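(* Let $\kappa\in\mathbb R$ and $\tau>0$ with $\kappa\ne\tau^2$, and let $\gamma$ be a geodesic in $M^3(\kappa,\tau)$ with slope angle $\theta\in\,]0,\pi[$. Then the following statements are equivalent: (i) $\gamma$ is isotropic; (ii) $\gamma$ does not admit any pair of conjugate points; (iii) $\gamma$ intersects each Hopf fiber only at a unique point.
   Context: $M^3(\kappa,\tau)$ denotes the connected, simply connected 3-dimensional Lie group whose Lie algebra has a basis $\{u_1,u_2,u_3\}$ with $[u_1,u_2]=\tau u_3$, $[u_2,u_3]=\frac{\kappa}{\tau}u_1$, $[u_3,u_1]=\frac{\kappa}{\tau}u_2$, equipped with the left-invariant Riemannian metric for which $\{u_1,u_2,u_3\}$ is orthonormal. $\xi=u_3$ is the Hopf vector field (a unit Killing field); its integral curves, which are geodesics, are the Hopf fibers. The slope angle of a unit-speed geodesic $\gamma$ is the (constant) angle $\theta\in[0,\pi]$ between $\gamma'$ and $\xi$. A Jacobi field along a geodesic is isotropic if it is the restriction to that geodesic of a Killing vector field. Two points $p,q$ are isotropically conjugate if there is a nonzero isotropic Jacobi field, along a geodesic passing through $p$ and $q$, that vanishes at these points. A geodesic starting at a point $p$ is isotropic if each of its conjugate points to $p$ is isotropic, i.e. isotropically conjugate to $p$; a geodesic without pairs of conjugate points is by definition regarded as isotropic.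
   Formalization: Condition (iii) is read as: γ meets each Hopf fiber for at most one parameter value; read as one point of the image, (iii) also holds for some closed geodesics that have conjugate points (e.g. τ=1, κ=100, cos²θ=1/99), so the equivalence would fail. *)

theory Defs
  imports "HOL-Analysis.Analysis" "HOL-Algebra.Group"
begin

section \<open>Smooth maps between Euclidean spaces\<close>

text \<open>Intended for open \<open>S\<close> only: the derivative is the unrestricted one at \<open>x\<close>.\<close>

fun Ck_on :: "nat \<Rightarrow> 'e::euclidean_space set \<Rightarrow> ('e \<Rightarrow> 'f::euclidean_space) \<Rightarrow> bool" where
  "Ck_on 0 S f \<longleftrightarrow> continuous_on S f"
| "Ck_on (Suc k) S f \<longleftrightarrow>
     (\<forall>x\<in>S. f differentiable (at x)) \<and>
     (\<forall>v. Ck_on k S (\<lambda>x. frechet_derivative f (at x) v))"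

definition smooth_on :: "'e::euclidean_space set \<Rightarrow> ('e \<Rightarrow> 'f::euclidean_space) \<Rightarrow> bool" where
  "smooth_on S f \<longleftrightarrow> (\<forall>k. Ck_on k S f)"

section \<open>Smooth manifolds\<close>

text \<open>The points of a manifold form a whole type, Hausdorff and second countable by type class.
  An atlas is a set of pairs (domain, chart), not necessarily maximal.\<close>

type_synonym ('a, 'e) atlas = "('a set \<times> ('a \<Rightarrow> 'e)) set"

definition smooth_atlas ::
  "('a::{t2_space, second_countable_topology}, 'e::euclidean_space) atlas \<Rightarrow> bool" where
  "smooth_atlas A \<longleftrightarrow>
     (\<forall>(U, \<phi>)\<in>A. open U \<and> open (\<phi> ` U) \<and> homeomorphism U (\<phi> ` U) \<phi> (inv_into U \<phi>)) \<and>
     (\<Union>(U, \<phi>)\<in>A. U) = UNIV \<and>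
     (\<forall>(U, \<phi>)\<in>A. \<forall>(V, \<psi>)\<in>A. smooth_on (\<phi> ` (U \<inter> V)) (\<psi> \<circ> inv_into U \<phi>))"

definition euclidean_atlas :: "('e::euclidean_space, 'e) atlas" where
  "euclidean_atlas = {(UNIV, id)}"

definition product_atlas ::
  "('a, 'e) atlas \<Rightarrow> ('b, 'f) atlas \<Rightarrow> ('a \<times> 'b, 'e \<times> 'f) atlas" where
  "product_atlas A B = {(U \<times> V, map_prod \<phi> \<psi>) |U \<phi> V \<psi>. (U, \<phi>) \<in> A \<and> (V, \<psi>) \<in> B}"

definition smooth_map ::
  "('a::topological_space, 'e::euclidean_space) atlas \<Rightarrow>
   ('b::topological_space, 'f::euclidean_space) atlas \<Rightarrow> ('a \<Rightarrow> 'b) \<Rightarrow> bool" where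
  "smooth_map A B F \<longleftrightarrow>
     continuous_on UNIV F \<and>
     (\<forall>(U, \<phi>)\<in>A. \<forall>(V, \<psi>)\<in>B. smooth_on (\<phi> ` (U \<inter> F -` V)) (\<psi> \<circ> F \<circ> inv_into U \<phi>))"

definition smooth_functions ::
  "('a::topological_space, 'e::euclidean_space) atlas \<Rightarrow> ('a \<Rightarrow> real) set" where
  "smooth_functions A = {f. smooth_map A euclidean_atlas f}"

definition smooth_curve ::
  "('a::topological_space, 'e::euclidean_space) atlas \<Rightarrow> (real \<Rightarrow> 'a) \<Rightarrow> bool" where
  "smooth_curve A \<gamma> \<longleftrightarrow> smooth_map euclidean_atlas A \<gamma>"

section \<open>Tangent vectors and vector fields\<close>

text \<open>Tangent vectors are derivations of the algebra of smooth functions. They are extended by 0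
  to non-smooth functions, so that equality of tangent vectors is equality in HOL.\<close>

type_synonym 'a tvec = "('a \<Rightarrow> real) \<Rightarrow> real"
type_synonym 'a vfield = "'a \<Rightarrow> 'a tvec"

definition tangent_space ::
  "('a::topological_space, 'e::euclidean_space) atlas \<Rightarrow> 'a \<Rightarrow> 'a tvec set" where
  "tangent_space A p = {v.
     (\<forall>f\<in>smooth_functions A. \<forall>h\<in>smooth_functions A. \<forall>a b.
        v (\<lambda>q. a * f q + b * h q) = a * v f + b * v h) \<and>
     (\<forall>f\<in>smooth_functions A. \<forall>h\<in>smooth_functions A.
        v (\<lambda>q. f q * h q) = f p * v h + v f * h p) \<and>
     (\<forall>f. f \<notin> smooth_functions A \<longrightarrow> v f = 0)}"

definition vector_fields ::
  "('a::topological_space, 'e::euclidean_space) atlas \<Rightarrow> 'a vfield set" where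
  "vector_fields A = {X.
     (\<forall>p. X p \<in> tangent_space A p) \<and>
     (\<forall>f\<in>smooth_functions A. (\<lambda>p. X p f) \<in> smooth_functions A)}"

definition lie_bracket :: "'a vfield \<Rightarrow> 'a vfield \<Rightarrow> 'a vfield" where
  "lie_bracket X Y = (\<lambda>p f. X p (\<lambda>q. Y q f) - Y p (\<lambda>q. X q f))"

definition pushforward ::
  "('b::topological_space, 'f::euclidean_space) atlas \<Rightarrow> ('a \<Rightarrow> 'b) \<Rightarrow> 'a tvec \<Rightarrow> 'b tvec" where
  "pushforward B F v = (\<lambda>f. if f \<in> smooth_functions B then v (f \<circ> F) else 0)"

definition velocity ::
  "('a::topological_space, 'e::euclidean_space) atlas \<Rightarrow> (real \<Rightarrow> 'a) \<Rightarrow> real \<Rightarrow> 'a tvec" where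
  "velocity A \<gamma> t = (\<lambda>f. if f \<in> smooth_functions A then deriv (f \<circ> \<gamma>) t else 0)"

definition integral_curve ::
  "('a::topological_space, 'e::euclidean_space) atlas \<Rightarrow> 'a vfield \<Rightarrow> (real \<Rightarrow> 'a) \<Rightarrow> bool" where
  "integral_curve A X \<beta> \<longleftrightarrow> smooth_curve A \<beta> \<and> (\<forall>t. velocity A \<beta> t = X (\<beta> t))"

section \<open>Riemannian metrics and the Levi-Civita connection\<close>

type_synonym 'a metric = "'a \<Rightarrow> 'a tvec \<Rightarrow> 'a tvec \<Rightarrow> real"

definition riemannian_metric ::
  "('a::topological_space, 'e::euclidean_space) atlas \<Rightarrow> 'a metric \<Rightarrow> bool" where
  "riemannian_metric A g \<longleftrightarrow>
     (\<forall>p. \<forall>v\<in>tangent_space A p. \<forall>w\<in>tangent_space A p. g p v w = g p w v) \<and>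
     (\<forall>p. \<forall>v\<in>tangent_space A p. \<forall>w\<in>tangent_space A p. \<forall>z\<in>tangent_space A p. \<forall>a b.
        g p (\<lambda>f. a * v f + b * w f) z = a * g p v z + b * g p w z) \<and>
     (\<forall>p. \<forall>v\<in>tangent_space A p. v \<noteq> (\<lambda>f. 0) \<longrightarrow> g p v v > 0) \<and>
     (\<forall>X\<in>vector_fields A. \<forall>Y\<in>vector_fields A. (\<lambda>p. g p (X p) (Y p)) \<in> smooth_functions A)"

text \<open>\<open>D p v Y\<close> is the covariant derivative at \<open>p\<close> of the vector field \<open>Y\<close> in the direction of the
  tangent vector \<open>v\<close> at \<open>p\<close>.\<close>

type_synonym 'a connection = "'a \<Rightarrow> 'a tvec \<Rightarrow> 'a vfield \<Rightarrow> 'a tvec"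

definition affine_connection ::
  "('a::topological_space, 'e::euclidean_space) atlas \<Rightarrow> 'a connection \<Rightarrow> bool" where
  "affine_connection A D \<longleftrightarrow>
     (\<forall>p. \<forall>v\<in>tangent_space A p. \<forall>Y\<in>vector_fields A. D p v Y \<in> tangent_space A p) \<and>
     (\<forall>p. \<forall>v\<in>tangent_space A p. \<forall>w\<in>tangent_space A p. \<forall>Y\<in>vector_fields A. \<forall>a b.
        D p (\<lambda>f. a * v f + b * w f) Y = (\<lambda>f. a * D p v Y f + b * D p w Y f)) \<and>
     (\<forall>p. \<forall>v\<in>tangent_space A p. \<forall>Y\<in>vector_fields A. \<forall>Z\<in>vector_fields A.
        D p v (\<lambda>q f. Y q f + Z q f) = (\<lambda>f. D p v Y f + D p v Z f)) \<and>
     (\<forall>p. \<forall>v\<in>tangent_space A p. \<forall>Y\<in>vector_fields A. \<forall>h\<in>smooth_functions A.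
        D p v (\<lambda>q f. h q * Y q f) = (\<lambda>f. v h * Y p f + h p * D p v Y f)) \<and>
     (\<forall>X\<in>vector_fields A. \<forall>Y\<in>vector_fields A. (\<lambda>p. D p (X p) Y) \<in> vector_fields A)"

definition levi_civita ::
  "('a::topological_space, 'e::euclidean_space) atlas \<Rightarrow> 'a metric \<Rightarrow> 'a connection \<Rightarrow> bool" where
  "levi_civita A g D \<longleftrightarrow>
     affine_connection A D \<and>
     (\<forall>X\<in>vector_fields A. \<forall>Y\<in>vector_fields A. \<forall>p f.
        D p (X p) Y f - D p (Y p) X f = lie_bracket X Y p f) \<and>
     (\<forall>p. \<forall>v\<in>tangent_space A p. \<forall>Y\<in>vector_fields A. \<forall>Z\<in>vector_fields A.
        v (\<lambda>q. g q (Y q) (Z q)) = g p (D p v Y) (Z p) + g p (Y p) (D p v Z))"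

text \<open>\<open>W\<close> is the covariant derivative of the vector field \<open>V\<close> along \<open>\<gamma>\<close>. Every smooth field along a
  curve is a finite combination of restrictions of vector fields \<open>E i\<close>, with smooth functions of
  the parameter as coefficients. The Leibniz rule then determines its covariant derivative, and
  the result does not depend on the chosen combination. In particular the relation forces \<open>V\<close> to
  be a smooth field along \<open>\<gamma>\<close>.\<close>

definition covariant_derivative_along ::
  "('a::topological_space, 'e::euclidean_space) atlas \<Rightarrow> 'a connection \<Rightarrow> (real \<Rightarrow> 'a) \<Rightarrow>
   (real \<Rightarrow> 'a tvec) \<Rightarrow> (real \<Rightarrow> 'a tvec) \<Rightarrow> bool" where
  "covariant_derivative_along A D \<gamma> V W \<longleftrightarrow>
     (\<exists>(n::nat) (c :: nat \<Rightarrow> real \<Rightarrow> real) (E :: nat \<Rightarrow> 'a vfield).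
        (\<forall>i<n. smooth_on UNIV (c i) \<and> E i \<in> vector_fields A) \<and>
        V = (\<lambda>t f. \<Sum>i<n. c i t * E i (\<gamma> t) f) \<and>
        W = (\<lambda>t f. \<Sum>i<n. deriv (c i) t * E i (\<gamma> t) f
                          + c i t * D (\<gamma> t) (velocity A \<gamma> t) (E i) f))"

definition curvature_field ::
  "'a connection \<Rightarrow> 'a vfield \<Rightarrow> 'a vfield \<Rightarrow> 'a vfield \<Rightarrow> 'a vfield" where
  "curvature_field D X Y Z = (\<lambda>p f.
     D p (X p) (\<lambda>q. D q (Y q) Z) f - D p (Y p) (\<lambda>q. D q (X q) Z) f
       - D p (lie_bracket X Y p) Z f)"

text \<open>The value at tangent vectors; well defined since the curvature is a tensor field and every
  tangent vector extends to a vector field.\<close>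

definition curvature ::
  "('a::topological_space, 'e::euclidean_space) atlas \<Rightarrow> 'a connection \<Rightarrow> 'a \<Rightarrow>
   'a tvec \<Rightarrow> 'a tvec \<Rightarrow> 'a tvec \<Rightarrow> 'a tvec" where
  "curvature A D p x y z = (THE r.
     \<forall>X\<in>vector_fields A. \<forall>Y\<in>vector_fields A. \<forall>Z\<in>vector_fields A.
       X p = x \<and> Y p = y \<and> Z p = z \<longrightarrow> r = curvature_field D X Y Z p)"

section \<open>Geodesics, Jacobi fields and conjugate points\<close>

text \<open>Geodesics are parametrized by arc length and defined on the whole line (left-invariant
  metrics are complete).\<close>

definition unit_speed_geodesic ::
  "('a::topological_space, 'e::euclidean_space) atlas \<Rightarrow> 'a metric \<Rightarrow> 'a connection \<Rightarrow>
   (real \<Rightarrow> 'a) \<Rightarrow> bool" where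
  "unit_speed_geodesic A g D \<gamma> \<longleftrightarrow>
     smooth_curve A \<gamma> \<and>
     covariant_derivative_along A D \<gamma> (velocity A \<gamma>) (\<lambda>t f. 0) \<and>
     (\<forall>t. g (\<gamma> t) (velocity A \<gamma> t) (velocity A \<gamma> t) = 1)"

definition jacobi_field ::
  "('a::topological_space, 'e::euclidean_space) atlas \<Rightarrow> 'a connection \<Rightarrow> (real \<Rightarrow> 'a) \<Rightarrow>
   (real \<Rightarrow> 'a tvec) \<Rightarrow> bool" where
  "jacobi_field A D \<gamma> J \<longleftrightarrow>
     (\<exists>J' J''. covariant_derivative_along A D \<gamma> J J' \<and> covariant_derivative_along A D \<gamma> J' J'' \<and>
        (\<forall>t f. J'' t f + curvature A D (\<gamma> t) (J t) (velocity A \<gamma> t) (velocity A \<gamma> t) f = 0))"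

definition conjugate_along ::
  "('a::topological_space, 'e::euclidean_space) atlas \<Rightarrow> 'a connection \<Rightarrow> (real \<Rightarrow> 'a) \<Rightarrow>
   real \<Rightarrow> real \<Rightarrow> bool" where
  "conjugate_along A D \<gamma> s t \<longleftrightarrow>
     s \<noteq> t \<and>
     (\<exists>J. jacobi_field A D \<gamma> J \<and> J \<noteq> (\<lambda>r f. 0) \<and> J s = (\<lambda>f. 0) \<and> J t = (\<lambda>f. 0))"

definition no_conjugate_pair ::
  "('a::topological_space, 'e::euclidean_space) atlas \<Rightarrow> 'a connection \<Rightarrow> (real \<Rightarrow> 'a) \<Rightarrow> bool" where
  "no_conjugate_pair A D \<gamma> \<longleftrightarrow> \<not> (\<exists>s t. conjugate_along A D \<gamma> s t)"

section \<open>Isotropic geodesics\<close>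

text \<open>The Lie derivative of the metric along a Killing field vanishes.\<close>

definition killing_field ::
  "('a::topological_space, 'e::euclidean_space) atlas \<Rightarrow> 'a metric \<Rightarrow> 'a vfield \<Rightarrow> bool" where
  "killing_field A g X \<longleftrightarrow>
     X \<in> vector_fields A \<and>
     (\<forall>Y\<in>vector_fields A. \<forall>Z\<in>vector_fields A. \<forall>p.
        X p (\<lambda>q. g q (Y q) (Z q)) =
          g p (lie_bracket X Y p) (Z p) + g p (Y p) (lie_bracket X Z p))"

definition isotropic_jacobi_field ::
  "('a::topological_space, 'e::euclidean_space) atlas \<Rightarrow> 'a metric \<Rightarrow> 'a connection \<Rightarrow>
   (real \<Rightarrow> 'a) \<Rightarrow> (real \<Rightarrow> 'a tvec) \<Rightarrow> bool" where
  "isotropic_jacobi_field A g D \<gamma> J \<longleftrightarrow>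
     jacobi_field A D \<gamma> J \<and> (\<exists>X. killing_field A g X \<and> J = X \<circ> \<gamma>)"

definition isotropically_conjugate ::
  "('a::topological_space, 'e::euclidean_space) atlas \<Rightarrow> 'a metric \<Rightarrow> 'a connection \<Rightarrow>
   'a \<Rightarrow> 'a \<Rightarrow> bool" where
  "isotropically_conjugate A g D p q \<longleftrightarrow>
     (\<exists>\<sigma> s t J. unit_speed_geodesic A g D \<sigma> \<and> s \<noteq> t \<and> \<sigma> s = p \<and> \<sigma> t = q \<and>
        isotropic_jacobi_field A g D \<sigma> J \<and> J \<noteq> (\<lambda>r f. 0) \<and>
        J s = (\<lambda>f. 0) \<and> J t = (\<lambda>f. 0))"

text \<open>The starting point of \<open>\<gamma>\<close> is \<open>\<gamma> 0\<close>. A geodesic without pairs of conjugate points is isotropic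
  vacuously.\<close>

definition isotropic_geodesic ::
  "('a::topological_space, 'e::euclidean_space) atlas \<Rightarrow> 'a metric \<Rightarrow> 'a connection \<Rightarrow>
   (real \<Rightarrow> 'a) \<Rightarrow> bool" where
  "isotropic_geodesic A g D \<gamma> \<longleftrightarrow>
     (\<forall>t. conjugate_along A D \<gamma> 0 t \<longrightarrow> isotropically_conjugate A g D (\<gamma> 0) (\<gamma> t))"

section \<open>The Lie groups $M^3(\kappa,\tau)$\<close>

definition lie_group ::
  "'a::{t2_space, second_countable_topology} monoid \<Rightarrow> ('a, 'e::euclidean_space) atlas \<Rightarrow> bool" where
  "lie_group G A \<longleftrightarrow>
     group G \<and> carrier G = UNIV \<and> smooth_atlas A \<and>
     smooth_map (product_atlas A A) A (\<lambda>(x, y). x \<otimes>\<^bsub>G\<^esub> y) \<and>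
     smooth_map A A (\<lambda>x. inv\<^bsub>G\<^esub> x)"

definition lie_algebra ::
  "'a::{t2_space, second_countable_topology} monoid \<Rightarrow> ('a, 'e::euclidean_space) atlas \<Rightarrow>
   'a vfield set" where
  "lie_algebra G A = {X \<in> vector_fields A.
     \<forall>a p. pushforward A (\<lambda>q. a \<otimes>\<^bsub>G\<^esub> q) (X p) = X (a \<otimes>\<^bsub>G\<^esub> p)}"

definition left_invariant_metric ::
  "'a::{t2_space, second_countable_topology} monoid \<Rightarrow> ('a, 'e::euclidean_space) atlas \<Rightarrow>
   'a metric \<Rightarrow> bool" where
  "left_invariant_metric G A g \<longleftrightarrow>
     riemannian_metric A g \<and>
     (\<forall>a p. \<forall>v\<in>tangent_space A p. \<forall>w\<in>tangent_space A p.
        g (a \<otimes>\<^bsub>G\<^esub> p) (pushforward A (\<lambda>q. a \<otimes>\<^bsub>G\<^esub> q) v) (pushforward A (\<lambda>q. a \<otimes>\<^bsub>G\<^esub> q) w)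
          = g p v w)"

text \<open>The library predicate \<^const>\<open>simply_connected\<close> only concerns loops; here they are freely
  homotopic to each other. The type \<open>3\<close> is the index set of the basis.\<close>

definition is_M3 ::
  "real \<Rightarrow> real \<Rightarrow> 'a::{t2_space, second_countable_topology} monoid \<Rightarrow> ('a, real^3) atlas \<Rightarrow>
   'a metric \<Rightarrow> (3 \<Rightarrow> 'a vfield) \<Rightarrow> bool" where
  "is_M3 \<kappa> \<tau> G A g u \<longleftrightarrow>
     lie_group G A \<and>
     connected (UNIV :: 'a set) \<and> simply_connected (UNIV :: 'a set) \<and>
     (\<forall>i. u i \<in> lie_algebra G A) \<and>
     (\<forall>X\<in>lie_algebra G A. \<exists>!c :: real^3. X = (\<lambda>p f. \<Sum>i\<in>UNIV. c $ i * u i p f)) \<and>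
     lie_bracket (u 1) (u 2) = (\<lambda>p f. \<tau> * u 3 p f) \<and>
     lie_bracket (u 2) (u 3) = (\<lambda>p f. \<kappa> / \<tau> * u 1 p f) \<and>
     lie_bracket (u 3) (u 1) = (\<lambda>p f. \<kappa> / \<tau> * u 2 p f) \<and>
     left_invariant_metric G A g \<and>
     (\<forall>p i j. g p (u i p) (u j p) = (if i = j then 1 else 0))"

text \<open>The Hopf vector field is \<open>u 3\<close>.\<close>

definition hopf_fiber ::
  "('a::topological_space, 'e::euclidean_space) atlas \<Rightarrow> (3 \<Rightarrow> 'a vfield) \<Rightarrow> 'a set \<Rightarrow> bool" where
  "hopf_fiber A u F \<longleftrightarrow> (\<exists>\<beta>. integral_curve A (u 3) \<beta> \<and> F = range \<beta>)"

definition angle :: "'a metric \<Rightarrow> 'a \<Rightarrow> 'a tvec \<Rightarrow> 'a tvec \<Rightarrow> real" where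
  "angle g p v w = arccos (g p v w / (sqrt (g p v v) * sqrt (g p w w)))"

definition slope_angle ::
  "('a::topological_space, 'e::euclidean_space) atlas \<Rightarrow> 'a metric \<Rightarrow> (3 \<Rightarrow> 'a vfield) \<Rightarrow>
   (real \<Rightarrow> 'a) \<Rightarrow> real \<Rightarrow> bool" where
  "slope_angle A g u \<gamma> \<theta> \<longleftrightarrow> (\<forall>t. angle g (\<gamma> t) (velocity A \<gamma> t) (u 3 (\<gamma> t)) = \<theta>)"

text \<open>Uniqueness refers to the parameter: each fiber is met at no more than one time. The
  analogous condition on the image of \<open>\<gamma>\<close> would be satisfied by certain closed geodesics of Berger
  spheres, which return to a fiber only at the same point and have conjugate points.\<close>

definition meets_each_fiber_once ::
  "('a::topological_space, 'e::euclidean_space) atlas \<Rightarrow> (3 \<Rightarrow> 'a vfield) \<Rightarrow>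
   (real \<Rightarrow> 'a) \<Rightarrow> bool" where
  "meets_each_fiber_once A u \<gamma> \<longleftrightarrow>
     (\<forall>F. hopf_fiber A u F \<longrightarrow> (\<forall>s t. \<gamma> s \<in> F \<and> \<gamma> t \<in> F \<longrightarrow> s = t))"

end

(* Write v for the velocity of the geodesic in the left-invariant frame, c for its vertical component cos theta and
   S = 1 - c^2. The horizontal part of v rotates with constant speed, and along the geodesic the Jacobi equation is a
   linear system with constant coefficients in the frame turning with v; its transverse component satisfies
   p'' + K p = const with K = kappa S + tau^2 c^2. The sign of K decides all three conditions.

   If K <= 0, an energy argument excludes conjugate points. The vertical component of a right-invariant field is constant
   on Hopf fibers, and for a suitable right-invariant field it is strictly monotone along the geodesic, so that no fiber
   is met twice.

   If K > 0, put k = sqrt K. Since kappa differs from tau^2, the equation tan x = nu x with nu = 1 - K / tau^2 has a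
   solution that gives a conjugate point at time T = 2x/k with sin (k T) nonzero. A Killing field vanishing at the starting
   point is a rotation about the fiber, hence along the geodesic its transverse component is a multiple of sin (k t), so
   it does not vanish at T and the conjugate point is not isotropic. Finally the geodesic is an explicit product of
   one-parameter subgroups, from which it is seen to return to the initial fiber at time 2 pi / k. *)

theory Submission
  imports Defs
begin

section \<open>Calculus of smooth maps\<close>

text \<open>The definitions are abstract: derivations, an arbitrary atlas, any group with the stated
  brackets. No matrix model is chosen. Everything is moved into the left-invariant frame, where
  fields along a curve become maps into \<open>real^3\<close> and brackets, connection and curvature
  become the algebraic maps \<open>Lam\<close>, \<open>Gam\<close> and \<open>Rm\<close>. The price
  is the calculus that brings derivations into charts.

  Three points shape the rest. Isotropic conjugacy allows a geodesic other than \<gamma> through the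
  two points, so only the zeros of the Killing field at these points are available. The number \<nu>
  comes from asking that the vertical component of a Jacobi field vanish together with the
  transverse one; it is nonzero because \<kappa> differs from \<tau>^2. The return to the fiber
  rests on a full turn about the fiber having trivial adjoint action, so that it survives
  conjugation; the conjugation divides by \<kappa>, hence the nilpotent group \<kappa> = 0 is
  treated in coordinates of its own.\<close>

lemma Ck_on_Suc_imp: "Ck_on (Suc k) S f \<Longrightarrow> Ck_on k S f"
proof (induction k arbitrary: f)
  case 0
  then show ?case
    by (auto intro!: continuous_at_imp_continuous_on differentiable_imp_continuous_within)
next
  case (Suc k)
  show ?case
    unfolding Ck_on.simps(2)
  proof (intro conjI allI)
    show "\<forall>x\<in>S. f differentiable at x" using Suc.prems by simp
    fix v show "Ck_on k S (\<lambda>x. frechet_derivative f (at x) v)"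
      using Suc.prems Ck_on.simps(2)[of "Suc k" S f] by (intro Suc.IH) blast
  qed
qed

lemma Ck_on_cong:
  assumes "open S" "Ck_on k S f" "\<And>x. x \<in> S \<Longrightarrow> f x = g x"
  shows "Ck_on k S g"
  using assms(2,3)
proof (induction k arbitrary: f g)
  case 0
  then show ?case by (simp cong: continuous_on_cong)
next
  case (Suc k)
  have d: "f differentiable at x" if "x \<in> S" for x using Suc.prems that by simp
  have hd: "(g has_derivative frechet_derivative f (at x)) (at x)" if "x \<in> S" for x
    using d[OF that] that \<open>open S\<close> Suc.prems(2)
    by (metis frechet_derivative_works has_derivative_transform_within_open)
  have eq: "frechet_derivative f (at x) = frechet_derivative g (at x)" if "x \<in> S" for x
    using frechet_derivative_at[OF hd[OF that]] .
  show ?case unfolding Ck_on.simps(2)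
  proof (intro conjI ballI allI)
    fix x assume "x \<in> S" then show "g differentiable at x" using hd unfolding differentiable_def by blast
  next
    fix v
    have "Ck_on k S (\<lambda>x. frechet_derivative f (at x) v)" using Suc.prems by simp
    then show "Ck_on k S (\<lambda>x. frechet_derivative g (at x) v)"
      by (rule Suc.IH) (simp add: eq)
  qed
qed

lemma Ck_on_SucI:
  assumes "open S" "\<And>x. x \<in> S \<Longrightarrow> (f has_derivative f' x) (at x)"
    and "\<And>v. Ck_on k S (\<lambda>x. f' x v)"
  shows "Ck_on (Suc k) S f"
  unfolding Ck_on.simps(2)
proof (intro conjI ballI allI)
  fix x assume "x \<in> S" then show "f differentiable at x" using assms(2) unfolding differentiable_def by blast
next
  fix v show "Ck_on k S (\<lambda>x. frechet_derivative f (at x) v)"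
    by (rule Ck_on_cong[OF assms(1) assms(3)[of v]]) (metis assms(2) frechet_derivative_at)
qed

lemma Ck_on_has_derivative:
  "Ck_on (Suc k) S f \<Longrightarrow> x \<in> S \<Longrightarrow> (f has_derivative frechet_derivative f (at x)) (at x)"
  by (simp add: frechet_derivative_works[symmetric])

lemma Ck_on_subset: "Ck_on k S f \<Longrightarrow> T \<subseteq> S \<Longrightarrow> Ck_on k T f"
  by (induction k arbitrary: f) (auto intro: continuous_on_subset)

lemma Ck_on_imp_continuous_on: "Ck_on k S f \<Longrightarrow> continuous_on S f"
  by (induction k) (use Ck_on_Suc_imp in \<open>auto simp del: Ck_on.simps(2)\<close>)

lemma Ck_on_local:
  assumes "\<And>x. x \<in> S \<Longrightarrow> \<exists>N. open N \<and> x \<in> N \<and> Ck_on k N f"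
  shows "Ck_on k S f"
  using assms
proof (induction k arbitrary: f)
  case 0
  show ?case unfolding Ck_on.simps(1)
  proof (rule continuous_at_imp_continuous_on, rule ballI)
    fix x assume "x \<in> S"
    then obtain N where "open N" "x \<in> N" "Ck_on 0 N f" using 0 by blast
    then show "isCont f x" by (simp add: continuous_on_eq_continuous_at)
  qed
next
  case (Suc k)
  have "f differentiable at x" if "x \<in> S" for x using Suc.prems[OF that] by auto
  moreover have "Ck_on k S (\<lambda>x. frechet_derivative f (at x) v)" for v
    using Suc.prems by (intro Suc.IH) fastforce
  ultimately show ?case by simp
qed

lemma Ck_on_const: "Ck_on k S (\<lambda>x. c)"
  by (induction k arbitrary: c) (simp_all add: frechet_derivative_const)

lemma Ck_on_bounded_linear:
  assumes "bounded_linear f" shows "Ck_on k S f"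
proof -
  have "Ck_on k UNIV f"
  proof (cases k)
    case 0 then show ?thesis using assms by (simp add: linear_continuous_on)
  next
    case (Suc j)
    show ?thesis unfolding Suc
      by (rule Ck_on_SucI[where f'="\<lambda>_. f"])
        (use assms Ck_on_const in \<open>auto intro: bounded_linear_imp_has_derivative\<close>)
  qed
  then show ?thesis by (rule Ck_on_subset) simp
qed

lemma Ck_on_id: "Ck_on k S (\<lambda>x. x)"
  by (rule Ck_on_bounded_linear) (rule bounded_linear_ident)

lemma Ck_on_add:
  assumes "open S" "Ck_on k S f" "Ck_on k S g" shows "Ck_on k S (\<lambda>x. f x + g x)"
  using assms(2,3)
proof (induction k arbitrary: f g)
  case 0 then show ?case by (simp add: continuous_on_add)
next
  case (Suc k)
  show ?case
    by (rule Ck_on_SucI[OF assms(1) has_derivative_add[OF Ck_on_has_derivative Ck_on_has_derivative]])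
      (use Suc in auto)
qed

lemma Ck_on_sum:
  assumes "open S" "\<And>i. i \<in> I \<Longrightarrow> Ck_on k S (f i)" shows "Ck_on k S (\<lambda>x. \<Sum>i\<in>I. f i x)"
  using assms(2)
  by (induction I rule: infinite_finite_induct) (auto intro: Ck_on_const Ck_on_add[OF assms(1)])

lemma Ck_on_bilinear:
  fixes prod :: "'a::euclidean_space \<Rightarrow> 'b::euclidean_space \<Rightarrow> 'c::euclidean_space"
    and f :: "'e::euclidean_space \<Rightarrow> 'a" and g :: "'e \<Rightarrow> 'b"
  assumes "bounded_bilinear prod" "open S" "Ck_on k S f" "Ck_on k S g"
  shows "Ck_on k S (\<lambda>x. prod (f x) (g x))"
  using assms(3,4)
proof (induction k arbitrary: f g)
  case 0 then show ?case by (simp add: bounded_bilinear.continuous_on[OF assms(1)])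
next
  case (Suc k)
  note s = Ck_on_Suc_imp[OF Suc.prems(1)] Ck_on_Suc_imp[OF Suc.prems(2)]
  show ?case
    by (rule Ck_on_SucI[OF assms(2) bounded_bilinear.FDERIV[OF assms(1) Ck_on_has_derivative[OF Suc.prems(1)] Ck_on_has_derivative[OF Suc.prems(2)]]])
      (use Suc.prems s in \<open>auto intro!: Ck_on_add[OF assms(2)] Suc.IH\<close>)
qed

lemmas Ck_on_scaleR = Ck_on_bilinear[OF bounded_bilinear_scaleR]
lemmas Ck_on_inner = Ck_on_bilinear[OF bounded_bilinear_inner]

lemma Ck_on_mult: fixes f g :: "'e::euclidean_space \<Rightarrow> real"
  shows "open S \<Longrightarrow> Ck_on k S f \<Longrightarrow> Ck_on k S g \<Longrightarrow> Ck_on k S (\<lambda>x. f x * g x)"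
  by (rule Ck_on_bilinear[OF bounded_bilinear_mult])

text \<open>In the chain rule the derivative of \<open>g\<close> is applied to a moving vector,
  while \<open>Ck_on\<close> controls derivatives in fixed directions only. Expanding the moving
  vector in the basis leaves products whose second factor is a composition covered by the induction
  hypothesis.\<close>

lemma Ck_on_compose:
  assumes "open S" "open T" "Ck_on k T g" "Ck_on k S f" "f ` S \<subseteq> T"
  shows "Ck_on k S (\<lambda>x. g (f x))"
  using assms(3-5)
proof (induction k arbitrary: f g)
  case 0 then show ?case by (auto intro: continuous_on_compose2)
next
  case (Suc k)
  have hd: "((\<lambda>x. g (f x)) has_derivative
      (\<lambda>v. \<Sum>b\<in>Basis. (frechet_derivative f (at x) v \<bullet> b) *\<^sub>R frechet_derivative g (at (f x)) b)) (at x)"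
    if "x \<in> S" for x
  proof -
    have g: "(g has_derivative frechet_derivative g (at (f x))) (at (f x))"
      using Suc.prems that by (intro Ck_on_has_derivative) auto
    have f: "(f has_derivative frechet_derivative f (at x)) (at x)"
      using Suc.prems that by (intro Ck_on_has_derivative) auto
    have lin: "linear (frechet_derivative g (at (f x)))"
      using g has_derivative_linear by blast
    have eq: "frechet_derivative g (at (f x)) w = (\<Sum>b\<in>Basis. (w \<bullet> b) *\<^sub>R frechet_derivative g (at (f x)) b)" for w
    proof -
      have "frechet_derivative g (at (f x)) (\<Sum>b\<in>Basis. (w \<bullet> b) *\<^sub>R b) = (\<Sum>b\<in>Basis. (w \<bullet> b) *\<^sub>R frechet_derivative g (at (f x)) b)"
        by (simp add: linear_sum[OF lin] linear_cmul[OF lin] del: euclidean_representation)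
      then show ?thesis by (simp add: euclidean_representation)
    qed
    have "((\<lambda>x. g (f x)) has_derivative (\<lambda>v. frechet_derivative g (at (f x)) (frechet_derivative f (at x) v))) (at x)"
      using has_derivative_compose[OF f g] .
    then show ?thesis unfolding eq[of "frechet_derivative f (at x) _"] .
  qed
  have f: "Ck_on k S f" using Ck_on_Suc_imp Suc.prems by blast
  show ?case
    apply (rule Ck_on_SucI[OF assms(1) hd], assumption)
    apply (rule Ck_on_sum[OF assms(1)])
    apply (rule Ck_on_scaleR[OF assms(1)])
    subgoal using Suc.prems by (intro Ck_on_inner assms(1) Ck_on_const) auto
    subgoal using Suc.prems f by (intro Suc.IH) auto
    done
qed

lemma Ck_on_minus:
  assumes "open S" "Ck_on k S f" shows "Ck_on k S (\<lambda>x. - f x)"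
  by (rule Ck_on_compose[OF assms(1) open_UNIV Ck_on_bounded_linear assms(2)])
    (auto intro: bounded_linear_minus bounded_linear_ident)

lemma Ck_on_diff:
  assumes "open S" "Ck_on k S f" "Ck_on k S g" shows "Ck_on k S (\<lambda>x. f x - g x)"
  using Ck_on_add[OF assms(1,2) Ck_on_minus[OF assms(1,3)]] by simp

lemma Ck_on_componentwise:
  assumes "open S" "\<And>b. b \<in> Basis \<Longrightarrow> Ck_on k S (\<lambda>x. f x \<bullet> b)"
  shows "Ck_on k S f"
proof -
  have "Ck_on k S (\<lambda>x. \<Sum>b\<in>Basis. (f x \<bullet> b) *\<^sub>R b)"
    by (intro Ck_on_sum Ck_on_scaleR assms Ck_on_const)
  then show ?thesis by (simp add: euclidean_representation)
qed

lemma Ck_on_Pair: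
  assumes "open S" "Ck_on k S f" "Ck_on k S g" shows "Ck_on k S (\<lambda>x. (f x, g x))"
proof -
  have "Ck_on k S (\<lambda>x. (f x, 0) + (0, g x))"
    apply (intro Ck_on_add assms)
     apply (rule Ck_on_compose[OF assms(1) open_UNIV Ck_on_bounded_linear assms(2)]; simp add: bounded_linear_Pair)
    apply (rule Ck_on_compose[OF assms(1) open_UNIV Ck_on_bounded_linear assms(3)]; simp add: bounded_linear_Pair)
    done
  then show ?thesis by simp
qed

lemma Ck_on_field_SucI:
  fixes f :: "real \<Rightarrow> real"
  assumes "open S" "\<And>x. x \<in> S \<Longrightarrow> (f has_real_derivative f' x) (at x)" "Ck_on k S f'"
  shows "Ck_on (Suc k) S f"
  by (rule Ck_on_SucI[OF assms(1), of f "\<lambda>x v. f' x * v"])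
    (use assms in \<open>auto simp: has_field_derivative_def intro!: Ck_on_mult Ck_on_const\<close>)

section \<open>Elementary functions and a smooth cutoff\<close>

lemma Ck_on_inverse: "Ck_on k (- {0}) (inverse :: real \<Rightarrow> real)"
proof (induction k)
  case 0 then show ?case by (auto intro!: continuous_intros)
next
  case (Suc k)
  show ?case
    by (rule Ck_on_field_SucI[where f'="\<lambda>x. - (inverse x * inverse x)"])
      (use Suc in \<open>auto intro!: Ck_on_minus Ck_on_mult derivative_eq_intros simp: power2_eq_square\<close>)
qed

lemma Ck_on_sin_cos: "Ck_on k UNIV (sin :: real \<Rightarrow> real) \<and> Ck_on k UNIV (cos :: real \<Rightarrow> real)"
proof (induction k)
  case 0 then show ?case by (auto intro!: continuous_intros)
next
  case (Suc k)
  have "Ck_on (Suc k) UNIV (sin :: real \<Rightarrow> real)"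
    by (rule Ck_on_field_SucI[where f'=cos]) (use Suc in \<open>auto intro!: derivative_eq_intros\<close>)
  moreover have "Ck_on (Suc k) UNIV (cos :: real \<Rightarrow> real)"
    by (rule Ck_on_field_SucI[where f'="\<lambda>x. - sin x"])
      (use Suc in \<open>auto intro!: derivative_eq_intros Ck_on_minus\<close>)
  ultimately show ?case by blast
qed

text \<open>The derivative of \<open>flat n\<close> is a linear combination of \<open>flat (n + 2)\<close> and \<open>flat (n + 1)\<close>, which
  gives smoothness at the origin by induction.\<close>

definition flat :: "nat \<Rightarrow> real \<Rightarrow> real" where
  "flat n x = (if x > 0 then inverse x ^ n * exp (- inverse x) else 0)"

lemma flat_nonneg: "flat n x \<ge> 0"
  by (simp add: flat_def)

lemma pow_le_fact_exp:
  assumes "(y::real) \<ge> 0" shows "y ^ n \<le> fact n * exp y"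
proof -
  have s: "(\<lambda>n. y ^ n /\<^sub>R fact n) sums exp y" by (rule exp_converges)
  have "sum (\<lambda>n. y ^ n /\<^sub>R fact n) {n} \<le> exp y"
    using s assms by (intro order_trans[OF sum_le_suminf]) (auto simp: sums_iff)
  then show ?thesis by (simp add: field_simps)
qed

text \<open>Quadratic decay is one order more than the difference quotient of \<open>flat n\<close>
  at 0 consumes, so that quotient tends to 0.\<close>

lemma flat_le: "x > 0 \<Longrightarrow> flat n x \<le> fact (n + 2) * x\<^sup>2"
proof -
  assume x: "x > 0"
  have "inverse x ^ (n + 2) \<le> fact (n + 2) * exp (inverse x)"
    using x by (intro pow_le_fact_exp) simp
  then have "inverse x ^ n * exp (- inverse x) \<le> fact (n + 2) * x\<^sup>2"
    using x by (simp add: exp_minus power_add power2_eq_square field_simps)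
  then show ?thesis using x by (simp add: flat_def)
qed

lemma flat_deriv: "(flat n has_real_derivative (flat (n + 2) x - n * flat (n + 1) x)) (at x)"
proof (cases x "0::real" rule: linorder_cases)
  case less
  have "((\<lambda>_. 0) has_real_derivative 0) (at x)" by simp
  then have "(flat n has_real_derivative 0) (at x)"
    by (rule has_field_derivative_transform_within_open[where S="{..<0}"]) (use less in \<open>auto simp: flat_def\<close>)
  then show ?thesis using less by (simp add: flat_def)
next
  case equal
  have "(\<lambda>h. flat n h / h) \<midarrow>0\<rightarrow> 0"
  proof (rule Lim_null_comparison)
    show "\<forall>\<^sub>F h in at 0. norm (flat n h / h) \<le> fact (n + 2) * \<bar>h\<bar>"
    proof (rule always_eventually, rule allI)
      fix h :: real
      show "norm (flat n h / h) \<le> fact (n + 2) * \<bar>h\<bar>"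
      proof (cases "h > 0")
        case True
        then have "flat n h / h \<le> fact (n + 2) * h"
          using flat_le[of h n] by (simp add: divide_le_eq power2_eq_square mult.assoc)
        then show ?thesis using True flat_nonneg[of n h] by simp
      qed (simp add: flat_def mult_nonneg_nonpos)
    qed
    show "((\<lambda>h. fact (n + 2) * \<bar>h\<bar>) \<longlongrightarrow> 0) (at (0::real))"
      by (auto intro!: tendsto_eq_intros)
  qed
  then have "(flat n has_real_derivative 0) (at 0)"
    by (simp add: DERIV_def flat_def)
  then show ?thesis using equal by (simp add: flat_def)
next
  case greater
  \<comment> \<open>The exponent \<open>n - 1\<close> is truncated; after one more factor
    \<open>inverse x\<close> the identity also holds for \<open>n = 0\<close>.\<close>
  have e: "n * inverse x ^ (n - 1) * inverse x = n * inverse x ^ n" by (cases n) auto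
  have "((\<lambda>x. inverse x ^ n * exp (- inverse x)) has_real_derivative
     n * inverse x ^ (n - 1) * (- (inverse x * inverse x)) * exp (- inverse x)
       + inverse x ^ n * (exp (- inverse x) * (inverse x * inverse x))) (at x)"
    using greater by (auto intro!: derivative_eq_intros simp: power2_eq_square)
  also have "n * inverse x ^ (n - 1) * (- (inverse x * inverse x)) * exp (- inverse x)
     = - ((n * inverse x ^ (n - 1) * inverse x) * inverse x * exp (- inverse x))" by (simp add: algebra_simps)
  finally have "((\<lambda>x. inverse x ^ n * exp (- inverse x)) has_real_derivative
     (inverse x ^ (n+2) * exp (- inverse x) - n * (inverse x ^ (n+1) * exp (- inverse x)))) (at x)"
    unfolding e by (simp add: algebra_simps power_add power2_eq_square)
  then have "(flat n has_real_derivative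
     (inverse x ^ (n+2) * exp (- inverse x) - n * (inverse x ^ (n+1) * exp (- inverse x)))) (at x)"
    by (rule has_field_derivative_transform_within_open[where S="{0<..}"]) (use greater in \<open>auto simp: flat_def\<close>)
  then show ?thesis using greater by (simp add: flat_def)
qed

lemma Ck_on_flat: "Ck_on k UNIV (flat n)"
proof (induction k arbitrary: n)
  case 0 then show ?case
    using DERIV_isCont[OF flat_deriv] by (auto intro!: continuous_at_imp_continuous_on)
next
  case (Suc k)
  have "(flat n has_real_derivative (flat (n + 2) x + (- real n) * flat (n + 1) x)) (at x)" for x
    using flat_deriv[of n x] by simp
  then show ?case
    by (rule Ck_on_field_SucI[OF open_UNIV]) (intro Ck_on_add Ck_on_mult Ck_on_const Suc open_UNIV)
qed

text \<open>For every \<open>x\<close> at least one of \<open>2 - x\<close> and \<open>x - 1\<close>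
  is positive, so the denominator never vanishes.\<close>

definition step :: "real \<Rightarrow> real" where
  "step x = flat 0 (2 - x) * inverse (flat 0 (2 - x) + flat 0 (x - 1))"

lemma flat_pos_iff: "flat n x > 0 \<longleftrightarrow> x > 0"
  by (simp add: flat_def)

lemma step_eq_1: "x \<le> 1 \<Longrightarrow> step x = 1"
  and step_eq_0: "x \<ge> 2 \<Longrightarrow> step x = 0"
  using flat_pos_iff[of 0 "2 - x"] by (auto simp: step_def flat_def)

lemma Ck_on_diff_id: "Ck_on k S (\<lambda>x::real. c - x)" "Ck_on k S (\<lambda>x::real. x - c)" 
  if "open S"
  using Ck_on_add[OF that Ck_on_const[of k S c] Ck_on_bounded_linear[OF bounded_linear_minus[OF bounded_linear_ident]]]
    Ck_on_add[OF that Ck_on_id[of k S] Ck_on_const[of k S "- c"]] by auto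

lemma Ck_on_step: "Ck_on k UNIV step"
proof -
  have a: "Ck_on k UNIV (\<lambda>x::real. flat 0 (2 - x))" "Ck_on k UNIV (\<lambda>x::real. flat 0 (x - 1))"
    by (auto intro!: Ck_on_compose[OF open_UNIV open_UNIV Ck_on_flat] Ck_on_diff_id)
  have "flat 0 (2 - x) + flat 0 (x - 1) > 0" for x
    using flat_pos_iff[of 0 "2 - x"] flat_pos_iff[of 0 "x - 1"] flat_nonneg[of 0 "2 - x"] flat_nonneg[of 0 "x - 1"]
    by (cases "x < 2") linarith+
  then have "Ck_on k UNIV (\<lambda>x. inverse (flat 0 (2 - x) + flat 0 (x - 1)))"
    by (intro Ck_on_compose[OF open_UNIV _ Ck_on_inverse] Ck_on_add a) (auto simp: less_imp_neq order_less_irrefl neq_iff)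
  then have "Ck_on k UNIV (\<lambda>x. flat 0 (2 - x) * inverse (flat 0 (2 - x) + flat 0 (x - 1)))"
    by (intro Ck_on_mult a open_UNIV)
  then show ?thesis by (simp add: step_def[abs_def])
qed

section \<open>Hadamard's lemma\<close>

text \<open>Each differentiation under the integral sign produces a further factor \<open>t\<close>
  from the inner function, so the induction needs all powers \<open>t ^ j\<close> at once.\<close>

lemma Ck_on_integral_segment:
  fixes h :: "'e::euclidean_space \<Rightarrow> real"
  assumes "x0 \<in> B" "open B" "convex B" "Ck_on k B h"
  shows "Ck_on k B (\<lambda>x. integral {0..1} (\<lambda>t. t ^ j * h (x0 + t *\<^sub>R (x - x0))))"
  using assms(4)
proof (induction k arbitrary: h j)
  case 0
  have inB: "x0 + t *\<^sub>R (x - x0) \<in> B" if "x \<in> B" "t \<in> {0..1}" for x t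
    using convexD_alt[OF assms(3,1) that(1), of t] that(2) by (simp add: algebra_simps)
  have "continuous_on (B \<times> cbox 0 1) (\<lambda>(x, t). t ^ j * h (x0 + t *\<^sub>R (x - x0)))"
    unfolding case_prod_beta
    by (rule continuous_on_mult, (intro continuous_intros)[1],
        rule continuous_on_compose2[of B h], use 0 in simp, (intro continuous_intros)[1])
      (use inB in auto)
  then show ?case
    using integral_continuous_on_param[of B 0 1 "\<lambda>x t. t ^ j * h (x0 + t *\<^sub>R (x - x0))"] by simp
next
  case (Suc k)
  have inB: "x0 + t *\<^sub>R (x - x0) \<in> B" if "x \<in> B" "t \<in> {0..1}" for x t
    using convexD_alt[OF assms(3,1) that(1), of t] that(2) by (simp add: algebra_simps)
  define h' where "h' x = frechet_derivative h (at x)" for x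
  have h': "(h has_derivative h' x) (at x)" if "x \<in> B" for x
    using Suc.prems that unfolding h'_def by (rule Ck_on_has_derivative)
  have C: "Ck_on k B (\<lambda>x. h' x v)" for v using Suc.prems by (simp add: h'_def)
  define fx where "fx x t = Blinfun (\<lambda>v. t ^ (j + 1) * h' (x0 + t *\<^sub>R (x - x0)) v)" for x t
  have fx: "blinfun_apply (fx x t) = (\<lambda>v. t ^ (j + 1) * h' (x0 + t *\<^sub>R (x - x0)) v)" if "x \<in> B" "t \<in> {0..1}" for x t
    unfolding fx_def using h'[OF inB[OF that]]
    by (intro bounded_linear_Blinfun_apply bounded_linear_const_mult has_derivative_bounded_linear)
  have lin: "h' x (t *\<^sub>R v) = t * h' x v" if "x \<in> B" for x t v
    using linear_cmul[OF has_derivative_linear[OF h'[OF that]]] by simp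
  have cont: "continuous_on (B \<times> cbox 0 1) (\<lambda>(x, t). fx x t)"
  proof (rule continuous_on_blinfun_componentwise)
    fix i :: 'e
    have "continuous_on (B \<times> cbox 0 1) (\<lambda>(x, t). t ^ (j + 1) * h' (x0 + t *\<^sub>R (x - x0)) i)"
      unfolding case_prod_beta
      by (rule continuous_on_mult, (intro continuous_intros)[1],
          rule continuous_on_compose2[OF Ck_on_imp_continuous_on[OF C[of i]]], (intro continuous_intros)[1])
        (use inB in auto)
    then show "continuous_on (B \<times> cbox 0 1) (\<lambda>x. blinfun_apply (case x of (x, t) \<Rightarrow> fx x t) i)"
      by (rule continuous_on_eq) (auto simp: fx)
  qed
  have int: "(\<lambda>t. t ^ j * h (x0 + t *\<^sub>R (x - x0))) integrable_on cbox 0 1" if "x \<in> B" for x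
    by (rule integrable_continuous, rule continuous_on_mult, (intro continuous_intros)[1],
        rule continuous_on_compose2[OF Ck_on_imp_continuous_on[OF Suc.prems]], (intro continuous_intros)[1])
      (use inB that in auto)
  have der: "((\<lambda>x. t ^ j * h (x0 + t *\<^sub>R (x - x0))) has_derivative fx x t) (at x within B)"
    if "x \<in> B" "t \<in> cbox 0 1" for x t
  proof -
    have t: "t \<in> {0..1}" using that by simp
    have "((\<lambda>x. t ^ j * h (x0 + t *\<^sub>R (x - x0))) has_derivative (\<lambda>v. t ^ j * h' (x0 + t *\<^sub>R (x - x0)) (t *\<^sub>R v))) (at x)"
      by (rule has_derivative_mult_right, rule has_derivative_compose[where f="\<lambda>x. x0 + t *\<^sub>R (x - x0)" and g=h])
        (auto intro!: derivative_eq_intros h'[OF inB[OF that(1) t]])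
    then show ?thesis using lin[OF inB[OF that(1) t]]
      by (simp add: fx[OF that(1) t] has_derivative_at_withinI mult.assoc mult.left_commute)
  qed
  have res: "((\<lambda>x. integral {0..1} (\<lambda>t. t ^ j * h (x0 + t *\<^sub>R (x - x0)))) has_derivative
      (\<lambda>v. integral {0..1} (\<lambda>t. t ^ (j + 1) * h' (x0 + t *\<^sub>R (x - x0)) v))) (at x)" if "x \<in> B" for x
  proof -
    have "((\<lambda>x. integral (cbox 0 1) (\<lambda>t. t ^ j * h (x0 + t *\<^sub>R (x - x0)))) has_derivative
        integral (cbox 0 1) (fx x)) (at x within B)"
      by (rule leibniz_rule[OF der int cont that assms(3)])
    then have "((\<lambda>x. integral {0..1} (\<lambda>t. t ^ j * h (x0 + t *\<^sub>R (x - x0)))) has_derivative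
        integral {0..1} (fx x)) (at x)"
      unfolding at_within_open[OF that assms(2)] by simp
    moreover have i: "fx x integrable_on cbox 0 1"
      by (rule integrable_continuous) (rule continuous_on_compose2[OF cont, of _ "\<lambda>t. (x, t)", simplified], use that in \<open>auto intro!: continuous_intros\<close>)
    moreover have "blinfun_apply (integral {0..1} (fx x)) = (\<lambda>v. integral {0..1} (\<lambda>t. t ^ (j + 1) * h' (x0 + t *\<^sub>R (x - x0)) v))"
    proof
      fix v
      have "integral {0..1} (fx x) v = integral {0..1} (\<lambda>t. fx x t v)"
        using i by (simp add: blinfun_apply_integral)
      also have "\<dots> = integral {0..1} (\<lambda>t. t ^ (j + 1) * h' (x0 + t *\<^sub>R (x - x0)) v)"
        by (rule integral_cong) (use fx[OF that] in simp)
      finally show "integral {0..1} (fx x) v = integral {0..1} (\<lambda>t. t ^ (j + 1) * h' (x0 + t *\<^sub>R (x - x0)) v)" .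
    qed
    ultimately show ?thesis by simp
  qed
  show ?case
    by (rule Ck_on_SucI[OF assms(2) res]) (assumption, rule Suc.IH[OF C])
qed

text \<open>The fundamental theorem of calculus along the segment from \<open>x0\<close> to
  \<open>x\<close> expresses \<open>f x - f x0\<close> by averaged partial derivatives. These
  averages are the smooth coefficients, and at \<open>x0\<close> the averaged function is
  constant.\<close>

lemma hadamard:
  fixes f :: "'e::euclidean_space \<Rightarrow> real"
  assumes "x0 \<in> B" "open B" "convex B" "smooth_on B f"
  obtains h where "\<And>b. smooth_on B (h b)"
    "\<And>x. x \<in> B \<Longrightarrow> f x = f x0 + (\<Sum>b\<in>Basis. ((x - x0) \<bullet> b) * h b x)"
    "\<And>b. h b x0 = frechet_derivative f (at x0) b"
proof
  define f' where "f' x = frechet_derivative f (at x)" for x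
  define h where "h b x = integral {0..1} (\<lambda>t. t ^ 0 * f' (x0 + t *\<^sub>R (x - x0)) b)" for b x
  have C: "Ck_on k B f" for k using assms(4) by (simp add: smooth_on_def)
  have C': "Ck_on k B (\<lambda>x. f' x b)" for k b using C[of "Suc k"] by (simp add: f'_def)
  have f': "(f has_derivative f' x) (at x)" if "x \<in> B" for x
    using C that unfolding f'_def by (rule Ck_on_has_derivative)
  show "smooth_on B (h b)" for b
    unfolding smooth_on_def h_def using Ck_on_integral_segment[OF assms(1-3) C'] by blast
  show "h b x0 = frechet_derivative f (at x0) b" for b
    by (simp add: h_def f'_def)
  fix x assume x: "x \<in> B"
  have inB: "x0 + t *\<^sub>R (x - x0) \<in> B" if "t \<in> {0..1}" for t
    using convexD_alt[OF assms(3,1) x, of t] that by (simp add: algebra_simps)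
  have "((\<lambda>t. f' (x0 + t *\<^sub>R (x - x0)) (x - x0)) has_integral
      (f (x0 + 1 *\<^sub>R (x - x0)) - f (x0 + 0 *\<^sub>R (x - x0)))) {0..1}"
  proof (rule fundamental_theorem_of_calculus)
    fix t :: real assume t: "t \<in> {0..1}"
    have lin: "linear (f' (x0 + t *\<^sub>R (x - x0)))" using f'[OF inB[OF t]] has_derivative_linear by blast
    have "((\<lambda>t. f (x0 + t *\<^sub>R (x - x0))) has_derivative (\<lambda>s. f' (x0 + t *\<^sub>R (x - x0)) (s *\<^sub>R (x - x0)))) (at t)"
      by (rule has_derivative_compose[where f="\<lambda>t. x0 + t *\<^sub>R (x - x0)" and g=f])
        (auto intro!: derivative_eq_intros f'[OF inB[OF t]])
    then show "((\<lambda>t. f (x0 + t *\<^sub>R (x - x0))) has_vector_derivative f' (x0 + t *\<^sub>R (x - x0)) (x - x0)) (at t within {0..1})"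
      unfolding has_vector_derivative_def using linear_cmul[OF lin] by (simp add: has_derivative_at_withinI)
  qed simp
  then have "f x = f x0 + integral {0..1} (\<lambda>t. f' (x0 + t *\<^sub>R (x - x0)) (x - x0))"
    by (simp add: integral_unique)
  also have "integral {0..1} (\<lambda>t. f' (x0 + t *\<^sub>R (x - x0)) (x - x0))
     = integral {0..1} (\<lambda>t. \<Sum>b\<in>Basis. ((x - x0) \<bullet> b) * f' (x0 + t *\<^sub>R (x - x0)) b)"
  proof (rule integral_cong)
    fix t :: real assume t: "t \<in> {0..1}"
    have lin: "linear (f' (x0 + t *\<^sub>R (x - x0)))" using f'[OF inB[OF t]] has_derivative_linear by blast
    have "f' (x0 + t *\<^sub>R (x - x0)) (\<Sum>b\<in>Basis. ((x - x0) \<bullet> b) *\<^sub>R b) = (\<Sum>b\<in>Basis. ((x - x0) \<bullet> b) * f' (x0 + t *\<^sub>R (x - x0)) b)"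
      by (simp add: linear_sum[OF lin] linear_cmul[OF lin] del: euclidean_representation)
    then show "f' (x0 + t *\<^sub>R (x - x0)) (x - x0) = (\<Sum>b\<in>Basis. ((x - x0) \<bullet> b) * f' (x0 + t *\<^sub>R (x - x0)) b)"
      by (simp add: euclidean_representation)
  qed
  also have "\<dots> = (\<Sum>b\<in>Basis. ((x - x0) \<bullet> b) * h b x)"
  proof (subst integral_sum)
    fix b :: 'e
    have "continuous_on {0..1} (\<lambda>t. f' (x0 + t *\<^sub>R (x - x0)) b)"
      by (rule continuous_on_compose2[OF Ck_on_imp_continuous_on[OF C'[of 0 b]]], (intro continuous_intros)[1])
        (use inB in auto)
    then show "(\<lambda>t. (x - x0) \<bullet> b * f' (x0 + t *\<^sub>R (x - x0)) b) integrable_on {0..1}"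
      by (intro integrable_continuous_interval continuous_on_mult continuous_on_const)
  qed (simp_all add: h_def)
  finally show "f x = f x0 + (\<Sum>b\<in>Basis. ((x - x0) \<bullet> b) * h b x)" .
qed

section \<open>Symmetry of second derivatives\<close>

lemma Ck_on_dir_deriv:
  fixes f :: "'e::euclidean_space \<Rightarrow> real"
  assumes "Ck_on (Suc k) S f" "x + s *\<^sub>R v \<in> S"
  shows "((\<lambda>s. f (x + s *\<^sub>R v)) has_real_derivative frechet_derivative f (at (x + s *\<^sub>R v)) v) (at s)"
proof -
  have hd: "(f has_derivative frechet_derivative f (at (x + s *\<^sub>R v))) (at (x + s *\<^sub>R v))"
    using assms by (rule Ck_on_has_derivative)
  have "((\<lambda>s. f (x + s *\<^sub>R v)) has_derivative (\<lambda>h. frechet_derivative f (at (x + s *\<^sub>R v)) (h *\<^sub>R v))) (at s)"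
    by (rule has_derivative_compose[where f="\<lambda>s. x + s *\<^sub>R v" and g=f])
      (auto intro!: derivative_eq_intros hd)
  then show ?thesis
    using linear_cmul[OF has_derivative_linear[OF hd]] by (simp add: has_field_derivative_def mult.commute[of _ "frechet_derivative f _ v"] fun_eq_iff)
qed

text \<open>The mean value theorem is used twice: in direction \<open>v\<close> for the increment of
  \<open>f\<close> by \<open>h *\<^sub>R w\<close>, and in direction \<open>w\<close> for the
  derivative this produces.\<close>

lemma second_difference:
  fixes f :: "'e::euclidean_space \<Rightarrow> real"
  assumes "Ck_on 2 S f" "h > 0" "\<And>s t. 0 \<le> s \<Longrightarrow> s \<le> h \<Longrightarrow> 0 \<le> t \<Longrightarrow> t \<le> h \<Longrightarrow> x + s *\<^sub>R v + t *\<^sub>R w \<in> S"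
  obtains s t where "0 \<le> s" "s \<le> h" "0 \<le> t" "t \<le> h"
    "f (x + h *\<^sub>R v + h *\<^sub>R w) - f (x + h *\<^sub>R w) - f (x + h *\<^sub>R v) + f x
     = h\<^sup>2 * frechet_derivative (\<lambda>x. frechet_derivative f (at x) v) (at (x + s *\<^sub>R v + t *\<^sub>R w)) w"
proof -
  define f' where "f' y = frechet_derivative f (at y) v" for y
  have f1: "Ck_on (Suc 1) S f" using assms(1) by (simp add: numeral_2_eq_2)
  then have f'1: "Ck_on (Suc 0) S f'" unfolding f'_def by simp
  define F where "F s = f (x + s *\<^sub>R v + h *\<^sub>R w) - f (x + s *\<^sub>R v)" for s
  have "\<exists>s>0. s < h \<and> F h - F 0 = (h - 0) * (f' (x + s *\<^sub>R v + h *\<^sub>R w) - f' (x + s *\<^sub>R v))"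
  proof (rule MVT2)
    fix s assume s: "0 \<le> s" "s \<le> h"
    have "x + h *\<^sub>R w + s *\<^sub>R v \<in> S" "x + s *\<^sub>R v \<in> S"
      using assms(3)[OF s, of h] assms(3)[OF s, of 0] assms(2) by (auto simp: algebra_simps)
    from Ck_on_dir_deriv[OF f1 this(1)] Ck_on_dir_deriv[OF f1 this(2)]
    show "(F has_real_derivative f' (x + s *\<^sub>R v + h *\<^sub>R w) - f' (x + s *\<^sub>R v)) (at s)"
      unfolding F_def[abs_def] f'_def by (intro DERIV_diff) (simp_all add: algebra_simps)
  qed (use assms in auto)
  then obtain s where s: "0 < s" "s < h" "F h - F 0 = h * (f' (x + s *\<^sub>R v + h *\<^sub>R w) - f' (x + s *\<^sub>R v))" by auto
  have "\<exists>t>0. t < h \<and> f' (x + s *\<^sub>R v + h *\<^sub>R w) - f' (x + s *\<^sub>R v + 0 *\<^sub>R w) = (h - 0) * frechet_derivative f' (at (x + s *\<^sub>R v + t *\<^sub>R w)) w"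
    by (rule MVT2) (use assms s in \<open>auto intro!: Ck_on_dir_deriv[OF f'1]\<close>)
  then obtain t where "0 < t" "t < h" "f' (x + s *\<^sub>R v + h *\<^sub>R w) - f' (x + s *\<^sub>R v) = h * frechet_derivative f' (at (x + s *\<^sub>R v + t *\<^sub>R w)) w" by auto
  with s show ?thesis
    by (intro that[of s t]) (auto simp: F_def f'_def[abs_def] power2_eq_square)
qed

text \<open>The second difference is symmetric in \<open>v\<close> and \<open>w\<close>, so the two
  iterated derivatives take equal values at points arbitrarily close to \<open>x\<close>. By
  continuity this excludes different values at \<open>x\<close>.\<close>

lemma mixed_derivatives_commute:
  fixes f :: "'e::euclidean_space \<Rightarrow> real"
  assumes "Ck_on 2 S f" "open S" "x \<in> S"
  shows "frechet_derivative (\<lambda>x. frechet_derivative f (at x) v) (at x) w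
       = frechet_derivative (\<lambda>x. frechet_derivative f (at x) w) (at x) v"
proof (rule ccontr)
  define A where "A y = frechet_derivative (\<lambda>x. frechet_derivative f (at x) v) (at y) w" for y
  define B where "B y = frechet_derivative (\<lambda>x. frechet_derivative f (at x) w) (at y) v" for y
  assume "\<not> ?thesis"
  then have ne: "\<bar>A x - B x\<bar> > 0" by (simp add: A_def B_def)
  have "Ck_on 0 S A" "Ck_on 0 S B"
    using assms(1) unfolding numeral_2_eq_2 A_def B_def by simp_all
  then have "isCont A x" "isCont B x" using assms by (auto simp: continuous_on_eq_continuous_at)
  then obtain d1 d2 where d: "d1 > 0" "\<And>y. dist y x < d1 \<Longrightarrow> dist (A y) (A x) < \<bar>A x - B x\<bar> / 2"
      "d2 > 0" "\<And>y. dist y x < d2 \<Longrightarrow> dist (B y) (B x) < \<bar>A x - B x\<bar> / 2"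
    unfolding continuous_at_eps_delta using ne by (metis half_gt_zero)
  obtain r where r: "r > 0" "ball x r \<subseteq> S" using assms by (meson openE)
  define \<delta> where "\<delta> = min r (min d1 d2)"
  have \<delta>: "\<delta> > 0" using r d by (simp add: \<delta>_def)
  \<comment> \<open>Keeps the parallelogram spanned by \<open>h *\<^sub>R v\<close> and
    \<open>h *\<^sub>R w\<close> within distance \<delta> of \<open>x\<close>; the summand 1 covers
    \<open>v = w = 0\<close>.\<close>
  define h where "h = \<delta> / (2 * (norm v + norm w + 1))"
  have nn: "norm v + norm w + 1 > 0" by (smt (verit) norm_ge_zero)
  have h: "h > 0" using \<delta> nn by (simp add: h_def)
  have near: "dist (x + s *\<^sub>R v + t *\<^sub>R w) x < \<delta>" if "0 \<le> s" "s \<le> h" "0 \<le> t" "t \<le> h" for s t v' w'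
  proof -
    have "dist (x + s *\<^sub>R v + t *\<^sub>R w) x = norm (s *\<^sub>R v + t *\<^sub>R w)" by (simp add: dist_norm algebra_simps)
    also have "\<dots> \<le> s * norm v + t * norm w" using that norm_triangle_ineq[of "s *\<^sub>R v" "t *\<^sub>R w"] by simp
    also have "\<dots> \<le> h * norm v + h * norm w" using that by (intro add_mono mult_right_mono) auto
    also have "\<dots> < 2 * (h * (norm v + norm w + 1))" using h nn
      by (smt (verit) distrib_left mult_pos_pos mult_nonneg_nonneg norm_ge_zero mult.right_neutral)
    also have "\<dots> = \<delta>" using nn by (simp add: h_def field_simps)
    finally show ?thesis .
  qed
  have inS: "x + s *\<^sub>R v + t *\<^sub>R w \<in> S" if "0 \<le> s" "s \<le> h" "0 \<le> t" "t \<le> h" for s t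
    using near[OF that] r by (auto simp: \<delta>_def dist_commute subset_iff)
  obtain s t where st: "0 \<le> s" "s \<le> h" "0 \<le> t" "t \<le> h"
    "f (x + h *\<^sub>R v + h *\<^sub>R w) - f (x + h *\<^sub>R w) - f (x + h *\<^sub>R v) + f x = h\<^sup>2 * A (x + s *\<^sub>R v + t *\<^sub>R w)"
    unfolding A_def using second_difference[OF assms(1) h inS] by blast
  have inS': "x + s *\<^sub>R w + t *\<^sub>R v \<in> S" if "0 \<le> s" "s \<le> h" "0 \<le> t" "t \<le> h" for s t
    using inS[OF that(3,4,1,2)] by (simp add: algebra_simps)
  obtain s' t' where st': "0 \<le> s'" "s' \<le> h" "0 \<le> t'" "t' \<le> h"
    "f (x + h *\<^sub>R w + h *\<^sub>R v) - f (x + h *\<^sub>R v) - f (x + h *\<^sub>R w) + f x = h\<^sup>2 * B (x + s' *\<^sub>R w + t' *\<^sub>R v)"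
    unfolding B_def using second_difference[OF assms(1) h inS'] by blast
  have "h\<^sup>2 * A (x + s *\<^sub>R v + t *\<^sub>R w) = h\<^sup>2 * B (x + t' *\<^sub>R v + s' *\<^sub>R w)"
    using st(5) st'(5) by (simp add: algebra_simps)
  then have eq: "A (x + s *\<^sub>R v + t *\<^sub>R w) = B (x + t' *\<^sub>R v + s' *\<^sub>R w)" using h by simp
  have "dist (A (x + s *\<^sub>R v + t *\<^sub>R w)) (A x) < \<bar>A x - B x\<bar> / 2"
    using near[OF st(1-4)] by (intro d) (simp add: \<delta>_def)
  moreover have "dist (B (x + t' *\<^sub>R v + s' *\<^sub>R w)) (B x) < \<bar>A x - B x\<bar> / 2"
    using near[OF st'(3,4,1,2)] by (intro d) (simp add: \<delta>_def)
  ultimately show False using eq unfolding dist_real_def by (smt (verit) field_sum_of_halves)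
qed

section \<open>Smooth functions and tangent vectors\<close>

text \<open>The argument of \<open>step\<close> reaches 2 on the sphere of radius \<open>R\<close>,
  so the product vanishes outside the ball whatever values the total function \<open>h\<close> takes
  there.\<close>

lemma Ck_on_cutoff:
  fixes h :: "'e::euclidean_space \<Rightarrow> real"
  assumes "open O'" "R > 0" "cball x0 R \<subseteq> O'" "Ck_on k O' h"
  shows "Ck_on k UNIV (\<lambda>x. step (2 / R\<^sup>2 * ((x - x0) \<bullet> (x - x0))) * h x)"
proof -
  have s: "Ck_on k UNIV (\<lambda>x. step (2 / R\<^sup>2 * ((x - x0) \<bullet> (x - x0))))"
    by (rule Ck_on_compose[OF open_UNIV open_UNIV Ck_on_step])
      (intro Ck_on_mult Ck_on_inner Ck_on_const Ck_on_diff Ck_on_id open_UNIV, simp)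
  show ?thesis
  proof (rule Ck_on_local)
    fix x
    show "\<exists>N. open N \<and> x \<in> N \<and> Ck_on k N (\<lambda>x. step (2 / R\<^sup>2 * ((x - x0) \<bullet> (x - x0))) * h x)"
    proof (cases "x \<in> O'")
      case True
      then show ?thesis
        using assms by (intro exI[of _ O'] conjI Ck_on_mult Ck_on_subset[OF s]) auto
    next
      case False
      have z: "step (2 / R\<^sup>2 * ((y - x0) \<bullet> (y - x0))) * h y = 0" if "y \<in> - cball x0 R" for y
      proof -
        have "R\<^sup>2 \<le> (norm (y - x0))\<^sup>2"
          using that assms(2) by (intro power_mono) (auto simp: dist_norm norm_minus_commute)
        then have "2 \<le> 2 / R\<^sup>2 * ((y - x0) \<bullet> (y - x0))"
          using assms(2) by (simp add: power2_norm_eq_inner[symmetric] field_simps)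
        then show ?thesis by (simp add: step_eq_0)
      qed
      have "Ck_on k (- cball x0 R) (\<lambda>x. step (2 / R\<^sup>2 * ((x - x0) \<bullet> (x - x0))) * h x)"
        by (rule Ck_on_cong[OF _ Ck_on_const[of k _ 0]]) (use z in auto)
      then show ?thesis
        using False assms(3) by (intro exI[of _ "- cball x0 R"]) auto
    qed
  qed
qed

locale manifold =
  fixes A :: "('a::{t2_space, second_countable_topology}, 'e::euclidean_space) atlas"
  assumes atlas: "smooth_atlas A"
begin

lemma chart:
  assumes "(U, \<phi>) \<in> A"
  shows "open U" "open (\<phi> ` U)" "continuous_on U \<phi>" "continuous_on (\<phi> ` U) (inv_into U \<phi>)"
    "q \<in> U \<Longrightarrow> inv_into U \<phi> (\<phi> q) = q" "inj_on \<phi> U"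
    "x \<in> \<phi> ` U \<Longrightarrow> inv_into U \<phi> x \<in> U" "x \<in> \<phi> ` U \<Longrightarrow> \<phi> (inv_into U \<phi> x) = x"
proof -
  have *: "\<forall>(U, \<phi>)\<in>A. open U \<and> open (\<phi> ` U) \<and> homeomorphism U (\<phi> ` U) \<phi> (inv_into U \<phi>)"
    using atlas unfolding smooth_atlas_def by (rule conjunct1)
  show "open U" "open (\<phi> ` U)" using bspec[OF * assms] by simp_all
  have h: "homeomorphism U (\<phi> ` U) \<phi> (inv_into U \<phi>)" using bspec[OF * assms] by simp
  show "continuous_on U \<phi>" by (rule homeomorphism_cont1[OF h])
  show "continuous_on (\<phi> ` U) (inv_into U \<phi>)" by (rule homeomorphism_cont2[OF h])
  show "q \<in> U \<Longrightarrow> inv_into U \<phi> (\<phi> q) = q" by (rule homeomorphism_apply1[OF h])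
  show "inj_on \<phi> U" by (rule inj_on_inverseI) (rule homeomorphism_apply1[OF h])
  show "x \<in> \<phi> ` U \<Longrightarrow> inv_into U \<phi> x \<in> U" "x \<in> \<phi> ` U \<Longrightarrow> \<phi> (inv_into U \<phi> x) = x"
    by (auto simp: inv_into_into f_inv_into_f)
qed

lemma chart_at: obtains U \<phi> where "(U, \<phi>) \<in> A" "p \<in> U"
  using atlas unfolding smooth_atlas_def by blast

lemma transition: "(U, \<phi>) \<in> A \<Longrightarrow> (V, \<psi>) \<in> A \<Longrightarrow> Ck_on k (\<phi> ` (U \<inter> V)) (\<lambda>x. \<psi> (inv_into U \<phi> x))"
  using atlas unfolding smooth_atlas_def smooth_on_def comp_def by blast

lemma open_chart_image:
  assumes "(U, \<phi>) \<in> A" "open W" shows "open (\<phi> ` (U \<inter> W))"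
proof -
  have "\<phi> ` (U \<inter> W) = \<phi> ` U \<inter> inv_into U \<phi> -` W"
    using chart(5)[OF assms(1)] by auto
  then show ?thesis using chart[OF assms(1)] assms(2) by (simp add: continuous_open_preimage)
qed

lemma open_chart_preimage:
  assumes "(U, \<phi>) \<in> A" "open W" shows "open (U \<inter> \<phi> -` W)"
  using chart[OF assms(1)] assms(2) by (simp add: continuous_open_preimage)

lemma smooth_functions_iff:
  "f \<in> smooth_functions A \<longleftrightarrow> (\<forall>(U, \<phi>)\<in>A. \<forall>k. Ck_on k (\<phi> ` U) (\<lambda>x. f (inv_into U \<phi> x)))"
proof
  assume "f \<in> smooth_functions A"
  then show "\<forall>(U, \<phi>)\<in>A. \<forall>k. Ck_on k (\<phi> ` U) (\<lambda>x. f (inv_into U \<phi> x))"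
    unfolding smooth_functions_def smooth_map_def euclidean_atlas_def smooth_on_def comp_def by auto
next
  assume *: "\<forall>(U, \<phi>)\<in>A. \<forall>k. Ck_on k (\<phi> ` U) (\<lambda>x. f (inv_into U \<phi> x))"
  have "continuous (at p) f" for p
  proof -
    obtain U \<phi> where c: "(U, \<phi>) \<in> A" "p \<in> U" by (rule chart_at)
    have "continuous_on (\<phi> ` U) (\<lambda>x. f (inv_into U \<phi> x))" using * c Ck_on_imp_continuous_on by blast
    then have "continuous_on U (\<lambda>q. f (inv_into U \<phi> (\<phi> q)))"
      by (rule continuous_on_compose2[OF _ chart(3)[OF c(1)]]) auto
    then have "continuous_on U f" using chart(5)[OF c(1)] by (simp cong: continuous_on_cong)
    then show ?thesis using c chart(1) by (simp add: continuous_on_eq_continuous_at)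
  qed
  then have "continuous_on UNIV f" by (simp add: continuous_on_eq_continuous_at)
  then show "f \<in> smooth_functions A"
    unfolding smooth_functions_def smooth_map_def euclidean_atlas_def smooth_on_def comp_def using * by auto
qed

lemma smooth_functions_Ck:
  "f \<in> smooth_functions A \<Longrightarrow> (U, \<phi>) \<in> A \<Longrightarrow> Ck_on k (\<phi> ` U) (\<lambda>x. f (inv_into U \<phi> x))"
  unfolding smooth_functions_iff by blast

lemma smooth_const: "(\<lambda>q. c) \<in> smooth_functions A"
  unfolding smooth_functions_iff by (auto intro: Ck_on_const)

lemma smooth_add: "f \<in> smooth_functions A \<Longrightarrow> h \<in> smooth_functions A \<Longrightarrow> (\<lambda>q. f q + h q) \<in> smooth_functions A"
  unfolding smooth_functions_iff using chart(2) by (fastforce intro: Ck_on_add)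

lemma smooth_mult: "f \<in> smooth_functions A \<Longrightarrow> h \<in> smooth_functions A \<Longrightarrow> (\<lambda>q. f q * h q) \<in> smooth_functions A"
  unfolding smooth_functions_iff using chart(2) by (fastforce intro: Ck_on_mult)

lemma smooth_cmult: "f \<in> smooth_functions A \<Longrightarrow> (\<lambda>q. c * f q) \<in> smooth_functions A"
  by (intro smooth_mult smooth_const)

lemma smooth_diff: "f \<in> smooth_functions A \<Longrightarrow> h \<in> smooth_functions A \<Longrightarrow> (\<lambda>q. f q - h q) \<in> smooth_functions A"
  using smooth_add[OF _ smooth_cmult[of h "-1"]] by simp

lemma smooth_sum: "(\<And>i. i \<in> I \<Longrightarrow> f i \<in> smooth_functions A) \<Longrightarrow> (\<lambda>q. \<Sum>i\<in>I. f i q) \<in> smooth_functions A"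
  by (induction I rule: infinite_finite_induct) (auto intro: smooth_const smooth_add)

text \<open>Smoothness at points outside \<open>U\<close> uses the Hausdorff property: the compact
  preimage of the ball is closed, so such a point has a neighborhood on which the extension is
  0.\<close>

lemma smooth_chart_extension:
  fixes H :: "'e \<Rightarrow> real"
  assumes c: "(U, \<phi>) \<in> A" and H: "\<And>k. Ck_on k UNIV H" and sub: "cball x0 R \<subseteq> \<phi> ` U"
    and z: "\<And>x. x \<notin> cball x0 R \<Longrightarrow> H x = 0"
  shows "(\<lambda>q. if q \<in> U then H (\<phi> q) else 0) \<in> smooth_functions A"
  unfolding smooth_functions_iff
proof (clarify, rule Ck_on_local)
  fix V \<psi> k x assume d: "(V, \<psi>) \<in> A" and "x \<in> \<psi> ` V"
  then obtain q where q: "q \<in> V" "x = \<psi> q" by auto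
  let ?f = "\<lambda>x. if inv_into V \<psi> x \<in> U then H (\<phi> (inv_into V \<psi> x)) else 0"
  show "\<exists>N. open N \<and> x \<in> N \<and> Ck_on k N ?f"
  proof (cases "q \<in> U")
    case True
    have "Ck_on k (\<psi> ` (V \<inter> U)) (\<lambda>x. H (\<phi> (inv_into V \<psi> x)))"
      by (rule Ck_on_compose[OF open_chart_image[OF d chart(1)[OF c]] open_UNIV H transition[OF d c]]) simp
    then have "Ck_on k (\<psi> ` (V \<inter> U)) ?f"
      by (rule Ck_on_cong[OF open_chart_image[OF d chart(1)[OF c]]]) (use chart(5)[OF d] in auto)
    then show ?thesis using True q open_chart_image[OF d chart(1)[OF c]] by blast
  next
    case False
    define K where "K = inv_into U \<phi> ` cball x0 R"
    have "compact K" unfolding K_def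
      by (intro compact_continuous_image continuous_on_subset[OF chart(4)[OF c] sub] compact_cball)
    then have "open (- K)" by (simp add: compact_imp_closed open_Compl)
    moreover have "q \<notin> K" using False sub chart(7)[OF c] by (auto simp: K_def)
    moreover have "?f x = 0" if "x \<in> \<psi> ` (V \<inter> - K)" for x
    proof -
      obtain q where q: "q \<in> V" "q \<notin> K" "x = \<psi> q" using \<open>x \<in> \<psi> ` (V \<inter> - K)\<close> by blast
      show ?thesis
      proof (cases "q \<in> U")
        case True
        then have "\<phi> q \<notin> cball x0 R"
          using q(2) chart(5)[OF c True] unfolding K_def by (metis imageI)
        then show ?thesis using q chart(5)[OF d] z by simp
      qed (use q chart(5)[OF d] in simp)
    qed
    then have "Ck_on k (\<psi> ` (V \<inter> - K)) ?f"
      using Ck_on_cong[OF open_chart_image[OF d \<open>open (- K)\<close>] Ck_on_const[of k _ 0], of ?f] by simp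
    ultimately show ?thesis using q open_chart_image[OF d \<open>open (- K)\<close>] by blast
  qed
qed

text \<open>Tangent vectors act on globally defined functions only. Functions given in a chart are
  therefore cut off and replaced by global ones that agree with them near \<open>p\<close>.\<close>

lemma smooth_extension:
  fixes h :: "'e \<Rightarrow> real"
  assumes c: "(U, \<phi>) \<in> A" "p \<in> U" and O': "open O'" "\<phi> p \<in> O'" and h: "smooth_on O' h"
  obtains f N where "f \<in> smooth_functions A" "open N" "p \<in> N" "N \<subseteq> U"
    "\<And>q. q \<in> N \<Longrightarrow> \<phi> q \<in> O' \<and> f q = h (\<phi> q)" "\<And>q. q \<notin> U \<or> \<phi> q \<notin> O' \<Longrightarrow> f q = 0"
proof -
  have "open (\<phi> ` U \<inter> O')" using chart(2)[OF c(1)] O' by blast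
  moreover have "\<phi> p \<in> \<phi> ` U \<inter> O'" using c O' by blast
  ultimately obtain R where R: "R > 0" "cball (\<phi> p) R \<subseteq> \<phi> ` U \<inter> O'"
    by (metis open_contains_cball)
  define H where "H x = step (2 / R\<^sup>2 * ((x - \<phi> p) \<bullet> (x - \<phi> p))) * h x" for x
  have z: "H x = 0" if "x \<notin> cball (\<phi> p) R" for x
  proof -
    have "R\<^sup>2 \<le> (norm (x - \<phi> p))\<^sup>2"
      using that R by (intro power_mono) (auto simp: dist_norm norm_minus_commute)
    then have "2 \<le> 2 / R\<^sup>2 * ((x - \<phi> p) \<bullet> (x - \<phi> p))"
      using R by (simp add: power2_norm_eq_inner[symmetric] field_simps)
    then show ?thesis by (simp add: step_eq_0 H_def)
  qed
  have one: "H x = h x" if "x \<in> ball (\<phi> p) (R / 2)" for x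
  proof -
    have "(norm (x - \<phi> p))\<^sup>2 \<le> (R / 2)\<^sup>2"
      using that R by (intro power_mono) (auto simp: dist_norm norm_minus_commute)
    then have "2 / R\<^sup>2 * ((x - \<phi> p) \<bullet> (x - \<phi> p)) \<le> 2 / R\<^sup>2 * (R / 2)\<^sup>2"
      using R by (intro mult_left_mono) (auto simp: power2_norm_eq_inner[symmetric])
    also have "\<dots> \<le> 1" using R by (simp add: field_simps)
    finally show ?thesis by (simp add: step_eq_1 H_def)
  qed
  let ?f = "\<lambda>q. if q \<in> U then H (\<phi> q) else 0"
  have "Ck_on k UNIV H" for k
    unfolding H_def[abs_def] by (rule Ck_on_cutoff) (use O' R h in \<open>auto simp: smooth_on_def\<close>)
  then have "?f \<in> smooth_functions A"
    by (rule smooth_chart_extension[OF c(1) _ _ z]) (use R in auto)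
  moreover have "open (U \<inter> \<phi> -` ball (\<phi> p) (R / 2))" by (rule open_chart_preimage[OF c(1)]) simp
  moreover have "\<phi> q \<in> O'" if "\<phi> q \<in> ball (\<phi> p) (R / 2)" for q
    using that R by (auto simp: subset_iff)
  moreover have "?f q = 0" if "q \<notin> U \<or> \<phi> q \<notin> O'" for q
    using that z[of "\<phi> q"] R(2) by (cases "q \<in> U") (auto simp: subset_iff)
  ultimately show ?thesis
    using that[of ?f "U \<inter> \<phi> -` ball (\<phi> p) (R / 2)"] R(1) c one by simp
qed

lemma smooth_extension_ex:
  fixes h :: "'e \<Rightarrow> real"
  assumes "(U, \<phi>) \<in> A" "p \<in> U" "open O'" "\<phi> p \<in> O'" "smooth_on O' h"
  shows "\<exists>f N. f \<in> smooth_functions A \<and> open N \<and> p \<in> N \<and> N \<subseteq> U \<and> (\<forall>q\<in>N. \<phi> q \<in> O' \<and> f q = h (\<phi> q))"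
proof (rule smooth_extension[OF assms])
  fix f N assume "f \<in> smooth_functions A" "open N" "p \<in> N" "N \<subseteq> U" "\<And>q. q \<in> N \<Longrightarrow> \<phi> q \<in> O' \<and> f q = h (\<phi> q)"
  then show ?thesis by (intro exI[of _ f] exI[of _ N] conjI ballI) simp_all
qed

lemma bump_function:
  assumes "open W" "p \<in> W"
  obtains \<beta> where "\<beta> \<in> smooth_functions A" "\<beta> p = 1" "\<And>q. q \<notin> W \<Longrightarrow> \<beta> q = 0"
proof -
  obtain U \<phi> where c: "(U, \<phi>) \<in> A" "p \<in> U" by (rule chart_at)
  have s: "smooth_on (\<phi> ` (U \<inter> W)) (\<lambda>x. 1 :: real)" by (simp add: smooth_on_def Ck_on_const)
  have pin: "\<phi> p \<in> \<phi> ` (U \<inter> W)" using c assms by blast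
  obtain f N where f: "f \<in> smooth_functions A" "p \<in> N" "\<And>q. q \<in> N \<Longrightarrow> f q = 1"
      "\<And>q. q \<notin> U \<or> \<phi> q \<notin> \<phi> ` (U \<inter> W) \<Longrightarrow> f q = 0"
    using smooth_extension[OF c open_chart_image[OF c(1) assms(1)] pin s] by metis
  have "f q = 0" if "q \<notin> W" for q
    using that inj_on_image_mem_iff[OF chart(6)[OF c(1)], of q "U \<inter> W"] by (intro f(4)) auto
  with f that show ?thesis by metis
qed

section \<open>Tangent vectors in charts\<close>

lemma tangentD:
  assumes "v \<in> tangent_space A p"
  shows "f \<in> smooth_functions A \<Longrightarrow> h \<in> smooth_functions A \<Longrightarrow> v (\<lambda>q. f q + h q) = v f + v h"
    and "f \<in> smooth_functions A \<Longrightarrow> v (\<lambda>q. c * f q) = c * v f"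
    and "f \<in> smooth_functions A \<Longrightarrow> h \<in> smooth_functions A \<Longrightarrow> v (\<lambda>q. f q - h q) = v f - v h"
    and "f \<in> smooth_functions A \<Longrightarrow> h \<in> smooth_functions A \<Longrightarrow> v (\<lambda>q. f q * h q) = f p * v h + v f * h p"
    and "f \<notin> smooth_functions A \<Longrightarrow> v f = 0"
    and "v (\<lambda>q. c) = 0"
proof -
  have lin: "v (\<lambda>q. a * f q + b * h q) = a * v f + b * v h"
    if "f \<in> smooth_functions A" "h \<in> smooth_functions A" for f h a b
    using assms that unfolding tangent_space_def by blast
  have leib: "v (\<lambda>q. f q * h q) = f p * v h + v f * h p"
    if "f \<in> smooth_functions A" "h \<in> smooth_functions A" for f h
    using assms that unfolding tangent_space_def by blast
  show "f \<in> smooth_functions A \<Longrightarrow> h \<in> smooth_functions A \<Longrightarrow> v (\<lambda>q. f q + h q) = v f + v h"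
    using lin[of f h 1 1] by simp
  show "f \<in> smooth_functions A \<Longrightarrow> v (\<lambda>q. c * f q) = c * v f"
    using lin[of f f c 0] by simp
  show "f \<in> smooth_functions A \<Longrightarrow> h \<in> smooth_functions A \<Longrightarrow> v (\<lambda>q. f q - h q) = v f - v h"
    using lin[of f h 1 "-1"] by simp
  show "f \<in> smooth_functions A \<Longrightarrow> h \<in> smooth_functions A \<Longrightarrow> v (\<lambda>q. f q * h q) = f p * v h + v f * h p"
    by (rule leib)
  show "f \<notin> smooth_functions A \<Longrightarrow> v f = 0"
    using assms unfolding tangent_space_def by blast
  have "v (\<lambda>q. 1) = 0" using leib[OF smooth_const[of 1] smooth_const[of 1]] by simp
  then show "v (\<lambda>q. c) = 0" using lin[OF smooth_const[of 1] smooth_const[of 1], of c 0] by simp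
qed

lemma tangent_sum:
  assumes "v \<in> tangent_space A p" "\<And>i. i \<in> I \<Longrightarrow> f i \<in> smooth_functions A"
  shows "v (\<lambda>q. \<Sum>i\<in>I. f i q) = (\<Sum>i\<in>I. v (f i))"
  using assms(2)
  by (induction I rule: infinite_finite_induct)
    (auto simp: tangentD(6)[OF assms(1)] tangentD(1)[OF assms(1)] smooth_sum)

text \<open>The difference of \<open>f\<close> and \<open>h\<close> times a bump function supported
  in \<open>W\<close> is identically 0; the Leibniz rule at \<open>p\<close>, where the bump
  function is 1, gives \<open>v f - v h = 0\<close>.\<close>

lemma tangent_local:
  assumes v: "v \<in> tangent_space A p" and f: "f \<in> smooth_functions A" "h \<in> smooth_functions A"
    and W: "open W" "p \<in> W" and eq: "\<And>q. q \<in> W \<Longrightarrow> f q = h q"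
  shows "v f = v h"
proof -
  obtain \<beta> where \<beta>: "\<beta> \<in> smooth_functions A" "\<beta> p = 1" "\<And>q. q \<notin> W \<Longrightarrow> \<beta> q = 0"
    using bump_function[OF W] by metis
  have z: "(\<lambda>q. (f q - h q) * \<beta> q) = (\<lambda>q. 0)"
    using eq \<beta>(3) by (metis mult_eq_0_iff right_minus_eq)
  have "v (\<lambda>q. (f q - h q) * \<beta> q) = (f p - h p) * v \<beta> + v (\<lambda>q. f q - h q) * \<beta> p"
    by (rule tangentD(4)[OF v smooth_diff[OF f] \<beta>(1)])
  then show ?thesis
    using eq[OF W(2)] \<beta>(2) tangentD(6)[OF v, of 0] by (simp add: z tangentD(3)[OF v f])
qed

text \<open>Hadamard's lemma writes \<open>f\<close> near \<open>p\<close> as a constant plus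
  products of centered coordinates and smooth functions. A derivation kills the constant, and in
  each product only the derivative of the coordinate survives at \<open>p\<close>, with the partial
  derivative of \<open>f\<close> as factor.\<close>

lemma tangent_chart:
  assumes v: "v \<in> tangent_space A p" and c: "(U, \<phi>) \<in> A" "p \<in> U"
  obtains \<xi> where "\<And>f. f \<in> smooth_functions A \<Longrightarrow>
    v f = frechet_derivative (\<lambda>x. f (inv_into U \<phi> x)) (at (\<phi> p)) \<xi>"
proof -
  have "\<exists>f N. f \<in> smooth_functions A \<and> open N \<and> p \<in> N \<and> N \<subseteq> U \<and> (\<forall>q\<in>N. f q = (\<phi> q - \<phi> p) \<bullet> b)" for b
  proof -
    have "smooth_on UNIV (\<lambda>x. (x - \<phi> p) \<bullet> b)" unfolding smooth_on_def
      by (auto intro!: Ck_on_inner Ck_on_diff Ck_on_id Ck_on_const)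
    from smooth_extension_ex[OF c open_UNIV UNIV_I this] show ?thesis by simp
  qed
  then have extX: "\<forall>b. \<exists>f N. f \<in> smooth_functions A \<and> open N \<and> p \<in> N \<and> (\<forall>q\<in>N. f q = (\<phi> q - \<phi> p) \<bullet> b)" by blast
  obtain X M where X: "\<And>b. X b \<in> smooth_functions A" "\<And>b. open (M b)" "\<And>b. p \<in> M b"
     "\<And>b q. q \<in> M b \<Longrightarrow> X b q = (\<phi> q - \<phi> p) \<bullet> b" using extX by metis
  show ?thesis
  proof
    fix f assume f: "f \<in> smooth_functions A"
    define F where "F x = f (inv_into U \<phi> x)" for x
    have FC: "smooth_on (\<phi> ` U) F" unfolding smooth_on_def F_def using smooth_functions_Ck[OF f c(1)] by blast
    obtain r where r: "r > 0" "ball (\<phi> p) r \<subseteq> \<phi> ` U"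
      using chart(2)[OF c(1)] c(2) by (meson image_eqI openE)
    have FB: "smooth_on (ball (\<phi> p) r) F" using FC r unfolding smooth_on_def by (blast intro: Ck_on_subset)
    obtain h where h: "\<And>b. smooth_on (ball (\<phi> p) r) (h b)"
      "\<And>x. x \<in> ball (\<phi> p) r \<Longrightarrow> F x = F (\<phi> p) + (\<Sum>b\<in>Basis. ((x - \<phi> p) \<bullet> b) * h b x)"
      "\<And>b. h b (\<phi> p) = frechet_derivative F (at (\<phi> p)) b"
      using hadamard[OF _ open_ball convex_ball FB, of "\<phi> p"] r by (metis centre_in_ball)
    have "\<exists>f N. f \<in> smooth_functions A \<and> open N \<and> p \<in> N \<and> N \<subseteq> U \<and> (\<forall>q\<in>N. \<phi> q \<in> ball (\<phi> p) r \<and> f q = h b (\<phi> q))" for b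
    proof -
      have "\<phi> p \<in> ball (\<phi> p) r" using r by simp
      from smooth_extension_ex[OF c open_ball this h(1)[of b]] show ?thesis .
    qed
    then have "\<forall>b. \<exists>f N. f \<in> smooth_functions A \<and> open N \<and> p \<in> N \<and> N \<subseteq> U \<and> (\<forall>q\<in>N. \<phi> q \<in> ball (\<phi> p) r \<and> f q = h b (\<phi> q))" by (rule allI)
    from choice[OF this] obtain H where "\<forall>b. \<exists>N. H b \<in> smooth_functions A \<and> open N \<and> p \<in> N \<and> N \<subseteq> U \<and>
        (\<forall>q\<in>N. \<phi> q \<in> ball (\<phi> p) r \<and> H b q = h b (\<phi> q))" by (rule exE)
    from choice[OF this] obtain N where "\<forall>b. H b \<in> smooth_functions A \<and> open (N b) \<and> p \<in> N b \<and> N b \<subseteq> U \<and>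
        (\<forall>q\<in>N b. \<phi> q \<in> ball (\<phi> p) r \<and> H b q = h b (\<phi> q))" by (rule exE)
    then have H: "\<And>b. H b \<in> smooth_functions A" "\<And>b. open (N b)" "\<And>b. p \<in> N b"
       "\<And>b. N b \<subseteq> U" "\<And>b q. q \<in> N b \<Longrightarrow> \<phi> q \<in> ball (\<phi> p) r \<and> H b q = h b (\<phi> q)" by simp_all
    define W where "W = (\<Inter>b\<in>Basis. N b \<inter> M b)"
    have W: "open W" "p \<in> W" using H X by (auto simp: W_def intro!: open_INT)
    define f' where "f' q = f p + (\<Sum>b\<in>Basis. X b q * H b q)" for q
    have f': "f' \<in> smooth_functions A" unfolding f'_def[abs_def]
      by (intro smooth_add smooth_const smooth_sum smooth_mult X H)
    have eq: "f q = f' q" if "q \<in> W" for q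
    proof -
      obtain b :: 'e where b: "b \<in> Basis" using nonempty_Basis by blast
      have qb: "q \<in> N b" using that b by (auto simp: W_def)
      have q: "q \<in> U" "\<phi> q \<in> ball (\<phi> p) r" using H(4,5) qb by blast+
      have "f q = F (\<phi> q)" using q chart(5)[OF c(1)] by (simp add: F_def)
      also have "\<dots> = F (\<phi> p) + (\<Sum>b\<in>Basis. ((\<phi> q - \<phi> p) \<bullet> b) * h b (\<phi> q))" using h(2) q by blast
      also have "\<dots> = f' q"
        using that X H chart(5)[OF c(1,2)] by (auto simp: f'_def F_def W_def intro!: sum.cong)
      finally show ?thesis .
    qed
    have "v f = v f'" by (rule tangent_local[OF v f f' W eq])
    also have "\<dots> = (\<Sum>b\<in>Basis. v (\<lambda>q. X b q * H b q))"
      unfolding f'_def[abs_def]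
      by (simp add: tangentD(1)[OF v] tangentD(6)[OF v] tangent_sum[OF v] smooth_const smooth_sum smooth_mult X H)
    also have "\<dots> = (\<Sum>b\<in>Basis. v (X b) * frechet_derivative F (at (\<phi> p)) b)"
      using X H h(3) by (simp add: tangentD(4)[OF v])
    also have "\<dots> = frechet_derivative F (at (\<phi> p)) (\<Sum>b\<in>Basis. v (X b) *\<^sub>R b)"
    proof -
      have "Ck_on (Suc 0) (\<phi> ` U) F" using FC by (simp add: smooth_on_def del: Ck_on.simps)
      then have "linear (frechet_derivative F (at (\<phi> p)))"
        using Ck_on_has_derivative c by (meson has_derivative_linear image_eqI)
      then show ?thesis by (simp add: linear_sum linear_cmul)
    qed
    finally show "v f = frechet_derivative (\<lambda>x. f (inv_into U \<phi> x)) (at (\<phi> p)) (\<Sum>b\<in>Basis. v (X b) *\<^sub>R b)"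
      by (simp add: F_def[abs_def])
  qed
qed

end

section \<open>Velocities of curves and functions of two points\<close>

text \<open>The curve is tested against smooth functions at a single parameter. Neither smoothness
  nor continuity is demanded, so the notion also serves for curves controlled on an interval
  only.\<close>

definition has_vel ::
  "('a::topological_space, 'e::euclidean_space) atlas \<Rightarrow> (real \<Rightarrow> 'a) \<Rightarrow> 'a tvec \<Rightarrow> real \<Rightarrow> bool" where
  "has_vel A c v t \<longleftrightarrow> v \<in> tangent_space A (c t) \<and>
     (\<forall>f\<in>smooth_functions A. ((\<lambda>s. f (c s)) has_real_derivative v f) (at t))"

text \<open>Joint smoothness on the product, in curried form: each variable can be frozen or
  differentiated by a tangent vector of its own factor. The intended instance is \<open>f\<close>
  applied to a group product.\<close>

definition smooth2 ::
  "('a::topological_space, 'e::euclidean_space) atlas \<Rightarrow> ('b::topological_space, 'f::euclidean_space) atlas \<Rightarrow>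
   ('a \<Rightarrow> 'b \<Rightarrow> real) \<Rightarrow> bool" where
  "smooth2 A B F \<longleftrightarrow> (\<forall>(U, \<phi>)\<in>A. \<forall>(V, \<psi>)\<in>B. \<forall>k.
     Ck_on k (\<phi> ` U \<times> \<psi> ` V) (\<lambda>z. F (inv_into U \<phi> (fst z)) (inv_into V \<psi> (snd z))))"

lemma DERIV_transform_eventually:
  "(f has_real_derivative D) (at x) \<Longrightarrow> \<forall>\<^sub>F s in nhds x. f s = g s \<Longrightarrow> (g has_real_derivative D) (at x)"
  using DERIV_cong_ev[of x x f g D D] by simp

lemma Ck_on_frechet: "Ck_on (Suc k) S f \<Longrightarrow> Ck_on k S (\<lambda>x. frechet_derivative f (at x) v)"
  by simp

lemma Ck_on_fst: "Ck_on k S fst" and Ck_on_snd: "Ck_on k S snd"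
  by (auto intro: Ck_on_bounded_linear bounded_linear_fst bounded_linear_snd)

lemma frechet_derivative_slice:
  assumes "Ck_on (Suc k) S H" "(x, y) \<in> S"
  shows "((\<lambda>x. H (x, y)) has_derivative (\<lambda>\<xi>. frechet_derivative H (at (x, y)) (\<xi>, 0))) (at x)"
    and "((\<lambda>y. H (x, y)) has_derivative (\<lambda>\<eta>. frechet_derivative H (at (x, y)) (0, \<eta>))) (at y)"
    and "frechet_derivative (\<lambda>x. H (x, y)) (at x) \<xi> = frechet_derivative H (at (x, y)) (\<xi>, 0)"
    and "frechet_derivative (\<lambda>y. H (x, y)) (at y) \<eta> = frechet_derivative H (at (x, y)) (0, \<eta>)"
proof -
  have d: "(H has_derivative frechet_derivative H (at (x, y))) (at (x, y))"
    by (rule Ck_on_has_derivative[OF assms])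
  show 1: "((\<lambda>x. H (x, y)) has_derivative (\<lambda>\<xi>. frechet_derivative H (at (x, y)) (\<xi>, 0))) (at x)"
    by (rule has_derivative_compose[where f="\<lambda>x. (x, y)" and g=H]) (auto intro!: derivative_eq_intros d)
  show 2: "((\<lambda>y. H (x, y)) has_derivative (\<lambda>\<eta>. frechet_derivative H (at (x, y)) (0, \<eta>))) (at y)"
    by (rule has_derivative_compose[where f="\<lambda>y. (x, y)" and g=H]) (auto intro!: derivative_eq_intros d)
  show "frechet_derivative (\<lambda>x. H (x, y)) (at x) \<xi> = frechet_derivative H (at (x, y)) (\<xi>, 0)"
    using frechet_derivative_at[OF 1] by (metis (no_types))
  show "frechet_derivative (\<lambda>y. H (x, y)) (at y) \<eta> = frechet_derivative H (at (x, y)) (0, \<eta>)"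
    using frechet_derivative_at[OF 2] by (metis (no_types))
qed

context manifold begin

definition chart_vec :: "'a set \<Rightarrow> ('a \<Rightarrow> 'e) \<Rightarrow> 'a \<Rightarrow> 'a tvec \<Rightarrow> 'e" where
  "chart_vec U \<phi> p v = (SOME \<xi>. \<forall>f\<in>smooth_functions A.
     v f = frechet_derivative (\<lambda>x. f (inv_into U \<phi> x)) (at (\<phi> p)) \<xi>)"

lemma chart_vec:
  assumes "v \<in> tangent_space A p" "(U, \<phi>) \<in> A" "p \<in> U" "f \<in> smooth_functions A"
  shows "v f = frechet_derivative (\<lambda>x. f (inv_into U \<phi> x)) (at (\<phi> p)) (chart_vec U \<phi> p v)"
proof -
  have "\<exists>\<xi>. \<forall>f\<in>smooth_functions A. v f = frechet_derivative (\<lambda>x. f (inv_into U \<phi> x)) (at (\<phi> p)) \<xi>"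
    by (rule tangent_chart[OF assms(1-3)]) blast
  from someI_ex[OF this] show ?thesis using assms(4) unfolding chart_vec_def by blast
qed

lemma chart_vec_coordinate:
  assumes "(U, \<phi>) \<in> A" "N \<subseteq> U" "open N" "q \<in> N" and f: "f \<in> smooth_functions A" "\<And>q. q \<in> N \<Longrightarrow> f q = \<phi> q \<bullet> b"
    and v: "v \<in> tangent_space A q"
  shows "v f = chart_vec U \<phi> q v \<bullet> b"
proof -
  have qU: "q \<in> U" using assms by blast
  have "((\<lambda>x. x \<bullet> b) has_derivative (\<lambda>x. x \<bullet> b)) (at (\<phi> q))"
    by (auto intro!: derivative_eq_intros)
  then have "((\<lambda>x. f (inv_into U \<phi> x)) has_derivative (\<lambda>x. x \<bullet> b)) (at (\<phi> q))"
    by (rule has_derivative_transform_within_open[OF _ open_chart_image[OF assms(1) assms(3)]])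
      (use assms chart(5)[OF assms(1)] in auto)
  from frechet_derivative_at[OF this] show ?thesis
    using chart_vec[OF v assms(1) qU f(1)] by (metis (no_types))
qed

lemma coordinate_extension:
  assumes "(U, \<phi>) \<in> A" "p \<in> U"
  shows "\<exists>f N. f \<in> smooth_functions A \<and> open N \<and> p \<in> N \<and> N \<subseteq> U \<and> (\<forall>q\<in>N. f q = \<phi> q \<bullet> b) \<and>
    (\<forall>v\<in>tangent_space A p. v f = chart_vec U \<phi> p v \<bullet> b)"
proof -
  have "smooth_on UNIV (\<lambda>x. x \<bullet> b)" unfolding smooth_on_def
    by (auto intro!: Ck_on_inner Ck_on_id Ck_on_const)
  from smooth_extension_ex[OF assms open_UNIV UNIV_I this] obtain f N where f:
    "f \<in> smooth_functions A" "open N" "p \<in> N" "N \<subseteq> U" "\<forall>q\<in>N. f q = \<phi> q \<bullet> b" by auto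
  have "v f = chart_vec U \<phi> p v \<bullet> b" if "v \<in> tangent_space A p" for v
    using chart_vec_coordinate[OF assms(1) f(4,2,3,1) _ that] f(5) by blast
  then show ?thesis using f by (intro exI[of _ f] exI[of _ N]) simp
qed

text \<open>Continuity is recovered by a bump function supported in \<open>W\<close>: along the
  curve it is differentiable, hence stays positive near \<open>t\<close>, and it is positive only on
  \<open>W\<close>.\<close>

lemma has_vel_eventually:
  assumes "has_vel A c v t" "open W" "c t \<in> W"
  shows "\<forall>\<^sub>F s in nhds t. c s \<in> W"
proof -
  obtain \<beta> where b: "\<beta> \<in> smooth_functions A" "\<beta> (c t) = 1" "\<And>q. q \<notin> W \<Longrightarrow> \<beta> q = 0"
    using bump_function[OF assms(2,3)] by metis
  have "((\<lambda>s. \<beta> (c s)) has_real_derivative v \<beta>) (at t)" using assms(1) b(1) unfolding has_vel_def by blast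
  then have "isCont (\<lambda>s. \<beta> (c s)) t" by (rule DERIV_isCont)
  then have "((\<lambda>s. \<beta> (c s)) \<longlongrightarrow> \<beta> (c t)) (nhds t)"
    unfolding isCont_def by (rule tendsto_at_iff_tendsto_nhds[THEN iffD1])
  then have "\<forall>\<^sub>F s in nhds t. \<beta> (c s) > 0" by (rule order_tendstoD) (simp add: b(2))
  then show ?thesis by (rule eventually_mono) (metis b(3) less_irrefl)
qed

lemma has_vel_chart:
  assumes "has_vel A c v t" "(U, \<phi>) \<in> A" "c t \<in> U"
  shows "((\<lambda>s. \<phi> (c s)) has_vector_derivative chart_vec U \<phi> (c t) v) (at t)"
  unfolding has_vector_derivative_def
proof (subst has_derivative_componentwise_within, rule ballI)
  fix b :: 'e assume "b \<in> Basis"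
  obtain f N where f: "f \<in> smooth_functions A" "open N" "c t \<in> N" "\<forall>q\<in>N. f q = \<phi> q \<bullet> b"
      "\<forall>v\<in>tangent_space A (c t). v f = chart_vec U \<phi> (c t) v \<bullet> b"
    using coordinate_extension[OF assms(2,3), of b] by blast
  have v: "v \<in> tangent_space A (c t)" using assms(1) by (simp add: has_vel_def)
  have d: "((\<lambda>s. f (c s)) has_real_derivative chart_vec U \<phi> (c t) v \<bullet> b) (at t)"
    using assms(1) f v unfolding has_vel_def by force
  have "\<forall>\<^sub>F s in nhds t. f (c s) = \<phi> (c s) \<bullet> b"
    using has_vel_eventually[OF assms(1) f(2,3)] by (rule eventually_mono) (use f in blast)
  from DERIV_transform_eventually[OF d this]
  have "((\<lambda>s. \<phi> (c s) \<bullet> b) has_real_derivative chart_vec U \<phi> (c t) v \<bullet> b) (at t)" .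
  then show "((\<lambda>s. \<phi> (c s) \<bullet> b) has_derivative (\<lambda>x. (x *\<^sub>R chart_vec U \<phi> (c t) v) \<bullet> b)) (at t)"
    by (simp add: has_field_derivative_def mult_commute_abs)
qed

lemma smooth_functions_separate:
  assumes "\<And>f. f \<in> smooth_functions A \<Longrightarrow> f p = f q"
  shows "p = q"
proof (rule ccontr)
  assume "p \<noteq> q"
  then obtain \<beta> where "\<beta> \<in> smooth_functions A" "\<beta> p = 1" "\<And>x. x \<notin> - {q} \<Longrightarrow> \<beta> x = 0"
    using bump_function[of "- {q}" p] by (metis Compl_iff open_Compl closed_singleton singletonD)
  then show False using assms by (metis Compl_iff singletonI zero_neq_one)
qed

lemma smooth_curve_Ck:
  assumes "smooth_curve A \<gamma>" "f \<in> smooth_functions A"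
  shows "Ck_on k UNIV (\<lambda>t. f (\<gamma> t))"
proof (rule Ck_on_local)
  fix t
  obtain U \<phi> where c: "(U, \<phi>) \<in> A" "\<gamma> t \<in> U" by (rule chart_at)
  have cont: "continuous_on UNIV \<gamma>" and s: "smooth_on (\<gamma> -` U) (\<phi> \<circ> \<gamma>)"
    using assms(1) c(1) unfolding smooth_curve_def smooth_map_def euclidean_atlas_def by auto
  have op: "open (\<gamma> -` U)" using cont chart(1)[OF c(1)] by (simp add: open_vimage)
  have "Ck_on k (\<gamma> -` U) (\<lambda>t. f (inv_into U \<phi> ((\<phi> \<circ> \<gamma>) t)))"
    by (rule Ck_on_compose[OF op chart(2)[OF c(1)] smooth_functions_Ck[OF assms(2) c(1)]])
      (use s in \<open>auto simp: smooth_on_def comp_def\<close>)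
  then have "Ck_on k (\<gamma> -` U) (\<lambda>t. f (\<gamma> t))"
    by (rule Ck_on_cong[OF op]) (simp add: chart(5)[OF c(1)])
  then show "\<exists>N. open N \<and> t \<in> N \<and> Ck_on k N (\<lambda>t. f (\<gamma> t))" using op c by blast
qed

text \<open>Continuity comes from \<open>has_vel_eventually\<close>. Chart components are smooth
  because near each point they coincide with global smooth functions, for which the second
  hypothesis applies.\<close>

lemma smooth_curveI:
  assumes "\<And>t. \<exists>v. has_vel A \<gamma> v t" "\<And>f k. f \<in> smooth_functions A \<Longrightarrow> Ck_on k UNIV (\<lambda>t. f (\<gamma> t))"
  shows "smooth_curve A \<gamma>"
proof -
  have cont: "continuous_on UNIV \<gamma>"
  proof (subst continuous_on_eq_continuous_at[OF open_UNIV], rule ballI)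
    fix t
    have "(\<gamma> \<longlongrightarrow> \<gamma> t) (nhds t)" using assms(1) has_vel_eventually by (blast intro: topological_tendstoI)
    then show "isCont \<gamma> t" unfolding isCont_def by (rule tendsto_at_iff_tendsto_nhds[THEN iffD2])
  qed
  have "Ck_on k (\<gamma> -` V) (\<lambda>t. \<psi> (\<gamma> t))" if d: "(V, \<psi>) \<in> A" for V \<psi> k
  proof (rule Ck_on_componentwise, use cont chart(1)[OF d] in \<open>simp add: open_vimage\<close>, rule Ck_on_local)
    fix b :: 'e and t assume "t \<in> \<gamma> -` V"
    then have V: "\<gamma> t \<in> V" by simp
    obtain f N where f: "f \<in> smooth_functions A" "open N" "\<gamma> t \<in> N" "\<forall>q\<in>N. f q = \<psi> q \<bullet> b"
      using coordinate_extension[OF d V, of b] by blast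
    have op: "open (\<gamma> -` N)" using cont f(2) by (simp add: open_vimage)
    have "Ck_on k (\<gamma> -` N) (\<lambda>t. \<psi> (\<gamma> t) \<bullet> b)"
      by (rule Ck_on_cong[OF op Ck_on_subset[OF assms(2)[OF f(1)]]]) (use f in auto)
    then show "\<exists>N. open N \<and> t \<in> N \<and> Ck_on k N (\<lambda>t. \<psi> (\<gamma> t) \<bullet> b)" using op f by blast
  qed
  then show ?thesis
    using cont unfolding smooth_curve_def smooth_map_def euclidean_atlas_def
    by (auto simp: smooth_on_def comp_def)
qed

lemma has_vel_velocity:
  assumes "smooth_curve A \<gamma>" shows "has_vel A \<gamma> (velocity A \<gamma> t) t"
proof -
  have d: "((\<lambda>s. f (\<gamma> s)) has_real_derivative deriv (\<lambda>s. f (\<gamma> s)) t) (at t)" if "f \<in> smooth_functions A" for f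
  proof -
    have "(\<lambda>s. f (\<gamma> s)) differentiable at t"
      using smooth_curve_Ck[OF assms that, of 1] by simp
    then show ?thesis
      by (simp add: DERIV_deriv_iff_real_differentiable)
  qed
  have lin: "deriv (\<lambda>s. a * f (\<gamma> s) + b * h (\<gamma> s)) t = a * deriv (\<lambda>s. f (\<gamma> s)) t + b * deriv (\<lambda>s. h (\<gamma> s)) t"
    if "f \<in> smooth_functions A" "h \<in> smooth_functions A" for f h a b
    by (rule DERIV_imp_deriv) (auto intro!: derivative_eq_intros d that)
  have leib: "deriv (\<lambda>s. f (\<gamma> s) * h (\<gamma> s)) t = f (\<gamma> t) * deriv (\<lambda>s. h (\<gamma> s)) t + deriv (\<lambda>s. f (\<gamma> s)) t * h (\<gamma> t)"
    if "f \<in> smooth_functions A" "h \<in> smooth_functions A" for f h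
    by (rule DERIV_imp_deriv) (auto intro!: derivative_eq_intros d that)
  have "velocity A \<gamma> t \<in> tangent_space A (\<gamma> t)"
    unfolding tangent_space_def velocity_def
    by (auto simp: comp_def lin leib smooth_add smooth_cmult smooth_mult)
  then show ?thesis using d by (simp add: has_vel_def velocity_def comp_def)
qed

lemma has_vel_unique:
  "has_vel A c v t \<Longrightarrow> has_vel A c w t \<Longrightarrow> v = w"
  using tangentD(5) DERIV_unique unfolding has_vel_def by (metis ext)

end

locale two_manifolds = M: manifold A + N: manifold B
  for A :: "('a::{t2_space, second_countable_topology}, 'e::euclidean_space) atlas"
  and B :: "('b::{t2_space, second_countable_topology}, 'f::euclidean_space) atlas"
begin

lemma smooth2_Ck:
  "smooth2 A B F \<Longrightarrow> (U, \<phi>) \<in> A \<Longrightarrow> (V, \<psi>) \<in> B \<Longrightarrow>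
     Ck_on k (\<phi> ` U \<times> \<psi> ` V) (\<lambda>z. F (inv_into U \<phi> (fst z)) (inv_into V \<psi> (snd z)))"
  unfolding smooth2_def by blast

lemma smooth2_swap:
  assumes "smooth2 A B F" shows "smooth2 B A (\<lambda>y x. F x y)"
  unfolding smooth2_def
proof clarify
  fix V \<psi> U \<phi> k assume c: "(V, \<psi>) \<in> B" "(U, \<phi>) \<in> A"
  have op: "open (\<phi> ` U \<times> \<psi> ` V)" "open (\<psi> ` V \<times> \<phi> ` U)"
    using c M.chart(2) N.chart(2) by (auto intro: open_Times)
  have "Ck_on k (\<psi> ` V \<times> \<phi> ` U) (\<lambda>z. F (inv_into U \<phi> (fst (snd z, fst z))) (inv_into V \<psi> (snd (snd z, fst z))))"
    by (rule Ck_on_compose[OF op(2,1) smooth2_Ck[OF assms c(2,1)]])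
      (auto intro!: Ck_on_Pair op Ck_on_fst Ck_on_snd)
  then show "Ck_on k (\<psi> ` V \<times> \<phi> ` U) (\<lambda>z. F (inv_into U \<phi> (snd z)) (inv_into V \<psi> (fst z)))" by simp
qed

lemma smooth2_slice:
  assumes "smooth2 A B F" shows "F p \<in> smooth_functions B"
  unfolding N.smooth_functions_iff
proof clarify
  fix V \<psi> k assume c: "(V, \<psi>) \<in> B"
  obtain U \<phi> where d: "(U, \<phi>) \<in> A" "p \<in> U" by (rule M.chart_at)
  have op: "open (\<phi> ` U \<times> \<psi> ` V)" "open (\<psi> ` V)"
    using c d M.chart(2) N.chart(2) by (auto intro: open_Times)
  have "Ck_on k (\<psi> ` V) (\<lambda>y. F (inv_into U \<phi> (fst (\<phi> p, y))) (inv_into V \<psi> (snd (\<phi> p, y))))"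
    by (rule Ck_on_compose[OF op(2,1) smooth2_Ck[OF assms d(1) c]])
      (use d in \<open>auto intro!: Ck_on_Pair op Ck_on_id Ck_on_const\<close>)
  then show "Ck_on k (\<psi> ` V) (\<lambda>y. F p (inv_into V \<psi> y))"
    using M.chart(5)[OF d] by simp
qed

end

sublocale two_manifolds \<subseteq> swap: two_manifolds B A
  by unfold_locales

context two_manifolds begin

lemma smooth2_slice': "smooth2 A B F \<Longrightarrow> (\<lambda>p. F p q) \<in> smooth_functions A"
  using swap.smooth2_slice[OF smooth2_swap] .

lemma smooth2_chart_deriv:
  assumes F: "smooth2 A B F" and v: "v \<in> tangent_space A p"
    and d: "(U, \<phi>) \<in> A" "p \<in> U" and c: "(V, \<psi>) \<in> B" and y: "y \<in> \<psi> ` V"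
  shows "v (\<lambda>p. F p (inv_into V \<psi> y)) =
    frechet_derivative (\<lambda>z. F (inv_into U \<phi> (fst z)) (inv_into V \<psi> (snd z))) (at (\<phi> p, y)) (M.chart_vec U \<phi> p v, 0)"
proof -
  have "(\<phi> p, y) \<in> \<phi> ` U \<times> \<psi> ` V" using d y by blast
  from frechet_derivative_slice(3)[OF smooth2_Ck[OF F d(1) c, of "Suc 0"] this, of "M.chart_vec U \<phi> p v"]
  show ?thesis using M.chart_vec[OF v d smooth2_slice'[OF F]] by simp
qed

lemma smooth2_deriv:
  assumes F: "smooth2 A B F" and v: "v \<in> tangent_space A p"
  shows "(\<lambda>q. v (\<lambda>p. F p q)) \<in> smooth_functions B"
  unfolding N.smooth_functions_iff
proof clarify
  fix V \<psi> k assume c: "(V, \<psi>) \<in> B"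
  obtain U \<phi> where d: "(U, \<phi>) \<in> A" "p \<in> U" by (rule M.chart_at)
  have op: "open (\<phi> ` U \<times> \<psi> ` V)" "open (\<psi> ` V)"
    using c d M.chart(2) N.chart(2) by (auto intro: open_Times)
  let ?H = "\<lambda>z. F (inv_into U \<phi> (fst z)) (inv_into V \<psi> (snd z))"
  have "Ck_on k (\<phi> ` U \<times> \<psi> ` V) (\<lambda>z. frechet_derivative ?H (at z) (M.chart_vec U \<phi> p v, 0))"
    by (rule Ck_on_frechet[OF smooth2_Ck[OF F d(1) c]])
  moreover have "Ck_on k (\<psi> ` V) (\<lambda>y. (\<phi> p, y))" by (intro Ck_on_Pair op Ck_on_id Ck_on_const)
  ultimately have "Ck_on k (\<psi> ` V) (\<lambda>y. frechet_derivative ?H (at (\<phi> p, y)) (M.chart_vec U \<phi> p v, 0))"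
    by (rule Ck_on_compose[OF op(2,1)]) (use d in auto)
  then show "Ck_on k (\<psi> ` V) (\<lambda>y. v (\<lambda>p. F p (inv_into V \<psi> y)))"
    by (rule Ck_on_cong[OF op(2)]) (simp add: smooth2_chart_deriv[OF F v d c])
qed

end

context two_manifolds begin

text \<open>In charts \<open>v\<close> and \<open>w\<close> become directional derivatives, along
  the first and the second factor, of one function on an open set of the product. The claim is then
  the symmetry of its second derivatives.\<close>

lemma tangent_commute:
  assumes F: "smooth2 A B F" and v: "v \<in> tangent_space A p" and w: "w \<in> tangent_space B q"
  shows "v (\<lambda>p. w (F p)) = w (\<lambda>q. v (\<lambda>p. F p q))"
proof -
  obtain U \<phi> where d: "(U, \<phi>) \<in> A" "p \<in> U" by (rule M.chart_at)
  obtain V \<psi> where c: "(V, \<psi>) \<in> B" "q \<in> V" by (rule N.chart_at)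
  have op: "open (\<phi> ` U \<times> \<psi> ` V)" "open (\<psi> ` V)" "open (\<phi> ` U)"
    using c d M.chart(2) N.chart(2) by (auto intro: open_Times)
  have pq: "(\<phi> p, \<psi> q) \<in> \<phi> ` U \<times> \<psi> ` V" using c d by blast
  define H where "H z = F (inv_into U \<phi> (fst z)) (inv_into V \<psi> (snd z))" for z
  define \<xi> where "\<xi> = M.chart_vec U \<phi> p v"
  define \<eta> where "\<eta> = N.chart_vec V \<psi> q w"
  have H: "Ck_on k (\<phi> ` U \<times> \<psi> ` V) H" for k unfolding H_def[abs_def] by (rule smooth2_Ck[OF F d(1) c(1)])
  note H' = Ck_on_frechet[OF H]
  have vF: "v (\<lambda>p. F p (inv_into V \<psi> y)) = frechet_derivative H (at (\<phi> p, y)) (\<xi>, 0)" if "y \<in> \<psi> ` V" for y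
    using smooth2_chart_deriv[OF F v d c(1) that] by (simp add: \<xi>_def H_def[abs_def])
  have wF: "w (F (inv_into U \<phi> x)) = frechet_derivative H (at (x, \<psi> q)) (0, \<eta>)" if "x \<in> \<phi> ` U" for x
  proof -
    have "(x, \<psi> q) \<in> \<phi> ` U \<times> \<psi> ` V" using c that by blast
    from frechet_derivative_slice(4)[OF H[of "Suc 0"] this, of \<eta>] show ?thesis
      using N.chart_vec[OF w c smooth2_slice[OF F]] by (simp add: \<eta>_def H_def)
  qed
  have "v (\<lambda>p. w (F p)) = frechet_derivative (\<lambda>x. w (F (inv_into U \<phi> x))) (at (\<phi> p)) \<xi>"
    unfolding \<xi>_def by (rule M.chart_vec[OF v d swap.smooth2_deriv[OF smooth2_swap[OF F] w]])
  also have "\<dots> = frechet_derivative (\<lambda>x. frechet_derivative H (at (x, \<psi> q)) (0, \<eta>)) (at (\<phi> p)) \<xi>"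
  proof (rule arg_cong[where f="\<lambda>f. f \<xi>"], rule frechet_derivative_transform_within_open[symmetric, OF _ op(3)])
    show "(\<lambda>x. frechet_derivative H (at (x, \<psi> q)) (0, \<eta>)) differentiable at (\<phi> p)"
      using frechet_derivative_slice(1)[OF H'[of "Suc 0"] pq] unfolding differentiable_def by blast
  qed (use d wF in auto)
  also have "\<dots> = frechet_derivative (\<lambda>z. frechet_derivative H (at z) (0, \<eta>)) (at (\<phi> p, \<psi> q)) (\<xi>, 0)"
    by (rule frechet_derivative_slice(3)[OF H'[of "Suc 0"] pq])
  also have "\<dots> = frechet_derivative (\<lambda>z. frechet_derivative H (at z) (\<xi>, 0)) (at (\<phi> p, \<psi> q)) (0, \<eta>)"
    by (rule mixed_derivatives_commute[OF H op(1) pq])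
  also have "\<dots> = frechet_derivative (\<lambda>y. frechet_derivative H (at (\<phi> p, y)) (\<xi>, 0)) (at (\<psi> q)) \<eta>"
    by (rule frechet_derivative_slice(4)[OF H'[of "Suc 0"] pq, symmetric])
  also have "\<dots> = frechet_derivative (\<lambda>y. v (\<lambda>p. F p (inv_into V \<psi> y))) (at (\<psi> q)) \<eta>"
  proof (rule arg_cong[where f="\<lambda>f. f \<eta>"], rule frechet_derivative_transform_within_open[OF _ op(2)])
    show "(\<lambda>y. frechet_derivative H (at (\<phi> p, y)) (\<xi>, 0)) differentiable at (\<psi> q)"
      using frechet_derivative_slice(2)[OF H'[of "Suc 0"] pq] unfolding differentiable_def by blast
  qed (use c vF in auto)
  also have "\<dots> = w (\<lambda>q. v (\<lambda>p. F p q))"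
    unfolding \<eta>_def by (rule N.chart_vec[OF w c smooth2_deriv[OF F v], symmetric])
  finally show ?thesis .
qed

text \<open>The chain rule through a pair of charts; applied to group multiplication it becomes the
  product rule for curves.\<close>

lemma smooth2_chain:
  assumes F: "smooth2 A B F" and v: "has_vel A c1 v t" and w: "has_vel B c2 w t"
  shows "((\<lambda>s. F (c1 s) (c2 s)) has_real_derivative v (\<lambda>p. F p (c2 t)) + w (F (c1 t))) (at t)"
proof -
  obtain U \<phi> where d: "(U, \<phi>) \<in> A" "c1 t \<in> U" by (rule M.chart_at)
  obtain V \<psi> where c: "(V, \<psi>) \<in> B" "c2 t \<in> V" by (rule N.chart_at)
  have pq: "(\<phi> (c1 t), \<psi> (c2 t)) \<in> \<phi> ` U \<times> \<psi> ` V" using c d by blast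
  define H where "H z = F (inv_into U \<phi> (fst z)) (inv_into V \<psi> (snd z))" for z
  define \<xi> where "\<xi> = M.chart_vec U \<phi> (c1 t) v"
  define \<eta> where "\<eta> = N.chart_vec V \<psi> (c2 t) w"
  have H: "Ck_on k (\<phi> ` U \<times> \<psi> ` V) H" for k unfolding H_def[abs_def] by (rule smooth2_Ck[OF F d(1) c(1)])
  have v1: "v \<in> tangent_space A (c1 t)" and w1: "w \<in> tangent_space B (c2 t)"
    using v w by (auto simp: has_vel_def)
  have vF: "v (\<lambda>p. F p (c2 t)) = frechet_derivative H (at (\<phi> (c1 t), \<psi> (c2 t))) (\<xi>, 0)"
    using smooth2_chart_deriv[OF F v1 d c(1), of "\<psi> (c2 t)"] c N.chart(5)[OF c] by (simp add: \<xi>_def H_def[abs_def])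
  have wF: "w (F (c1 t)) = frechet_derivative H (at (\<phi> (c1 t), \<psi> (c2 t))) (0, \<eta>)"
    using swap.smooth2_chart_deriv[OF smooth2_swap[OF F] w1 c d(1), of "\<phi> (c1 t)"]
      frechet_derivative_slice(4)[OF H[of "Suc 0"] pq, of \<eta>] N.chart_vec[OF w1 c smooth2_slice[OF F]] M.chart(5)[OF d]
    by (simp add: \<eta>_def H_def[abs_def])
  have hd: "(H has_derivative frechet_derivative H (at (\<phi> (c1 t), \<psi> (c2 t)))) (at (\<phi> (c1 t), \<psi> (c2 t)))"
    by (rule Ck_on_has_derivative[OF H pq])
  have lin: "linear (frechet_derivative H (at (\<phi> (c1 t), \<psi> (c2 t))))" using hd has_derivative_linear by blast
  have "((\<lambda>s. (\<phi> (c1 s), \<psi> (c2 s))) has_derivative (\<lambda>h. (h *\<^sub>R \<xi>, h *\<^sub>R \<eta>))) (at t)"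
    using M.has_vel_chart[OF v d] N.has_vel_chart[OF w c]
    unfolding has_vector_derivative_def \<xi>_def \<eta>_def by (rule has_derivative_Pair)
  from has_derivative_compose[OF this, of H, OF hd]
  have "((\<lambda>s. H (\<phi> (c1 s), \<psi> (c2 s))) has_derivative
     (\<lambda>h. frechet_derivative H (at (\<phi> (c1 t), \<psi> (c2 t))) (h *\<^sub>R \<xi>, h *\<^sub>R \<eta>))) (at t)" .
  moreover have "frechet_derivative H (at (\<phi> (c1 t), \<psi> (c2 t))) (h *\<^sub>R \<xi>, h *\<^sub>R \<eta>) = h * (v (\<lambda>p. F p (c2 t)) + w (F (c1 t)))" for h
  proof -
    have e: "(h *\<^sub>R \<xi>, h *\<^sub>R \<eta>) = h *\<^sub>R ((\<xi>, 0) + (0, \<eta>))" by simp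
    show ?thesis unfolding vF wF e linear_cmul[OF lin] linear_add[OF lin] by simp
  qed
  ultimately have "((\<lambda>s. H (\<phi> (c1 s), \<psi> (c2 s))) has_derivative (\<lambda>h. h * (v (\<lambda>p. F p (c2 t)) + w (F (c1 t))))) (at t)"
    by (simp only:)
  then have "((\<lambda>s. H (\<phi> (c1 s), \<psi> (c2 s))) has_real_derivative v (\<lambda>p. F p (c2 t)) + w (F (c1 t))) (at t)"
    by (simp only: has_field_derivative_def mult_commute_abs)
  moreover have "\<forall>\<^sub>F s in nhds t. H (\<phi> (c1 s), \<psi> (c2 s)) = F (c1 s) (c2 s)"
    using M.has_vel_eventually[OF v M.chart(1)[OF d(1)] d(2)] N.has_vel_eventually[OF w N.chart(1)[OF c(1)] c(2)]
    by eventually_elim (simp add: H_def M.chart(5)[OF d(1)] N.chart(5)[OF c(1)])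
  ultimately show ?thesis by (rule DERIV_transform_eventually)
qed

end

section \<open>The left-invariant frame and the Levi-Civita connection\<close>

lemma vec3_eq_iff: "(x::real^3) = y \<longleftrightarrow> x $ 1 = y $ 1 \<and> x $ 2 = y $ 2 \<and> x $ 3 = y $ 3"
  by (simp add: vec_eq_iff forall_3)

text \<open>The structure constants: frame coordinates of the bracket of the left-invariant fields
  with coordinates \<open>x\<close> and \<open>y\<close>.\<close>

definition Lam :: "real \<Rightarrow> real \<Rightarrow> real^3 \<Rightarrow> real^3 \<Rightarrow> real^3" where
  "Lam \<kappa> \<tau> x y = vector [\<kappa> / \<tau> * (x $ 2 * y $ 3 - x $ 3 * y $ 2),
     \<kappa> / \<tau> * (x $ 3 * y $ 1 - x $ 1 * y $ 3), \<tau> * (x $ 1 * y $ 2 - x $ 2 * y $ 1)]"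

text \<open>The Koszul formula on left-invariant fields: frame coordinates of the covariant
  derivative, in direction \<open>x\<close>, of the field with coordinates \<open>y\<close>.\<close>

definition Gam :: "real \<Rightarrow> real \<Rightarrow> real^3 \<Rightarrow> real^3 \<Rightarrow> real^3" where
  "Gam \<kappa> \<tau> x y = vector [\<tau> / 2 * (x $ 2 * y $ 3) - (\<kappa> / \<tau> - \<tau> / 2) * (x $ 3 * y $ 2),
     (\<kappa> / \<tau> - \<tau> / 2) * (x $ 3 * y $ 1) - \<tau> / 2 * (x $ 1 * y $ 3),
     \<tau> / 2 * (x $ 1 * y $ 2 - x $ 2 * y $ 1)]"

lemma Lam_nth: "Lam \<kappa> \<tau> x y $ 1 = \<kappa> / \<tau> * (x $ 2 * y $ 3 - x $ 3 * y $ 2)"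
  "Lam \<kappa> \<tau> x y $ 2 = \<kappa> / \<tau> * (x $ 3 * y $ 1 - x $ 1 * y $ 3)"
  "Lam \<kappa> \<tau> x y $ 3 = \<tau> * (x $ 1 * y $ 2 - x $ 2 * y $ 1)"
  by (simp_all add: Lam_def)

lemma Gam_nth: "Gam \<kappa> \<tau> x y $ 1 = \<tau> / 2 * (x $ 2 * y $ 3) - (\<kappa> / \<tau> - \<tau> / 2) * (x $ 3 * y $ 2)"
  "Gam \<kappa> \<tau> x y $ 2 = (\<kappa> / \<tau> - \<tau> / 2) * (x $ 3 * y $ 1) - \<tau> / 2 * (x $ 1 * y $ 3)"
  "Gam \<kappa> \<tau> x y $ 3 = \<tau> / 2 * (x $ 1 * y $ 2 - x $ 2 * y $ 1)"
  by (simp_all add: Gam_def)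

lemma Gam_diff: "Gam \<kappa> \<tau> x y - Gam \<kappa> \<tau> y x = Lam \<kappa> \<tau> x y"
  by (simp add: vec3_eq_iff Lam_nth Gam_nth algebra_simps)

context manifold begin

lemma tangent_combine:
  assumes v: "v \<in> tangent_space A p" and w: "w \<in> tangent_space A p"
  shows "(\<lambda>f. a * v f + b * w f) \<in> tangent_space A p"
  unfolding tangent_space_def
proof (intro CollectI conjI ballI allI impI)
  fix f h :: "'a \<Rightarrow> real" and c d assume f: "f \<in> smooth_functions A" "h \<in> smooth_functions A"
  show "a * v (\<lambda>q. c * f q + d * h q) + b * w (\<lambda>q. c * f q + d * h q) = c * (a * v f + b * w f) + d * (a * v h + b * w h)"
    by (simp add: tangentD(1,2)[OF v] tangentD(1,2)[OF w] smooth_cmult f algebra_simps)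
  show "a * v (\<lambda>q. f q * h q) + b * w (\<lambda>q. f q * h q) = f p * (a * v h + b * w h) + (a * v f + b * w f) * h p"
    by (simp add: tangentD(4)[OF v] tangentD(4)[OF w] f algebra_simps)
next
  fix f assume "f \<notin> smooth_functions A"
  then show "a * v f + b * w f = 0" by (simp add: tangentD(5)[OF v] tangentD(5)[OF w])
qed

lemma chart_vec_eqI:
  assumes "v \<in> tangent_space A p" "w \<in> tangent_space A p" "(U, \<phi>) \<in> A" "p \<in> U"
    "chart_vec U \<phi> p v = chart_vec U \<phi> p w"
  shows "v = w"
proof
  fix f show "v f = w f"
    using chart_vec[OF assms(1,3,4), of f] chart_vec[OF assms(2,3,4), of f] assms(5)
      tangentD(5)[OF assms(1), of f] tangentD(5)[OF assms(2), of f] by (cases "f \<in> smooth_functions A") auto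
qed

lemma chart_vec_linear:
  assumes v: "v \<in> tangent_space A p" and w: "w \<in> tangent_space A p" and c: "(U, \<phi>) \<in> A" "p \<in> U"
  shows "chart_vec U \<phi> p (\<lambda>f. a * v f + b * w f) = a *\<^sub>R chart_vec U \<phi> p v + b *\<^sub>R chart_vec U \<phi> p w"
proof (rule euclidean_eqI)
  fix e :: 'e assume "e \<in> Basis"
  obtain f where f: "\<forall>v\<in>tangent_space A p. v f = chart_vec U \<phi> p v \<bullet> e"
    using coordinate_extension[OF c, of e] by blast
  show "chart_vec U \<phi> p (\<lambda>f. a * v f + b * w f) \<bullet> e = (a *\<^sub>R chart_vec U \<phi> p v + b *\<^sub>R chart_vec U \<phi> p w) \<bullet> e"
    using bspec[OF f tangent_combine[OF v w, of a b]] bspec[OF f v] bspec[OF f w] by (simp add: inner_add_left)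
qed

end

locale M3 = manifold A for A :: "('a::{t2_space, second_countable_topology}, real^3) atlas" +
  fixes \<kappa> \<tau> :: real and G :: "'a monoid" and g :: "'a metric" and u :: "3 \<Rightarrow> 'a vfield"
    and D :: "'a connection"
  assumes tau_pos: "\<tau> > 0" and M3: "is_M3 \<kappa> \<tau> G A g u" and LC: "levi_civita A g D"
begin

lemma metric: "riemannian_metric A g"
  using M3 unfolding is_M3_def left_invariant_metric_def by blast

lemma g_sym: "v \<in> tangent_space A p \<Longrightarrow> w \<in> tangent_space A p \<Longrightarrow> g p v w = g p w v"
  using metric unfolding riemannian_metric_def by blast

lemma g_linear: "v \<in> tangent_space A p \<Longrightarrow> w \<in> tangent_space A p \<Longrightarrow> z \<in> tangent_space A p \<Longrightarrow>
   g p (\<lambda>f. a * v f + b * w f) z = a * g p v z + b * g p w z"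
  using metric unfolding riemannian_metric_def by blast

lemma u_vf: "u i \<in> vector_fields A"
  using M3 unfolding is_M3_def lie_algebra_def by blast

lemma vf_tangent: "X \<in> vector_fields A \<Longrightarrow> X p \<in> tangent_space A p"
  unfolding vector_fields_def by blast

lemma vf_smooth: "X \<in> vector_fields A \<Longrightarrow> f \<in> smooth_functions A \<Longrightarrow> (\<lambda>p. X p f) \<in> smooth_functions A"
  unfolding vector_fields_def by blast

lemmas u_tangent = vf_tangent[OF u_vf]

lemma g_u: "g p (u i p) (u j p) = (if i = j then 1 else 0)"
  using M3 unfolding is_M3_def by blast

definition fr :: "real^3 \<Rightarrow> 'a \<Rightarrow> 'a tvec" where
  "fr c p = (\<lambda>f. c $ 1 * u 1 p f + c $ 2 * u 2 p f + c $ 3 * u 3 p f)"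

lemma fr_eq: "fr c p = (\<lambda>f. 1 * (\<lambda>f. c $ 1 * u 1 p f + c $ 2 * u 2 p f) f + c $ 3 * u 3 p f)"
  by (simp add: fr_def)

lemma fr_tangent: "fr c p \<in> tangent_space A p"
  unfolding fr_eq by (intro tangent_combine u_tangent)

lemma g_fr_left: "z \<in> tangent_space A p \<Longrightarrow> g p (fr c p) z = c $ 1 * g p (u 1 p) z + c $ 2 * g p (u 2 p) z + c $ 3 * g p (u 3 p) z"
  unfolding fr_eq by (simp only: g_linear tangent_combine u_tangent) simp

lemma g_fr_u: "g p (fr c p) (u i p) = c $ i"
  using exhaust_3[of i] by (auto simp: g_fr_left u_tangent g_u)

lemma g_fr: "g p (fr c p) (fr d p) = c $ 1 * d $ 1 + c $ 2 * d $ 2 + c $ 3 * d $ 3"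
  by (simp add: g_fr_left fr_tangent g_sym[OF u_tangent fr_tangent] g_fr_u)

lemma fr_inject: "fr c p = fr d p \<longleftrightarrow> c = d"
  by (metis g_fr_u vec_eq_iff)

lemma fr_zero: "fr 0 p = (\<lambda>f. 0)"
  by (simp add: fr_def)

lemma fr_add: "fr (c + d) p f = fr c p f + fr d p f"
  and fr_scale: "fr (a *\<^sub>R c) p f = a * fr c p f"
  and fr_diff: "fr (c - d) p f = fr c p f - fr d p f"
  by (simp_all add: fr_def algebra_simps)

text \<open>A dimension count. Sending frame coordinates to chart coordinates is a linear map of
  \<open>real^3\<close> to itself; it is injective by orthonormality, hence onto.\<close>

lemma tangent_fr:
  assumes v: "v \<in> tangent_space A p" obtains c where "v = fr c p"
proof -
  obtain U \<phi> where ch: "(U, \<phi>) \<in> A" "p \<in> U" by (rule chart_at)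
  define T where "T c = chart_vec U \<phi> p (fr c p)" for c
  have T: "T c = c $ 1 *\<^sub>R chart_vec U \<phi> p (u 1 p) + c $ 2 *\<^sub>R chart_vec U \<phi> p (u 2 p) + c $ 3 *\<^sub>R chart_vec U \<phi> p (u 3 p)" for c
    unfolding T_def fr_eq by (simp only: chart_vec_linear[OF _ _ ch] tangent_combine u_tangent scaleR_one)
  have lin: "linear T"
    by (rule linearI) (simp_all add: T algebra_simps)
  have "inj T"
  proof (rule injI)
    fix c d assume "T c = T d"
    then have "fr c p = fr d p" unfolding T_def by (rule chart_vec_eqI[OF fr_tangent fr_tangent ch])
    then show "c = d" by (simp add: fr_inject)
  qed
  then have "surj T" using lin linear_injective_imp_surjective by blast
  then obtain c where "chart_vec U \<phi> p v = T c" by (metis surjD)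
  then have "v = fr c p" unfolding T_def by (rule chart_vec_eqI[OF v fr_tangent ch])
  then show ?thesis by (rule that)
qed

definition coef :: "'a \<Rightarrow> 'a tvec \<Rightarrow> real^3" where
  "coef p v = (\<chi> i. g p v (u i p))"

lemma coef_fr [simp]: "coef p (fr c p) = c"
  by (simp add: coef_def g_fr_u vec_eq_iff)

lemma fr_coef: "v \<in> tangent_space A p \<Longrightarrow> fr (coef p v) p = v"
  by (metis tangent_fr coef_fr)

lemma coef_u: "coef p (u i p) = axis i 1"
  by (auto simp: coef_def g_u vec_eq_iff axis_def)

lemma u_fr: "u i p = fr (axis i 1) p"
  by (metis coef_u fr_coef u_tangent)

definition smooth_vec :: "('a \<Rightarrow> real^3) \<Rightarrow> bool" where
  "smooth_vec x \<longleftrightarrow> (\<forall>i. (\<lambda>p. x p $ i) \<in> smooth_functions A)"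

lemma smooth_vec_const: "smooth_vec (\<lambda>p. c)"
  by (simp add: smooth_vec_def smooth_const)

lemma fr_field: assumes "smooth_vec x" shows "(\<lambda>p. fr (x p) p) \<in> vector_fields A"
proof -
  have "(\<lambda>p. fr (x p) p f) \<in> smooth_functions A" if "f \<in> smooth_functions A" for f
    unfolding fr_def using assms that
    by (intro smooth_add smooth_mult vf_smooth[OF u_vf]) (auto simp: smooth_vec_def)
  then show ?thesis unfolding vector_fields_def using fr_tangent by blast
qed

lemma field_coef_smooth:
  assumes "X \<in> vector_fields A" shows "smooth_vec (\<lambda>p. coef p (X p))"
  using metric assms u_vf unfolding smooth_vec_def coef_def riemannian_metric_def by simp

lemma field_fr: "X \<in> vector_fields A \<Longrightarrow> X = (\<lambda>p. fr (coef p (X p)) p)"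
  by (simp add: fr_coef vf_tangent)

definition dv :: "'a tvec \<Rightarrow> ('a \<Rightarrow> real^3) \<Rightarrow> real^3" where
  "dv v x = (\<chi> i. v (\<lambda>q. x q $ i))"

lemma dv_nth: "dv v x $ i = v (\<lambda>q. x q $ i)"
  by (simp add: dv_def)

section \<open>The connection in the frame\<close>

lemmas LC_conj = LC[unfolded levi_civita_def affine_connection_def conj_assoc]

lemma D_tangent: "v \<in> tangent_space A p \<Longrightarrow> Y \<in> vector_fields A \<Longrightarrow> D p v Y \<in> tangent_space A p"
  by (rule LC_conj[THEN conjunct1, rule_format])

lemma D_linear: "v \<in> tangent_space A p \<Longrightarrow> w \<in> tangent_space A p \<Longrightarrow> Y \<in> vector_fields A \<Longrightarrow>
    D p (\<lambda>f. a * v f + b * w f) Y = (\<lambda>f. a * D p v Y f + b * D p w Y f)"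
  by (rule LC_conj[THEN conjunct2, THEN conjunct1, rule_format])

lemma D_add: "v \<in> tangent_space A p \<Longrightarrow> Y \<in> vector_fields A \<Longrightarrow> Z \<in> vector_fields A \<Longrightarrow>
    D p v (\<lambda>q f. Y q f + Z q f) = (\<lambda>f. D p v Y f + D p v Z f)"
  by (rule LC_conj[THEN conjunct2, THEN conjunct2, THEN conjunct1, rule_format])

lemma D_leibniz: "v \<in> tangent_space A p \<Longrightarrow> Y \<in> vector_fields A \<Longrightarrow> h \<in> smooth_functions A \<Longrightarrow>
    D p v (\<lambda>q f. h q * Y q f) = (\<lambda>f. v h * Y p f + h p * D p v Y f)"
  by (rule LC_conj[THEN conjunct2, THEN conjunct2, THEN conjunct2, THEN conjunct1, rule_format])

lemma D_torsion: "X \<in> vector_fields A \<Longrightarrow> Y \<in> vector_fields A \<Longrightarrow>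
    D p (X p) Y f - D p (Y p) X f = lie_bracket X Y p f"
  by (rule LC_conj[THEN conjunct2, THEN conjunct2, THEN conjunct2, THEN conjunct2, THEN conjunct2, THEN conjunct1, rule_format])

lemma D_metric: "v \<in> tangent_space A p \<Longrightarrow> Y \<in> vector_fields A \<Longrightarrow> Z \<in> vector_fields A \<Longrightarrow>
    v (\<lambda>q. g q (Y q) (Z q)) = g p (D p v Y) (Z p) + g p (Y p) (D p v Z)"
  by (rule LC_conj[THEN conjunct2, THEN conjunct2, THEN conjunct2, THEN conjunct2, THEN conjunct2, THEN conjunct2, rule_format])

lemma bracket_u:
  "lie_bracket (u 1) (u 2) p = fr (vector [0, 0, \<tau>]) p"
  "lie_bracket (u 2) (u 3) p = fr (vector [\<kappa> / \<tau>, 0, 0]) p"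
  "lie_bracket (u 3) (u 1) p = fr (vector [0, \<kappa> / \<tau>, 0]) p"
  using M3 unfolding is_M3_def fr_def by simp_all

text \<open>Compatibility with the metric makes the Christoffel symbols skew in the last two
  indices, and vanishing torsion fixes their differences in the first two by the structure
  constants. These linear relations have \<open>Gam\<close> as their only solution.\<close>

lemma D_u: "D p (u i p) (u j) = fr (Gam \<kappa> \<tau> (axis i 1) (axis j 1)) p"
proof -
  define \<Gamma> where "\<Gamma> i j k = coef p (D p (u i p) (u j)) $ k" for i j k
  have t: "D p (u i p) (u j) \<in> tangent_space A p" for i j by (intro D_tangent u_tangent u_vf)
  have skew: "\<Gamma> i j k = - \<Gamma> i k j" for i j k
  proof -
    have "u i p (\<lambda>q. g q (u j q) (u k q)) = \<Gamma> i j k + g p (u j p) (D p (u i p) (u k))"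
      by (simp add: D_metric u_tangent u_vf \<Gamma>_def coef_def)
    also have "g p (u j p) (D p (u i p) (u k)) = \<Gamma> i k j"
      by (simp add: \<Gamma>_def coef_def g_sym[OF u_tangent t])
    finally show ?thesis by (simp add: g_u tangentD(6)[OF u_tangent])
  qed
  have tor: "\<Gamma> i j k - \<Gamma> j i k = c $ k" if "lie_bracket (u i) (u j) p = fr c p" for i j k c
  proof -
    have "fr (coef p (D p (u i p) (u j)) - coef p (D p (u j p) (u i))) p = fr c p"
      using D_torsion[OF u_vf[of i] u_vf[of j], of p] by (intro ext) (simp add: fr_diff fr_coef t flip: that)
    then show ?thesis unfolding fr_inject \<Gamma>_def by (metis vector_minus_component)
  qed
  note tors = tor[OF bracket_u(1)] tor[OF bracket_u(2)] tor[OF bracket_u(3)]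
  have d: "\<Gamma> i j j = 0" for i j using skew[of i j j] by simp
  have "coef p (D p (u i p) (u j)) = Gam \<kappa> \<tau> (axis i 1) (axis j 1)"
    unfolding vec3_eq_iff \<Gamma>_def[symmetric]
    using exhaust_3[of i] exhaust_3[of j] d[of 1] d[of 2] d[of 3]
      tors[of 1] tors[of 2] tors[of 3]
      skew[of 1 1 2] skew[of 1 1 3] skew[of 1 2 3] skew[of 2 1 2] skew[of 2 1 3] skew[of 2 2 3]
      skew[of 3 1 2] skew[of 3 1 3] skew[of 3 2 3]
    by (elim disjE) (simp_all add: Gam_nth axis_def d)
  then show ?thesis by (metis fr_coef t)
qed

lemma D_fr_u: "D p (fr c p) (u j) = fr (Gam \<kappa> \<tau> c (axis j 1)) p"
proof -
  have "D p (fr c p) (u j) = (\<lambda>f. c $ 1 * D p (u 1 p) (u j) f + c $ 2 * D p (u 2 p) (u j) f + c $ 3 * D p (u 3 p) (u j) f)"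
    unfolding fr_eq by (simp only: D_linear tangent_combine u_tangent u_vf) simp
  also have "\<dots> = fr (Gam \<kappa> \<tau> c (axis j 1)) p"
    by (rule ext) (simp add: D_u fr_def Gam_nth axis_def algebra_simps)
  finally show ?thesis .
qed

lemma D_fr:
  assumes x: "smooth_vec x"
  shows "D p (fr c p) (\<lambda>q. fr (x q) q) = fr (dv (fr c p) x + Gam \<kappa> \<tau> c (x p)) p"
proof -
  have s: "(\<lambda>q. x q $ i) \<in> smooth_functions A" for i using x by (simp add: smooth_vec_def)
  have vf: "(\<lambda>q f. x q $ i * u i q f) \<in> vector_fields A" for i
  proof -
    have "smooth_vec (\<lambda>q. axis i (x q $ i))"
      unfolding smooth_vec_def
    proof
      fix k show "(\<lambda>q. axis i (x q $ i) $ k) \<in> smooth_functions A"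
        using s[of i] smooth_const[of 0] by (cases "k = i") (simp_all add: axis_def)
    qed
    from fr_field[OF this] show ?thesis
      using exhaust_3[of i] by (auto simp: fr_def axis_def)
  qed
  have vf2: "(\<lambda>q f. x q $ 1 * u 1 q f + x q $ 2 * u 2 q f) \<in> vector_fields A"
  proof -
    have "smooth_vec (\<lambda>q. vector [x q $ 1, x q $ 2, 0])"
      using s smooth_const[of 0] by (simp add: smooth_vec_def forall_3)
    from fr_field[OF this] show ?thesis by (simp add: fr_def)
  qed
  have "D p (fr c p) (\<lambda>q. fr (x q) q) = D p (fr c p) (\<lambda>q f. (x q $ 1 * u 1 q f + x q $ 2 * u 2 q f) + x q $ 3 * u 3 q f)"
    by (simp add: fr_def)
  also have "\<dots> = (\<lambda>f. D p (fr c p) (\<lambda>q f. x q $ 1 * u 1 q f) f + D p (fr c p) (\<lambda>q f. x q $ 2 * u 2 q f) f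
      + D p (fr c p) (\<lambda>q f. x q $ 3 * u 3 q f) f)"
    by (simp only: D_add[OF fr_tangent vf2 vf] D_add[OF fr_tangent vf vf])
  also have "\<dots> = fr (dv (fr c p) x + Gam \<kappa> \<tau> c (x p)) p"
    unfolding D_leibniz[OF fr_tangent u_vf s] D_fr_u
    by (rule ext) (simp add: fr_def dv_nth Gam_nth axis_def algebra_simps)
  finally show ?thesis .
qed

lemma bracket_fr:
  assumes x: "smooth_vec x" and y: "smooth_vec y"
  shows "lie_bracket (\<lambda>q. fr (x q) q) (\<lambda>q. fr (y q) q) p =
    fr (dv (fr (x p) p) y - dv (fr (y p) p) x + Lam \<kappa> \<tau> (x p) (y p)) p"
  by (rule ext) (simp add: D_torsion[symmetric] fr_field x y D_fr Gam_diff[symmetric] fr_diff fr_add)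

end

text \<open>Componentwise derivatives, so that the rules for real-valued functions apply directly.\<close>

abbreviation hvd :: "(real \<Rightarrow> real^3) \<Rightarrow> real^3 \<Rightarrow> real \<Rightarrow> bool" where
  "hvd y d t \<equiv> (\<forall>i. ((\<lambda>s. y s $ i) has_real_derivative d $ i) (at t))"

section \<open>Curvature, geodesics and Jacobi fields in the frame\<close>

definition Rm :: "real \<Rightarrow> real \<Rightarrow> real^3 \<Rightarrow> real^3 \<Rightarrow> real^3 \<Rightarrow> real^3" where
  "Rm \<kappa> \<tau> x y z = Gam \<kappa> \<tau> x (Gam \<kappa> \<tau> y z) - Gam \<kappa> \<tau> y (Gam \<kappa> \<tau> x z) - Gam \<kappa> \<tau> (Lam \<kappa> \<tau> x y) z"

lemma Gam_add: "Gam \<kappa> \<tau> (x + x') y = Gam \<kappa> \<tau> x y + Gam \<kappa> \<tau> x' y"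
  "Gam \<kappa> \<tau> x (y + y') = Gam \<kappa> \<tau> x y + Gam \<kappa> \<tau> x y'"
  "Gam \<kappa> \<tau> (x - x') y = Gam \<kappa> \<tau> x y - Gam \<kappa> \<tau> x' y"
  "Gam \<kappa> \<tau> x (y - y') = Gam \<kappa> \<tau> x y - Gam \<kappa> \<tau> x y'"
  "Gam \<kappa> \<tau> (a *\<^sub>R x) y = a *\<^sub>R Gam \<kappa> \<tau> x y"
  "Gam \<kappa> \<tau> x (a *\<^sub>R y) = a *\<^sub>R Gam \<kappa> \<tau> x y"
  "Gam \<kappa> \<tau> 0 y = 0" "Gam \<kappa> \<tau> x 0 = 0"
  by (simp_all add: vec3_eq_iff Gam_nth algebra_simps)

lemma Gam_sum: "Gam \<kappa> \<tau> x (\<Sum>i\<in>I. y i) = (\<Sum>i\<in>I. Gam \<kappa> \<tau> x (y i))"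
  by (induction I rule: infinite_finite_induct) (simp_all add: Gam_add)

text \<open>The Jacobi equation is the linearization of \<open>v' = - Gam v v\<close>. The left side
  is what it prescribes for the derivative of \<open>z = w + Gam y v\<close>; the right side
  differentiates \<open>z\<close> by the product rule, with \<open>y' = w - Lam v y\<close> and the
  linearized equation for \<open>w\<close>.\<close>

lemma jacobi_linearized_euler:
  "- Gam \<kappa> \<tau> v (w + Gam \<kappa> \<tau> y v) - Rm \<kappa> \<tau> y v v
     = - Gam \<kappa> \<tau> w v - Gam \<kappa> \<tau> v w + (Gam \<kappa> \<tau> (w - Lam \<kappa> \<tau> v y) v + Gam \<kappa> \<tau> y (- Gam \<kappa> \<tau> v v))"
proof -
  \<comment> \<open>As atoms these turn the claim into a polynomial identity without
    fractions.\<close>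
  define om h where "om = \<kappa> / \<tau>" and "h = \<tau> / 2"
  have t: "\<tau> = 2 * h" by (simp add: h_def)
  show ?thesis
    unfolding Rm_def vec3_eq_iff vector_add_component vector_minus_component vector_uminus_component Gam_nth Lam_nth om_def[symmetric] h_def[symmetric]
    unfolding t by (simp add: algebra_simps)
qed

lemma hvd_Gam:
  assumes "hvd x x' t" "hvd y y' t"
  shows "hvd (\<lambda>s. Gam \<kappa> \<tau> (x s) (y s)) (Gam \<kappa> \<tau> x' (y t) + Gam \<kappa> \<tau> (x t) y') t"
proof -
  have x: "((\<lambda>s. x s $ i) has_real_derivative x' $ i) (at t)" and y: "((\<lambda>s. y s $ i) has_real_derivative y' $ i) (at t)" for i
    using assms by auto
  show ?thesis unfolding forall_3 Gam_nth
    by (intro conjI; rule DERIV_cong, (rule DERIV_diff DERIV_cmult DERIV_mult x y)+, simp add: Gam_nth algebra_simps)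
qed

lemma hvd_add: "hvd x x' t \<Longrightarrow> hvd y y' t \<Longrightarrow> hvd (\<lambda>s. x s + y s) (x' + y') t"
  and hvd_diff: "hvd x x' t \<Longrightarrow> hvd y y' t \<Longrightarrow> hvd (\<lambda>s. x s - y s) (x' - y') t"
  by (simp_all add: DERIV_add DERIV_diff)

context M3 begin

lemma smooth_vecD: "smooth_vec x \<Longrightarrow> (\<lambda>p. x p $ i) \<in> smooth_functions A"
  by (simp add: smooth_vec_def)

lemma smooth_vec_Gam:
  "smooth_vec x \<Longrightarrow> smooth_vec y \<Longrightarrow> smooth_vec (\<lambda>p. Gam \<kappa> \<tau> (x p) (y p))"
  unfolding smooth_vec_def forall_3 Gam_nth
  by (intro conjI smooth_diff smooth_add smooth_mult smooth_cmult) auto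

lemma smooth_vec_dv:
  "smooth_vec x \<Longrightarrow> smooth_vec y \<Longrightarrow> smooth_vec (\<lambda>p. dv (fr (y p) p) x)"
  unfolding smooth_vec_def dv_nth using vf_smooth[OF fr_field[of y]] by (simp add: smooth_vec_def)

lemma dv_Gam:
  assumes v: "v \<in> tangent_space A p" and x: "smooth_vec x" and y: "smooth_vec y"
  shows "dv v (\<lambda>q. Gam \<kappa> \<tau> (x q) (y q)) = Gam \<kappa> \<tau> (dv v x) (y p) + Gam \<kappa> \<tau> (x p) (dv v y)"
  by (simp only: vec3_eq_iff vector_add_component dv_nth Gam_nth tangentD(1-4)[OF v] smooth_diff smooth_mult smooth_cmult
      smooth_vecD[OF x] smooth_vecD[OF y]) (simp add: algebra_simps)

lemma dv_add:
  assumes v: "v \<in> tangent_space A p" and x: "smooth_vec x" and y: "smooth_vec y"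
  shows "dv v (\<lambda>q. x q + y q) = dv v x + dv v y"
  by (simp add: vec3_eq_iff dv_nth tangentD(1)[OF v] smooth_vecD[OF x] smooth_vecD[OF y])

lemma smooth_vec_add: "smooth_vec x \<Longrightarrow> smooth_vec y \<Longrightarrow> smooth_vec (\<lambda>p. x p + y p)"
  by (simp add: smooth_vec_def smooth_add)

text \<open>Second derivatives of the coefficients \<open>z\<close> occur only in a commutator,
  which the derivative along the bracket cancels (\<open>dvb\<close>). The first-order terms cancel
  too, and the algebraic part \<open>Rm\<close> remains.\<close>

lemma curvature_field_fr:
  assumes x: "smooth_vec x" and y: "smooth_vec y" and z: "smooth_vec z"
  shows "curvature_field D (\<lambda>q. fr (x q) q) (\<lambda>q. fr (y q) q) (\<lambda>q. fr (z q) q) p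
    = fr (Rm \<kappa> \<tau> (x p) (y p) (z p)) p"
proof
  fix f
  define b where "b = dv (fr (x p) p) y - dv (fr (y p) p) x + Lam \<kappa> \<tau> (x p) (y p)"
  have br: "lie_bracket (\<lambda>q. fr (x q) q) (\<lambda>q. fr (y q) q) p = fr b p"
    unfolding b_def by (rule bracket_fr[OF x y])
  have dvb: "dv (fr b p) z = dv (fr (x p) p) (\<lambda>q. dv (fr (y q) q) z) - dv (fr (y p) p) (\<lambda>q. dv (fr (x q) q) z)"
    unfolding br[symmetric] by (simp add: vec_eq_iff dv_nth lie_bracket_def)
  have s: "smooth_vec (\<lambda>q. dv (fr (y q) q) z + Gam \<kappa> \<tau> (y q) (z q))" "smooth_vec (\<lambda>q. dv (fr (x q) q) z + Gam \<kappa> \<tau> (x q) (z q))"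
    by (intro smooth_vec_add smooth_vec_dv smooth_vec_Gam x y z)+
  show "curvature_field D (\<lambda>q. fr (x q) q) (\<lambda>q. fr (y q) q) (\<lambda>q. fr (z q) q) p f = fr (Rm \<kappa> \<tau> (x p) (y p) (z p)) p f"
    unfolding curvature_field_def br D_fr[OF z] D_fr[OF s(1)] D_fr[OF s(2)] fr_diff[symmetric] dvb
    by (simp add: dv_add[OF fr_tangent] smooth_vec_dv smooth_vec_Gam dv_Gam[OF fr_tangent] x y z Gam_add b_def Rm_def algebra_simps)
qed

text \<open>The description by \<open>THE\<close> needs one value for all extensions. By
  \<open>curvature_field_fr\<close> the value depends on the three vectors alone, and extensions
  with constant coefficients show that there is no other.\<close>

lemma curvature_fr: "curvature A D p (fr a p) (fr b p) (fr c p) = fr (Rm \<kappa> \<tau> a b c) p"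
  unfolding curvature_def
proof (rule the_equality)
  show "\<forall>X\<in>vector_fields A. \<forall>Y\<in>vector_fields A. \<forall>Z\<in>vector_fields A.
     X p = fr a p \<and> Y p = fr b p \<and> Z p = fr c p \<longrightarrow> fr (Rm \<kappa> \<tau> a b c) p = curvature_field D X Y Z p"
  proof (intro ballI impI, elim conjE)
    fix X Y Z assume v: "X \<in> vector_fields A" "Y \<in> vector_fields A" "Z \<in> vector_fields A"
      and e: "X p = fr a p" "Y p = fr b p" "Z p = fr c p"
    show "fr (Rm \<kappa> \<tau> a b c) p = curvature_field D X Y Z p"
      using curvature_field_fr[OF v[THEN field_coef_smooth], of p] v[THEN field_fr, symmetric] e by simp
  qed
  fix r assume "\<forall>X\<in>vector_fields A. \<forall>Y\<in>vector_fields A. \<forall>Z\<in>vector_fields A.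
     X p = fr a p \<and> Y p = fr b p \<and> Z p = fr c p \<longrightarrow> r = curvature_field D X Y Z p"
  moreover have "(\<lambda>q. fr k q) \<in> vector_fields A" for k by (rule fr_field[OF smooth_vec_const])
  ultimately have "r = curvature_field D (\<lambda>q. fr a q) (\<lambda>q. fr b q) (\<lambda>q. fr c q) p" by blast
  then show "r = fr (Rm \<kappa> \<tau> a b c) p"
    using curvature_field_fr[OF smooth_vec_const smooth_vec_const smooth_vec_const, of a b c p] by simp
qed

lemma fr_sum: "fr (\<Sum>i\<in>I. c i) p f = (\<Sum>i\<in>I. fr (c i) p f)"
  by (simp add: fr_def sum_distrib_right sum.distrib)

lemma hvd_compose:
  assumes "has_vel A \<gamma> v t" "smooth_vec x" shows "hvd (\<lambda>s. x (\<gamma> s)) (dv v x) t"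
proof
  fix i
  have "(\<lambda>p. x p $ i) \<in> smooth_functions A" using assms(2) by (simp add: smooth_vec_def)
  from bspec[OF conjunct2[OF assms(1)[unfolded has_vel_def]] this]
  show "((\<lambda>s. x (\<gamma> s) $ i) has_real_derivative dv v x $ i) (at t)" by (simp add: dv_nth)
qed

definition vel :: "(real \<Rightarrow> 'a) \<Rightarrow> real \<Rightarrow> real^3" where
  "vel \<gamma> t = coef (\<gamma> t) (velocity A \<gamma> t)"

lemma velocity_fr: "smooth_curve A \<gamma> \<Longrightarrow> velocity A \<gamma> t = fr (vel \<gamma> t) (\<gamma> t)"
  unfolding vel_def using has_vel_velocity by (simp add: fr_coef has_vel_def)

lemma has_vel_vel: "smooth_curve A \<gamma> \<Longrightarrow> has_vel A \<gamma> (fr (vel \<gamma> t) (\<gamma> t)) t"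
  using has_vel_velocity velocity_fr by metis

text \<open>The unknown combination of fields \<open>E i\<close> is rewritten in the frame. Its
  Leibniz terms add up to the derivative of the coordinate vector \<open>y\<close> plus
  \<open>Gam\<close>, an expression in which the combination no longer appears.\<close>

lemma covariant_derivative_alongD:
  assumes \<gamma>: "smooth_curve A \<gamma>" and cd: "covariant_derivative_along A D \<gamma> V W"
  obtains y y' where "\<And>i k. Ck_on k UNIV (\<lambda>t. y t $ i)" "\<And>t. hvd y (y' t) t"
    "\<And>t. V t = fr (y t) (\<gamma> t)" "\<And>t. W t = fr (y' t + Gam \<kappa> \<tau> (vel \<gamma> t) (y t)) (\<gamma> t)"
proof -
  obtain n c E where c: "\<And>i. i < n \<Longrightarrow> smooth_on UNIV (c i)" and E: "\<And>i. i < n \<Longrightarrow> E i \<in> vector_fields A"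
    and V: "V = (\<lambda>t f. \<Sum>i<(n::nat). c i t * E i (\<gamma> t) f)"
    and W: "W = (\<lambda>t f. \<Sum>i<n. deriv (c i) t * E i (\<gamma> t) f + c i t * D (\<gamma> t) (velocity A \<gamma> t) (E i) f)"
    using cd unfolding covariant_derivative_along_def by blast
  define e where "e i q = coef q (E i q)" for i q
  have e: "smooth_vec (e i)" "E i = (\<lambda>q. fr (e i q) q)" if "i < n" for i
    unfolding e_def using field_coef_smooth[OF E[OF that]] field_fr[OF E[OF that]] by auto
  define y where "y t = (\<Sum>i<n. c i t *\<^sub>R e i (\<gamma> t))" for t
  define y' where "y' t = (\<Sum>i<n. deriv (c i) t *\<^sub>R e i (\<gamma> t) + c i t *\<^sub>R dv (fr (vel \<gamma> t) (\<gamma> t)) (e i))" for t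
  have c': "(c i has_real_derivative deriv (c i) t) (at t)" if "i < n" for i t
  proof -
    have "Ck_on (Suc 0) UNIV (c i)" using c[OF that] unfolding smooth_on_def by blast
    then show ?thesis by (simp add: DERIV_deriv_iff_real_differentiable)
  qed
  show ?thesis
  proof
    show "Ck_on k UNIV (\<lambda>t. y t $ i)" for i k
      unfolding y_def using c e(1)[THEN smooth_vecD, THEN smooth_curve_Ck[OF \<gamma>]]
      by (auto simp: smooth_on_def sum_component intro!: Ck_on_sum Ck_on_mult)
    show "hvd y (y' t) t" for t
      unfolding y_def y'_def using hvd_compose[OF has_vel_vel[OF \<gamma>] e(1)] c'
      by (auto simp: sum_component intro!: DERIV_sum derivative_eq_intros)
    show "V t = fr (y t) (\<gamma> t)" for t
      unfolding V y_def by (rule ext) (simp add: fr_sum fr_scale e(2))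
    show "W t = fr (y' t + Gam \<kappa> \<tau> (vel \<gamma> t) (y t)) (\<gamma> t)" for t
      unfolding W y_def y'_def velocity_fr[OF \<gamma>] Gam_sum
      by (rule ext) (simp add: fr_sum fr_scale fr_add e D_fr Gam_add sum.distrib algebra_simps)
  qed
qed

lemma covariant_derivative_alongI:
  assumes \<gamma>: "smooth_curve A \<gamma>" and y: "\<And>i k. Ck_on k UNIV (\<lambda>t. y t $ i)" "\<And>t. hvd y (y' t) t"
  shows "covariant_derivative_along A D \<gamma> (\<lambda>t. fr (y t) (\<gamma> t)) (\<lambda>t. fr (y' t + Gam \<kappa> \<tau> (vel \<gamma> t) (y t)) (\<gamma> t))"
proof -
  \<comment> \<open>The definition sums over \<open>nat\<close>, the frame is indexed by the type
    \<open>3\<close>; this enumerates the latter.\<close>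
  define j :: "nat \<Rightarrow> 3" where "j i = (if i = 0 then 1 else if i = 1 then 2 else 3)" for i
  have s3: "(\<Sum>i<3::nat. h i) = h 0 + h 1 + h 2" for h :: "nat \<Rightarrow> real"
    by (simp add: eval_nat_numeral)
  have d: "deriv (\<lambda>t. y t $ i) t = y' t $ i" for i t using y(2)[of t] DERIV_imp_deriv by blast
  show ?thesis unfolding covariant_derivative_along_def
  proof (intro exI[of _ 3] exI[of _ "\<lambda>i t. y t $ j i"] exI[of _ "\<lambda>i. u (j i)"] conjI allI impI)
    show "smooth_on UNIV (\<lambda>t. y t $ j i)" "u (j i) \<in> vector_fields A" for i using y u_vf by (auto simp: smooth_on_def)
    show "(\<lambda>t. fr (y t) (\<gamma> t)) = (\<lambda>t f. \<Sum>i<3. y t $ j i * u (j i) (\<gamma> t) f)"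
      unfolding s3 by (simp add: j_def fr_def)
    show "(\<lambda>t. fr (y' t + Gam \<kappa> \<tau> (vel \<gamma> t) (y t)) (\<gamma> t)) =
      (\<lambda>t f. \<Sum>i<3. deriv (\<lambda>t. y t $ j i) t * u (j i) (\<gamma> t) f + y t $ j i * D (\<gamma> t) (velocity A \<gamma> t) (u (j i)) f)"
      unfolding s3 velocity_fr[OF \<gamma>] D_fr_u d
      by (intro ext) (simp add: j_def fr_def Gam_nth axis_def algebra_simps)
  qed
qed

text \<open>The Euler-Arnold equation: the body velocity satisfies an autonomous quadratic system in
  \<open>real^3\<close> in which the point of the group does not occur.\<close>

lemma geodesic_equation:
  assumes "unit_speed_geodesic A g D \<gamma>"
  shows "smooth_curve A \<gamma>" "Ck_on k UNIV (\<lambda>t. vel \<gamma> t $ i)" "hvd (vel \<gamma>) (- Gam \<kappa> \<tau> (vel \<gamma> t) (vel \<gamma> t)) t"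
    "(vel \<gamma> t $ 1)\<^sup>2 + (vel \<gamma> t $ 2)\<^sup>2 + (vel \<gamma> t $ 3)\<^sup>2 = 1"
proof -
  show \<gamma>: "smooth_curve A \<gamma>" using assms by (simp add: unit_speed_geodesic_def)
  have cd: "covariant_derivative_along A D \<gamma> (velocity A \<gamma>) (\<lambda>t f. 0)"
    using assms by (simp add: unit_speed_geodesic_def)
  obtain y y' where y: "\<And>i k. Ck_on k UNIV (\<lambda>t. y t $ i)" "\<And>t. hvd y (y' t) t"
    "\<And>t. velocity A \<gamma> t = fr (y t) (\<gamma> t)" "\<And>t. (\<lambda>f. 0) = fr (y' t + Gam \<kappa> \<tau> (vel \<gamma> t) (y t)) (\<gamma> t)"
    using covariant_derivative_alongD[OF \<gamma> cd] by metis
  have yv: "y = vel \<gamma>" by (rule ext) (simp add: vel_def y(3))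
  have "y' t + Gam \<kappa> \<tau> (vel \<gamma> t) (y t) = 0" for t using y(4)[of t] unfolding fr_zero[of "\<gamma> t", symmetric] fr_inject by (rule sym)
  then have "y' t = - Gam \<kappa> \<tau> (vel \<gamma> t) (vel \<gamma> t)" for t by (simp add: yv eq_neg_iff_add_eq_0)
  then show "Ck_on k UNIV (\<lambda>t. vel \<gamma> t $ i)" "hvd (vel \<gamma>) (- Gam \<kappa> \<tau> (vel \<gamma> t) (vel \<gamma> t)) t"
    using y yv by metis+
  have "g (\<gamma> t) (velocity A \<gamma> t) (velocity A \<gamma> t) = 1" using assms by (simp add: unit_speed_geodesic_def)
  then show "(vel \<gamma> t $ 1)\<^sup>2 + (vel \<gamma> t $ 2)\<^sup>2 + (vel \<gamma> t $ 3)\<^sup>2 = 1"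
    unfolding velocity_fr[OF \<gamma>] g_fr by (simp add: power2_eq_square)
qed

text \<open>The Jacobi equation as a first-order system: \<open>w\<close> is the variation of the body velocity.\<close>

lemma jacobi_fieldD:
  assumes \<gamma>: "unit_speed_geodesic A g D \<gamma>" and J: "jacobi_field A D \<gamma> J"
  obtains y w where "\<And>t. J t = fr (y t) (\<gamma> t)"
    "\<And>t. hvd y (w t - Lam \<kappa> \<tau> (vel \<gamma> t) (y t)) t"
    "\<And>t. hvd w (- Gam \<kappa> \<tau> (w t) (vel \<gamma> t) - Gam \<kappa> \<tau> (vel \<gamma> t) (w t)) t"
proof -
  note v = geodesic_equation[OF \<gamma>]
  obtain J' J'' where cd: "covariant_derivative_along A D \<gamma> J J'" "covariant_derivative_along A D \<gamma> J' J''"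
    and eq: "\<And>t f. J'' t f + curvature A D (\<gamma> t) (J t) (velocity A \<gamma> t) (velocity A \<gamma> t) f = 0"
    using J unfolding jacobi_field_def by blast
  obtain y y' where y: "\<And>t. hvd y (y' t) t" "\<And>t. J t = fr (y t) (\<gamma> t)" "\<And>t. J' t = fr (y' t + Gam \<kappa> \<tau> (vel \<gamma> t) (y t)) (\<gamma> t)"
    using covariant_derivative_alongD[OF v(1) cd(1)] by metis
  obtain z z' where z: "\<And>t. hvd z (z' t) t" "\<And>t. J' t = fr (z t) (\<gamma> t)" "\<And>t. J'' t = fr (z' t + Gam \<kappa> \<tau> (vel \<gamma> t) (z t)) (\<gamma> t)"
    using covariant_derivative_alongD[OF v(1) cd(2)] by metis
  have zy: "z t = y' t + Gam \<kappa> \<tau> (vel \<gamma> t) (y t)" for t using y(3) z(2) by (metis fr_inject)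
  have "fr (z' t + Gam \<kappa> \<tau> (vel \<gamma> t) (z t) + Rm \<kappa> \<tau> (y t) (vel \<gamma> t) (vel \<gamma> t)) (\<gamma> t) = fr 0 (\<gamma> t)" for t
    using eq[of t] unfolding y(2) z(3) velocity_fr[OF v(1)] curvature_fr fr_zero
    by (intro ext) (simp add: fr_add)
  then have zeq: "z' t = - Gam \<kappa> \<tau> (vel \<gamma> t) (z t) - Rm \<kappa> \<tau> (y t) (vel \<gamma> t) (vel \<gamma> t)" for t
    unfolding fr_inject by (simp add: eq_diff_eq eq_neg_iff_add_eq_0 add.assoc add.commute add.left_commute)
  \<comment> \<open>As \<open>z\<close> is \<open>y' + Gam v y\<close>, subtracting
    \<open>Gam y v\<close> leaves \<open>y' + Lam v y\<close>, the variation of the body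
    velocity.\<close>
  define w where "w t = z t - Gam \<kappa> \<tau> (y t) (vel \<gamma> t)" for t
  have y'w: "y' t = w t - Lam \<kappa> \<tau> (vel \<gamma> t) (y t)" for t
    unfolding w_def zy Gam_diff[symmetric] by simp
  have "hvd w (z' t - (Gam \<kappa> \<tau> (y' t) (vel \<gamma> t) + Gam \<kappa> \<tau> (y t) (- Gam \<kappa> \<tau> (vel \<gamma> t) (vel \<gamma> t)))) t" for t
    unfolding w_def[abs_def] by (rule hvd_diff[OF z(1) hvd_Gam[OF y(1) v(3)]])
  moreover have "z' t - (Gam \<kappa> \<tau> (y' t) (vel \<gamma> t) + Gam \<kappa> \<tau> (y t) (- Gam \<kappa> \<tau> (vel \<gamma> t) (vel \<gamma> t)))
     = - Gam \<kappa> \<tau> (w t) (vel \<gamma> t) - Gam \<kappa> \<tau> (vel \<gamma> t) (w t)" for t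
  proof -
    have "z t = w t + Gam \<kappa> \<tau> (y t) (vel \<gamma> t)" by (simp add: w_def)
    then show ?thesis using jacobi_linearized_euler[of \<kappa> \<tau> "vel \<gamma> t" "w t" "y t"]
      unfolding zeq y'w by simp
  qed
  ultimately have W: "hvd w (- Gam \<kappa> \<tau> (w t) (vel \<gamma> t) - Gam \<kappa> \<tau> (vel \<gamma> t) (w t)) t" for t by (simp only: simp_thms)
  have Y: "hvd y (w t - Lam \<kappa> \<tau> (vel \<gamma> t) (y t)) t" for t using y(1)[of t] by (simp only: y'w simp_thms)
  show ?thesis by (rule that[OF y(2) Y W])
qed

text \<open>The substitution of \<open>jacobi_fieldD\<close> read backwards: \<open>z\<close>
  becomes the covariant derivative of the field, and \<open>jacobi_linearized_euler\<close>
  identifies its derivative. This is how explicit Jacobi fields are produced.\<close>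

lemma jacobi_fieldI:
  assumes \<gamma>: "unit_speed_geodesic A g D \<gamma>"
    and y: "\<And>i k. Ck_on k UNIV (\<lambda>t. y t $ i)" "\<And>t. hvd y (w t - Lam \<kappa> \<tau> (vel \<gamma> t) (y t)) t"
    and w: "\<And>i k. Ck_on k UNIV (\<lambda>t. w t $ i)" "\<And>t. hvd w (- Gam \<kappa> \<tau> (w t) (vel \<gamma> t) - Gam \<kappa> \<tau> (vel \<gamma> t) (w t)) t"
  shows "jacobi_field A D \<gamma> (\<lambda>t. fr (y t) (\<gamma> t))"
proof -
  note v = geodesic_equation[OF \<gamma>]
  define z where "z t = w t + Gam \<kappa> \<tau> (y t) (vel \<gamma> t)" for t
  define z' where "z' t = - Gam \<kappa> \<tau> (vel \<gamma> t) (z t) - Rm \<kappa> \<tau> (y t) (vel \<gamma> t) (vel \<gamma> t)" for t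
  have zy: "z t = (w t - Lam \<kappa> \<tau> (vel \<gamma> t) (y t)) + Gam \<kappa> \<tau> (vel \<gamma> t) (y t)" for t
    unfolding z_def Gam_diff[symmetric] by simp
  have "\<forall>i. Ck_on k UNIV (\<lambda>t. z t $ i)" for k
    unfolding z_def forall_3 vector_add_component Gam_nth
    by (intro conjI Ck_on_add Ck_on_diff Ck_on_mult Ck_on_const y(1) w(1) v(2) open_UNIV)
  then have zs: "Ck_on k UNIV (\<lambda>t. z t $ i)" for k i by blast
  have "hvd z (- Gam \<kappa> \<tau> (w t) (vel \<gamma> t) - Gam \<kappa> \<tau> (vel \<gamma> t) (w t) +
      (Gam \<kappa> \<tau> (w t - Lam \<kappa> \<tau> (vel \<gamma> t) (y t)) (vel \<gamma> t) + Gam \<kappa> \<tau> (y t) (- Gam \<kappa> \<tau> (vel \<gamma> t) (vel \<gamma> t)))) t" for t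
    unfolding z_def[abs_def] by (rule hvd_add[OF w(2) hvd_Gam[OF y(2) v(3)]])
  moreover have "- Gam \<kappa> \<tau> (w t) (vel \<gamma> t) - Gam \<kappa> \<tau> (vel \<gamma> t) (w t) +
      (Gam \<kappa> \<tau> (w t - Lam \<kappa> \<tau> (vel \<gamma> t) (y t)) (vel \<gamma> t) + Gam \<kappa> \<tau> (y t) (- Gam \<kappa> \<tau> (vel \<gamma> t) (vel \<gamma> t))) = z' t" for t
    unfolding z'_def z_def by (rule jacobi_linearized_euler[symmetric])
  ultimately have z': "hvd z (z' t) t" for t by simp
  show ?thesis unfolding jacobi_field_def
  proof (intro exI conjI allI)
    show "covariant_derivative_along A D \<gamma> (\<lambda>t. fr (y t) (\<gamma> t)) (\<lambda>t. fr (z t) (\<gamma> t))"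
      unfolding zy by (rule covariant_derivative_alongI[OF v(1) y])
    show "covariant_derivative_along A D \<gamma> (\<lambda>t. fr (z t) (\<gamma> t)) (\<lambda>t. fr (z' t + Gam \<kappa> \<tau> (vel \<gamma> t) (z t)) (\<gamma> t))"
      by (rule covariant_derivative_alongI[OF v(1) zs z'])
    show "fr (z' t + Gam \<kappa> \<tau> (vel \<gamma> t) (z t)) (\<gamma> t) f +
       curvature A D (\<gamma> t) (fr (y t) (\<gamma> t)) (velocity A \<gamma> t) (velocity A \<gamma> t) f = 0" for t f
      unfolding velocity_fr[OF v(1)] curvature_fr fr_add[symmetric] by (simp add: z'_def fr_zero)
  qed
qed

section \<open>Killing fields\<close>

lemma commutator_u:
  "u 1 p (\<lambda>q. u 2 q f) - u 2 p (\<lambda>q. u 1 q f) = \<tau> * u 3 p f"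
  "u 2 p (\<lambda>q. u 3 q f) - u 3 p (\<lambda>q. u 2 q f) = \<kappa> / \<tau> * u 1 p f"
  "u 3 p (\<lambda>q. u 1 q f) - u 1 p (\<lambda>q. u 3 q f) = \<kappa> / \<tau> * u 2 p f"
  using fun_cong[OF bracket_u(1), of p f] fun_cong[OF bracket_u(2), of p f] fun_cong[OF bracket_u(3), of p f]
  by (simp_all add: lie_bracket_def fr_def)

text \<open>Being Killing says that \<open>[u j, X] = B j\<close> is skew, hence a cross product with a vector \<open>(b1, b2, b3)\<close>. The
  Jacobi identity for \<open>u i, u j, X\<close> determines the derivatives of \<open>b1, b2, b3\<close>, and the commutators of these
  derivatives force \<open>b1 = b2 = 0\<close> unless \<open>\<kappa> = \<tau> * \<tau>\<close>.\<close>

lemma killing_field_coef: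
  assumes "\<kappa> \<noteq> \<tau>\<^sup>2" and K: "killing_field A g X"
  obtains b where "b \<in> smooth_functions A" "\<And>p c. fr c p b = 0"
    "\<And>p c. dv (fr c p) (\<lambda>q. coef q (X q)) = b p *\<^sub>R vector [- c $ 2, c $ 1, 0] - Lam \<kappa> \<tau> c (coef p (X p))"
proof -
  have X: "X \<in> vector_fields A" using K by (simp add: killing_field_def)
  define x where "x p = coef p (X p)" for p
  have x: "smooth_vec x" "X = (\<lambda>p. fr (x p) p)" using field_coef_smooth[OF X] field_fr[OF X] by (simp_all add: x_def[abs_def])
  define B where "B j p = dv (u j p) x + Lam \<kappa> \<tau> (axis j 1) (x p)" for j p
  have br: "lie_bracket X (u j) p = fr (- B j p) p" for j p
  proof -
    have uj: "u j = (\<lambda>q. fr (axis j 1) q)" by (rule ext) (rule u_fr)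
    have "lie_bracket X (u j) p = fr (dv (fr (x p) p) (\<lambda>q. axis j 1) - dv (u j p) x + Lam \<kappa> \<tau> (x p) (axis j 1)) p"
      unfolding x(2) using bracket_fr[OF x(1) smooth_vec_const, of "axis j 1" p] by (simp add: uj)
    also have "dv (fr (x p) p) (\<lambda>q. axis j 1) - dv (u j p) x + Lam \<kappa> \<tau> (x p) (axis j 1) = - B j p"
      by (simp add: B_def vec3_eq_iff dv_nth tangentD(6)[OF fr_tangent] Lam_nth algebra_simps)
    finally show ?thesis .
  qed
  \<comment> \<open>The Killing equation is evaluated on the frame, whose inner products are
    constant, so its left side is 0.\<close>
  have skew: "B j p $ k = - B k p $ j" for j k p
  proof -
    have "X p (\<lambda>q. g q (u j q) (u k q)) = g p (fr (- B j p) p) (u k p) + g p (u j p) (fr (- B k p) p)"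
      using K u_vf unfolding killing_field_def br[symmetric] by blast
    then show ?thesis
      by (simp add: g_u tangentD(6)[OF vf_tangent[OF X]] g_fr_u g_sym[OF u_tangent fr_tangent])
  qed
  define b1 b2 b3 where "b1 p = B 2 p $ 3" and "b2 p = B 3 p $ 1" and "b3 p = B 1 p $ 2" for p
  have xs: "(\<lambda>p. x p $ i) \<in> smooth_functions A" for i using x(1) by (rule smooth_vecD)
  have xs': "(\<lambda>p. u j p (\<lambda>q. x q $ i)) \<in> smooth_functions A" for i j by (rule vf_smooth[OF u_vf xs])
  have bs: "b1 \<in> smooth_functions A" "b2 \<in> smooth_functions A" "b3 \<in> smooth_functions A"
    unfolding b1_def[abs_def] b2_def[abs_def] b3_def[abs_def] B_def vector_add_component dv_nth Lam_nth
    by (intro smooth_add smooth_diff smooth_mult smooth_const xs xs')+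
  have E: "u 1 p (\<lambda>q. x q $ 1) = 0" "u 1 p (\<lambda>q. x q $ 2) = b3 p + \<kappa> / \<tau> * x p $ 3" "u 1 p (\<lambda>q. x q $ 3) = - b2 p - \<tau> * x p $ 2"
    "u 2 p (\<lambda>q. x q $ 1) = - b3 p - \<kappa> / \<tau> * x p $ 3" "u 2 p (\<lambda>q. x q $ 2) = 0" "u 2 p (\<lambda>q. x q $ 3) = b1 p + \<tau> * x p $ 1"
    "u 3 p (\<lambda>q. x q $ 1) = b2 p + \<kappa> / \<tau> * x p $ 2" "u 3 p (\<lambda>q. x q $ 2) = - b1 p - \<kappa> / \<tau> * x p $ 1" "u 3 p (\<lambda>q. x q $ 3) = 0" for p
    using skew[of 1 p 1] skew[of 2 p 2] skew[of 3 p 3] skew[of 1 p 2] skew[of 1 p 3] skew[of 2 p 3]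
    by (simp_all add: b1_def b2_def b3_def B_def dv_nth Lam_nth axis_def)
  note T = tangentD(1-3,6)[OF u_tangent]
  have neg: "u i p (\<lambda>q. - f q - h q) = - u i p f - u i p h" if "f \<in> smooth_functions A" "h \<in> smooth_functions A" for i p f h
    using tangentD(3)[OF u_tangent smooth_cmult[of f "-1"] that(2), of i p] tangentD(2)[OF u_tangent that(1), of i p "-1"] that by simp
  have C: "u i p (\<lambda>q. f q + c * x q $ k) = u i p f + c * u i p (\<lambda>q. x q $ k)"
    "u i p (\<lambda>q. - f q - c * x q $ k) = - u i p f - c * u i p (\<lambda>q. x q $ k)" if "f \<in> smooth_functions A" for i p c k f
    using that by (simp_all add: T(1,2) neg smooth_cmult xs)
  have eqs: "u 1 p b3 = (\<kappa> / \<tau> - \<tau>) * b2 p" "u 1 p b2 = 0" "u 1 p b1 = 0" "u 2 p b3 = - (\<kappa> / \<tau> - \<tau>) * b1 p"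
    "u 2 p b1 = 0" "u 2 p b2 = 0" "u 3 p b1 = (\<kappa> / \<tau> - \<tau>) * b2 p" "u 3 p b2 = - (\<kappa> / \<tau> - \<tau>) * b1 p" "u 3 p b3 = 0" for p
    using commutator_u(1)[of p "\<lambda>q. x q $ 1"] commutator_u(1)[of p "\<lambda>q. x q $ 2"] commutator_u(1)[of p "\<lambda>q. x q $ 3"]
      commutator_u(2)[of p "\<lambda>q. x q $ 1"] commutator_u(2)[of p "\<lambda>q. x q $ 2"] commutator_u(2)[of p "\<lambda>q. x q $ 3"]
      commutator_u(3)[of p "\<lambda>q. x q $ 1"] commutator_u(3)[of p "\<lambda>q. x q $ 2"] commutator_u(3)[of p "\<lambda>q. x q $ 3"]
    unfolding E C[OF bs(1)] C[OF bs(2)] C[OF bs(3)] T(4)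
    by (simp_all add: algebra_simps)
  have lam: "\<kappa> / \<tau> - \<tau> \<noteq> 0" using assms(1) tau_pos by (simp add: field_simps power2_eq_square)
  have z: "b1 p = 0" "b2 p = 0" for p
  proof -
    \<comment> \<open>Both \<open>u 1\<close> and \<open>u 2\<close> annihilate \<open>b1\<close>,
      hence so does \<tau> times \<open>u 3\<close>; but \<open>u 3\<close> sends \<open>b1\<close>
      to a nonzero multiple of \<open>b2\<close>. With \<open>b2\<close> in place of
      \<open>b1\<close> the same argument gives \<open>b1 = 0\<close>.\<close>
    have "u 1 p (\<lambda>q. u 2 q b1) - u 2 p (\<lambda>q. u 1 q b1) = \<tau> * u 3 p b1" by (rule commutator_u)
    then show "b2 p = 0" unfolding eqs T(4) using lam tau_pos by simp
    have "u 1 p (\<lambda>q. u 2 q b2) - u 2 p (\<lambda>q. u 1 q b2) = \<tau> * u 3 p b2" by (rule commutator_u)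
    then show "b1 p = 0" unfolding eqs T(4) using lam tau_pos by simp
  qed
  show ?thesis
  proof
    show "b3 \<in> smooth_functions A" by (rule bs)
    show "fr c p b3 = 0" for c p by (simp add: fr_def eqs z)
    show "dv (fr c p) (\<lambda>q. coef q (X q)) = b3 p *\<^sub>R vector [- c $ 2, c $ 1, 0] - Lam \<kappa> \<tau> c (coef p (X p))" for c p
      unfolding x_def[symmetric] by (simp add: vec3_eq_iff dv_nth fr_def E z Lam_nth algebra_simps)
  qed
qed

end

section \<open>Conjugate points and Killing fields\<close>

text \<open>Gronwall's argument in both time directions: \<open>f\<close> times
  \<open>exp (- C * t)\<close> cannot increase after \<open>s\<close>, and \<open>f\<close> times
  \<open>exp (C * t)\<close> cannot be larger before \<open>s\<close> than at
  \<open>s\<close>.\<close>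

lemma nonneg_gronwall_zero_on:
  fixes f :: "real \<Rightarrow> real"
  assumes I: "is_interval I" "s \<in> I" "t \<in> I"
    and d: "\<And>t. t \<in> I \<Longrightarrow> (f has_real_derivative f' t) (at t)" and nn: "\<And>t. f t \<ge> 0"
    and b: "\<And>t. t \<in> I \<Longrightarrow> \<bar>f' t\<bar> \<le> C * f t" and z: "f s = 0"
  shows "f t = 0"
proof (cases "s \<le> t")
  case True
  have "f t * exp (- C * t) \<le> f s * exp (- C * s)"
  proof (rule DERIV_nonpos_imp_nonincreasing[OF True])
    fix x assume "s \<le> x" "x \<le> t"
    then have x: "x \<in> I" using I mem_is_interval_1_I by blast
    have "((\<lambda>t. f t * exp (- C * t)) has_real_derivative (f' x - C * f x) * exp (- C * x)) (at x)"
      by (auto intro!: derivative_eq_intros d x simp: algebra_simps)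
    moreover have "(f' x - C * f x) * exp (- C * x) \<le> 0"
      using b[OF x] by (intro mult_nonpos_nonneg) auto
    ultimately show "\<exists>y. ((\<lambda>t. f t * exp (- C * t)) has_real_derivative y) (at x) \<and> y \<le> 0" by blast
  qed
  then show ?thesis using nn[of t] z by (simp add: mult_le_0_iff)
next
  case False
  then have le: "t \<le> s" by simp
  have "f t * exp (C * t) \<le> f s * exp (C * s)"
  proof (rule DERIV_nonneg_imp_nondecreasing[OF le])
    fix x assume "t \<le> x" "x \<le> s"
    then have x: "x \<in> I" using I mem_is_interval_1_I by blast
    have "((\<lambda>t. f t * exp (C * t)) has_real_derivative (f' x + C * f x) * exp (C * x)) (at x)"
      by (auto intro!: derivative_eq_intros d x simp: algebra_simps)
    moreover have "(f' x + C * f x) * exp (C * x) \<ge> 0"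
      using b[OF x] by (intro mult_nonneg_nonneg) auto
    ultimately show "\<exists>y. ((\<lambda>t. f t * exp (C * t)) has_real_derivative y) (at x) \<and> 0 \<le> y" by blast
  qed
  then show ?thesis using nn[of t] z by (simp add: mult_le_0_iff)
qed

lemmas nonneg_gronwall_zero = nonneg_gronwall_zero_on[OF is_interval_univ UNIV_I UNIV_I]

lemma linear_ode_zero:
  fixes y :: "real \<Rightarrow> real^3"
  assumes I: "is_interval I" "s \<in> I" "t \<in> I" and T: "linear T"
    and y: "\<And>t. t \<in> I \<Longrightarrow> hvd y (T (y t)) t" and z: "y s = 0"
  shows "y t = 0"
proof -
  obtain C where C: "\<And>x. norm (T x) \<le> norm x * C"
    using bounded_linear.bounded T linear_conv_bounded_linear by blast
  have "(y t $ 1)\<^sup>2 + (y t $ 2)\<^sup>2 + (y t $ 3)\<^sup>2 = 0"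
  proof (rule nonneg_gronwall_zero_on[OF I, where f="\<lambda>t. (y t $ 1)\<^sup>2 + (y t $ 2)\<^sup>2 + (y t $ 3)\<^sup>2"
        and f'="\<lambda>t. 2 * (y t \<bullet> T (y t))" and C="2 * C"])
    fix t assume "t \<in> I"
    from y[OF this, unfolded forall_3]
    show "((\<lambda>t. (y t $ 1)\<^sup>2 + (y t $ 2)\<^sup>2 + (y t $ 3)\<^sup>2) has_real_derivative 2 * (y t \<bullet> T (y t))) (at t)"
      by (auto intro!: derivative_eq_intros simp: inner_vec_def sum_3)
    have "\<bar>y t \<bullet> T (y t)\<bar> \<le> norm (y t) * norm (T (y t))" by (rule Cauchy_Schwarz_ineq2)
    also have "\<dots> \<le> norm (y t) * (norm (y t) * C)" by (intro mult_left_mono C) simp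
    also have "\<dots> = C * (y t \<bullet> y t)" by (simp add: dot_square_norm power2_eq_square)
    finally show "\<bar>2 * (y t \<bullet> T (y t))\<bar> \<le> 2 * C * ((y t $ 1)\<^sup>2 + (y t $ 2)\<^sup>2 + (y t $ 3)\<^sup>2)"
      by (simp add: inner_vec_def sum_3 power2_eq_square)
  qed (simp_all add: z)
  then show ?thesis by (simp add: vec3_eq_iff add_nonneg_eq_0_iff)
qed

text \<open>Uniqueness for \<open>p'' + K p = 0\<close> with \<open>K\<close> of either sign. The
  squared length of \<open>(p, r)\<close> is used instead of the energy \<open>K p^2 + r^2\<close>,
  which need not be positive.\<close>

lemma oscillator_zero:
  fixes p r :: "real \<Rightarrow> real"
  assumes "\<And>t. (p has_real_derivative r t) (at t)" "\<And>t. (r has_real_derivative - K * p t) (at t)"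
    and "p s = 0" "r s = 0"
  shows "p t = 0" "r t = 0"
proof -
  have "(p t)\<^sup>2 + (r t)\<^sup>2 = 0"
  proof (rule nonneg_gronwall_zero[where f="\<lambda>t. (p t)\<^sup>2 + (r t)\<^sup>2" and s=s
        and f'="\<lambda>t. (1 - K) * (2 * p t * r t)" and C="\<bar>1 - K\<bar>"])
    fix t
    show "((\<lambda>t. (p t)\<^sup>2 + (r t)\<^sup>2) has_real_derivative (1 - K) * (2 * p t * r t)) (at t)"
      by (auto intro!: derivative_eq_intros assms simp: algebra_simps)
    have "\<bar>2 * p t * r t\<bar> \<le> (p t)\<^sup>2 + (r t)\<^sup>2"
      using sum_squares_bound[of "\<bar>p t\<bar>" "\<bar>r t\<bar>"] by (simp add: abs_mult)
    then show "\<bar>(1 - K) * (2 * p t * r t)\<bar> \<le> \<bar>1 - K\<bar> * ((p t)\<^sup>2 + (r t)\<^sup>2)"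
      unfolding abs_mult[of "1 - K"] by (intro mult_left_mono) auto
  qed (use assms in auto)
  then show "p t = 0" "r t = 0" by (auto simp: sum_power2_eq_zero_iff)
qed

text \<open>For \<open>K \<le> 0\<close> the function \<open>p r + m z - m * m * x\<close> is nondecreasing, while between two common zeros it drops by
  \<open>m * m * (t - s)\<close>.\<close>

lemma jacobi_system_no_zeros:
  fixes p q z P :: "real \<Rightarrow> real"
  assumes dp: "\<And>t. (p has_real_derivative r t) (at t)" and dr: "\<And>t. (r has_real_derivative - K * p t + \<tau> * (S * m - c * Q)) (at t)"
    and dq: "\<And>t. (q has_real_derivative \<tau> * c * p t + Q) (at t)"
    and dz: "\<And>t. (z has_real_derivative m - \<tau> * p t) (at t)"
    and S: "S + c\<^sup>2 = 1" and K: "K \<le> 0" and st: "s < t"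
    and 0: "p s = 0" "q s = 0" "z s = 0" "p t = 0" "q t = 0" "z t = 0"
  shows "p x = 0" "q x = 0" "z x = 0"
proof -
  \<comment> \<open>This is the tangential component of the Jacobi field. It is affine in
    \<open>t\<close>, so its two zeros force its slope to vanish.\<close>
  have "((\<lambda>t. q t + c * z t) has_real_derivative Q + c * m) (at x)" for x
    by (auto intro!: derivative_eq_intros dq dz simp: algebra_simps)
  then have "\<exists>x>s. x < t \<and> (q t + c * z t) - (q s + c * z s) = (t - s) * (Q + c * m)"
    by (intro MVT2 st) auto
  then have Q: "Q = - c * m" using 0 st by auto
  have N: "S * m - c * Q = m" 
  proof -
    have "S * m - c * Q = (S + c\<^sup>2) * m" unfolding Q by (simp add: algebra_simps power2_eq_square)
    then show ?thesis by (simp add: S)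
  qed
  have dr2: "(r has_real_derivative - K * p x + \<tau> * m) (at x)" for x using dr[of x] by (simp only: N)
  define h where "h x = p x * r x + m * z x - m\<^sup>2 * x" for x
  have dh: "(h has_real_derivative (r x)\<^sup>2 - K * (p x)\<^sup>2) (at x)" for x
    unfolding h_def by (auto intro!: derivative_eq_intros dp dr2 dz simp: power2_eq_square algebra_simps)
  have nn: "(r x)\<^sup>2 - K * (p x)\<^sup>2 \<ge> 0" for x
    using mult_nonpos_nonneg[OF K zero_le_power2[of "p x"]] zero_le_power2[of "r x"] by linarith
  have mono: "h a \<le> h b" if "a \<le> b" for a b
    by (rule DERIV_nonneg_imp_nondecreasing[OF that]) (use dh nn in blast)
  have "m\<^sup>2 * (t - s) \<le> 0" using mono[of s t] st 0 by (simp add: h_def algebra_simps)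
  then have m: "m = 0" using st by (simp add: mult_le_0_iff)
  have hc: "h x = h s" if "s \<le> x" "x \<le> t" for x
    using mono[OF that(1)] mono[OF that(2)] 0 m by (simp add: h_def)
  \<comment> \<open>Between the zeros \<open>h\<close> is constant and its derivative is a sum of
    two nonnegative terms. For \<open>K = 0\<close> the second one says nothing about
    \<open>p\<close>, so only \<open>r\<close> is read off; \<open>p\<close> vanishes at the
    midpoint by the mean value theorem.\<close>
  have r0: "r x = 0" if "s < x" "x < t" for x
  proof -
    have "(h has_real_derivative 0) (at x)"
      by (rule has_field_derivative_transform_within_open[where f="\<lambda>_. h s" and S="{s<..<t}"])
        (use that in simp, simp, use that in simp, rule hc[symmetric], simp_all)
    then have "(r x)\<^sup>2 - K * (p x)\<^sup>2 = 0" using dh DERIV_unique by blast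
    moreover have "K * (p x)\<^sup>2 \<le> 0" using K by (simp add: mult_nonpos_nonneg)
    ultimately have "(r x)\<^sup>2 \<le> 0" by linarith
    then show ?thesis by simp
  qed
  define x0 where "x0 = (s + t) / 2"
  have x0: "s < x0" "x0 < t" using st by (auto simp: x0_def)
  have "\<exists>x>s. x < x0 \<and> p x0 - p s = (x0 - s) * r x" using dp by (intro MVT2 x0) auto
  then obtain xi where xi: "s < xi" "xi < x0" "p x0 - p s = (x0 - s) * r xi" by blast
  have "r xi = 0" using xi x0 by (intro r0) auto
  then have p0: "p x0 = 0" using 0 xi by simp
  have dr': "(r has_real_derivative - K * p t) (at t)" for t using dr[of t] by (simp add: Q m)
  have pz: "p x = 0" for x by (rule oscillator_zero(1)[OF dp dr' p0 r0[OF x0]])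
  show "p x = 0" by (rule pz)
  have "(q has_real_derivative 0) (at x)" "(z has_real_derivative 0) (at x)" for x
    using dq[of x] dz[of x] by (simp_all add: pz Q m)
  then show "q x = 0" "z x = 0" using DERIV_isconst_all 0 by metis+
qed

section \<open>The Jacobi equation along a geodesic\<close>

context M3 begin

lemma slope_vel:
  assumes "unit_speed_geodesic A g D \<gamma>" "slope_angle A g u \<gamma> \<theta>"
  shows "vel \<gamma> t $ 3 = cos \<theta>"
proof -
  note v = geodesic_equation[OF assms(1)]
  have 1: "g (\<gamma> t) (velocity A \<gamma> t) (velocity A \<gamma> t) = 1"
    using assms(1) by (simp add: unit_speed_geodesic_def)
  have "angle g (\<gamma> t) (velocity A \<gamma> t) (u 3 (\<gamma> t)) = \<theta>" using assms(2) by (simp add: slope_angle_def)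
  then have "arccos (vel \<gamma> t $ 3) = \<theta>"
    unfolding angle_def 1 by (simp add: g_u vel_def coef_def)
  moreover have "\<bar>vel \<gamma> t $ 3\<bar> \<le> 1"
    using v(4)[of t] by (simp flip: abs_square_le_1) (smt (verit) zero_le_power2)
  ultimately show ?thesis by (metis abs_le_iff cos_arccos_abs cos_arccos minus_le_iff)
qed

text \<open>Components of fields along the geodesic orthogonal and parallel to its horizontal velocity.\<close>

lemma rotating_frame:
  assumes \<gamma>: "unit_speed_geodesic A g D \<gamma>" and sl: "\<And>t. vel \<gamma> t $ 3 = c"
    and y: "\<And>t. hvd y (w t - Lam \<kappa> \<tau> (vel \<gamma> t) (y t)) t"
    and w: "\<And>t. hvd w (- Gam \<kappa> \<tau> (w t) (vel \<gamma> t) - Gam \<kappa> \<tau> (vel \<gamma> t) (w t)) t"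
  defines "S \<equiv> 1 - c\<^sup>2" and "K \<equiv> \<kappa> * (1 - c\<^sup>2) + \<tau>\<^sup>2 * c\<^sup>2"
    and "m \<equiv> w 0 $ 3" and "Q \<equiv> vel \<gamma> 0 $ 1 * w 0 $ 1 + vel \<gamma> 0 $ 2 * w 0 $ 2"
    and "p \<equiv> \<lambda>t. vel \<gamma> t $ 1 * y t $ 2 - vel \<gamma> t $ 2 * y t $ 1"
    and "q \<equiv> \<lambda>t. vel \<gamma> t $ 1 * y t $ 1 + vel \<gamma> t $ 2 * y t $ 2"
    and "P \<equiv> \<lambda>t. vel \<gamma> t $ 1 * w t $ 2 - vel \<gamma> t $ 2 * w t $ 1"
  defines "r \<equiv> \<lambda>t. - \<tau> * c * q t + \<kappa> / \<tau> * S * y t $ 3 + P t"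
  shows "(p has_real_derivative r t) (at t)" "(r has_real_derivative - K * p t + \<tau> * (S * m - c * Q)) (at t)"
    "(q has_real_derivative \<tau> * c * p t + Q) (at t)"
    "((\<lambda>t. y t $ 3) has_real_derivative m - \<tau> * p t) (at t)"
    "p t = 0 \<Longrightarrow> q t = 0 \<Longrightarrow> y t $ 3 = 0 \<Longrightarrow> S \<noteq> 0 \<Longrightarrow> y t = 0"
proof -
  note v = geodesic_equation[OF \<gamma>]
  \<comment> \<open>\<open>lam * c\<close> is the rate at which the horizontal velocity turns;
    \<open>lam\<close> measures the anisotropy of the metric and vanishes only for \<kappa> =
    \<tau>^2.\<close>
  define lam where "lam = \<kappa> / \<tau> - \<tau>"
  have om: "\<kappa> / \<tau> = lam + \<tau>" "\<kappa> = (lam + \<tau>) * \<tau>" using tau_pos by (simp_all add: lam_def field_simps)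
  have vS: "(vel \<gamma> t $ 1)\<^sup>2 + (vel \<gamma> t $ 2)\<^sup>2 = S" for t using v(4)[of t] by (simp add: S_def sl)
  have v1: "((\<lambda>t. vel \<gamma> t $ 1) has_real_derivative lam * c * vel \<gamma> t $ 2) (at t)"
    and v2: "((\<lambda>t. vel \<gamma> t $ 2) has_real_derivative - lam * c * vel \<gamma> t $ 1) (at t)" for t
    using spec[OF v(3), of 1 t] spec[OF v(3), of 2 t] unfolding vector_uminus_component Gam_nth sl om(1)
    by (simp_all add: algebra_simps)
  have y1: "((\<lambda>t. y t $ 1) has_real_derivative w t $ 1 - (lam + \<tau>) * (vel \<gamma> t $ 2 * y t $ 3 - c * y t $ 2)) (at t)"
    and y2: "((\<lambda>t. y t $ 2) has_real_derivative w t $ 2 - (lam + \<tau>) * (c * y t $ 1 - vel \<gamma> t $ 1 * y t $ 3)) (at t)"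
    and y3: "((\<lambda>t. y t $ 3) has_real_derivative w t $ 3 - \<tau> * p t) (at t)" for t
    using spec[OF y, of 1 t] spec[OF y, of 2 t] spec[OF y, of 3 t]
    unfolding vector_minus_component Lam_nth sl om(1) p_def by simp_all
  have w1: "((\<lambda>t. w t $ 1) has_real_derivative lam * (w t $ 3 * vel \<gamma> t $ 2 + c * w t $ 2)) (at t)"
    and w2: "((\<lambda>t. w t $ 2) has_real_derivative - lam * (w t $ 3 * vel \<gamma> t $ 1 + c * w t $ 1)) (at t)"
    and w3: "((\<lambda>t. w t $ 3) has_real_derivative 0) (at t)" for t
    using spec[OF w, of 1 t] spec[OF w, of 2 t] spec[OF w, of 3 t]
    unfolding vector_minus_component vector_uminus_component Gam_nth sl om(1) by (simp_all add: algebra_simps)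
  \<comment> \<open>The vertical component and the horizontal length of the velocity are conserved
    by the geodesic equation. Hence \<open>m\<close> and \<open>Q\<close>, their linearizations (for
    \<open>Q\<close>, that of half the squared length), are constant.\<close>
  have m: "w t $ 3 = m" for t unfolding m_def using DERIV_isconst_all w3 by blast
  have dQ: "((\<lambda>t. vel \<gamma> t $ 1 * w t $ 1 + vel \<gamma> t $ 2 * w t $ 2) has_real_derivative 0) (at t)" for t
    by (rule DERIV_cong, (rule DERIV_add DERIV_mult v1 v2 w1 w2)+, simp add: algebra_simps)
  have Q: "vel \<gamma> t $ 1 * w t $ 1 + vel \<gamma> t $ 2 * w t $ 2 = Q" for t
    unfolding Q_def using DERIV_isconst_all[of _ t 0] dQ by blast
  have dP: "(P has_real_derivative - lam * m * S) (at t)" for t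
    unfolding P_def
    by (rule DERIV_cong, (rule DERIV_diff DERIV_mult v1 v2 w1 w2)+, simp add: m vS[of t, symmetric] power2_eq_square algebra_simps)
  show dp: "(p has_real_derivative r t) (at t)" for t
    unfolding p_def
    by (rule DERIV_cong, (rule DERIV_diff DERIV_mult v1 v2 y1 y2)+,
       simp add: r_def P_def q_def om(1) vS[of t, symmetric] power2_eq_square algebra_simps)
  show dq: "(q has_real_derivative \<tau> * c * p t + Q) (at t)" for t
    unfolding q_def
    by (rule DERIV_cong, (rule DERIV_add DERIV_mult v1 v2 y1 y2)+,
       simp add: Q[of t, symmetric] p_def algebra_simps)
  show dz: "((\<lambda>t. y t $ 3) has_real_derivative m - \<tau> * p t) (at t)" for t using y3[of t] by (simp add: m)
  show "(r has_real_derivative - K * p t + \<tau> * (S * m - c * Q)) (at t)"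
  proof -
    have K: "K = (lam + \<tau>) * \<tau> * S + \<tau>\<^sup>2 * c\<^sup>2" by (simp add: K_def S_def om(2))
    show ?thesis unfolding r_def K om(1)
      by (rule DERIV_cong, (rule DERIV_add DERIV_cmult dq dP dz)+, simp add: power2_eq_square algebra_simps)
  qed
  assume 0: "p t = 0" "q t = 0" "y t $ 3 = 0" "S \<noteq> 0"
  have "S * y t $ 1 = vel \<gamma> t $ 1 * q t - vel \<gamma> t $ 2 * p t" "S * y t $ 2 = vel \<gamma> t $ 2 * q t + vel \<gamma> t $ 1 * p t"
    unfolding vS[of t, symmetric] p_def q_def by (simp_all add: power2_eq_square algebra_simps)
  then show "y t = 0" using 0 by (simp add: vec3_eq_iff)
qed

lemma no_conjugate_pair_if:
  assumes \<gamma>: "unit_speed_geodesic A g D \<gamma>" and sl: "\<And>t. vel \<gamma> t $ 3 = c" and S: "c\<^sup>2 < 1"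
    and K: "\<kappa> * (1 - c\<^sup>2) + \<tau>\<^sup>2 * c\<^sup>2 \<le> 0"
  shows "no_conjugate_pair A D \<gamma>"
  unfolding no_conjugate_pair_def
proof
  assume "\<exists>s t. conjugate_along A D \<gamma> s t"
  then obtain s0 t0 J where J: "s0 \<noteq> t0" "jacobi_field A D \<gamma> J" "J \<noteq> (\<lambda>r f. 0)" "J s0 = (\<lambda>f. 0)" "J t0 = (\<lambda>f. 0)"
    unfolding conjugate_along_def by blast
  define s t where "s = min s0 t0" and "t = max s0 t0"
  have st: "s < t" "J s = (\<lambda>f. 0)" "J t = (\<lambda>f. 0)" using J by (auto simp: s_def t_def min_def max_def)
  obtain y w where yw: "\<And>t. J t = fr (y t) (\<gamma> t)"
    "\<And>t. hvd y (w t - Lam \<kappa> \<tau> (vel \<gamma> t) (y t)) t"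
    "\<And>t. hvd w (- Gam \<kappa> \<tau> (w t) (vel \<gamma> t) - Gam \<kappa> \<tau> (vel \<gamma> t) (w t)) t"
    by (rule jacobi_fieldD[OF \<gamma> J(2)]) (rule that)
  note rf = rotating_frame[OF \<gamma> sl yw(2,3)]
  have "fr (y s) (\<gamma> s) = fr 0 (\<gamma> s)" "fr (y t) (\<gamma> t) = fr 0 (\<gamma> t)"
    using st(2,3) unfolding yw(1) by (simp_all add: fr_zero)
  then have "y s = 0" "y t = 0" by (simp_all only: fr_inject)
  then have "vel \<gamma> x $ 1 * y x $ 2 - vel \<gamma> x $ 2 * y x $ 1 = 0 \<and>
    vel \<gamma> x $ 1 * y x $ 1 + vel \<gamma> x $ 2 * y x $ 2 = 0 \<and> y x $ 3 = 0" for x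
    using jacobi_system_no_zeros[OF rf(1-4) _ K st(1), of x] by simp
  then have "y x = 0" for x using rf(5)[of x] S by simp
  then have "J = (\<lambda>r f. 0)" using yw(1) by (simp add: fr_zero fun_eq_iff)
  then show False using J by simp
qed

end

section \<open>A conjugate point that is not isotropic\<close>

text \<open>Clearing the denominator of \<open>tan\<close> gives the continuous function
  \<open>d\<close>, which changes sign between \<open>pi\<close> and \<open>3 * pi / 2\<close> if
  \<nu> is positive and between \<open>pi / 2\<close> and \<open>pi\<close> if it is negative. At
  the ends where \<open>cos\<close> vanishes \<open>d\<close> does not.\<close>

lemma tan_eq_linear_solution:
  fixes \<nu> :: real assumes "\<nu> \<noteq> 0"
  obtains x where "x > 0" "sin x = \<nu> * x * cos x" "sin x \<noteq> 0" "cos x \<noteq> 0"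
proof -
  define d where "d x = sin x - \<nu> * x * cos x" for x
  have cont: "continuous_on S d" for S unfolding d_def by (intro continuous_intros)
  have *: "\<exists>x. 0 < x \<and> d x = 0 \<and> cos x \<noteq> 0"
  proof (cases "\<nu> > 0")
    case True
    have 1: "d pi > 0" using True by (simp add: d_def)
    have "sin (3 * pi / 2) = -1 \<and> cos (3 * pi / 2) = 0" using sin_3over2_pi cos_3over2_pi by simp
    then have 2: "d (3 * pi / 2) < 0" by (simp add: d_def)
    obtain x where x: "pi \<le> x" "x \<le> 3 * pi / 2" "d x = 0"
      using IVT2'[of d "3 * pi / 2" 0 pi] cont 1 2 by auto
    have "x \<noteq> 3 * pi / 2" using x(3) 2 by (metis less_irrefl)
    moreover have "cos x \<noteq> 0" if "x < 3 * pi / 2"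
    proof -
      have "0 < cos (x - pi)" using x that by (intro cos_gt_zero_pi) auto
      then show ?thesis by (simp add: cos_diff)
    qed
    ultimately show ?thesis using x pi_gt_zero by (intro exI[of _ x]) linarith
  next
    case False
    then have 1: "d pi < 0" using assms by (simp add: d_def mult_neg_pos)
    have 2: "d (pi / 2) > 0" by (simp add: d_def)
    obtain x where x: "pi / 2 \<le> x" "x \<le> pi" "d x = 0"
      using IVT2'[of d pi 0 "pi / 2"] cont 1 2 pi_gt_zero by auto
    have "x \<noteq> pi / 2" using x(3) 2 by (metis less_irrefl)
    moreover have "cos x \<noteq> 0" if "x > pi / 2"
    proof -
      have "0 < cos (x - pi)" using x that by (intro cos_gt_zero_pi) auto
      then show ?thesis by (simp add: cos_diff)
    qed
    ultimately show ?thesis using x pi_gt_zero by (intro exI[of _ x]) linarith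
  qed
  then obtain x where x: "0 < x" "d x = 0" "cos x \<noteq> 0" by blast
  then have "sin x = \<nu> * x * cos x" by (simp add: d_def)
  then show ?thesis using that[of x] x assms by simp
qed

lemma Ck_on_sin_scaled: "Ck_on k UNIV (\<lambda>t::real. sin (a * t))"
  and Ck_on_cos_scaled: "Ck_on k UNIV (\<lambda>t::real. cos (a * t))"
proof -
  have l: "Ck_on k UNIV (\<lambda>t::real. a * t)" by (intro Ck_on_mult Ck_on_const Ck_on_id open_UNIV)
  show "Ck_on k UNIV (\<lambda>t::real. sin (a * t))" "Ck_on k UNIV (\<lambda>t::real. cos (a * t))"
    using Ck_on_sin_cos by (auto intro: Ck_on_compose[OF open_UNIV open_UNIV _ l])
qed

context M3 begin

text \<open>The Killing field comes with a geodesic \<sigma> that may differ from \<gamma>. The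
  field is nonzero along \<sigma>, which forces its rotation part \<open>b\<close> to be nonzero;
  since \<open>b\<close> has zero derivative in every direction, its value at
  \<open>\<gamma> 0\<close> can be carried over to \<gamma>. Restricted to \<gamma>, the transverse
  component of the field is then a nonzero multiple of \<open>sin (k * t)\<close>.\<close>

lemma killing_zero_off_fiber:
  assumes kt: "\<kappa> \<noteq> \<tau>\<^sup>2" and \<gamma>: "unit_speed_geodesic A g D \<gamma>" and sl: "\<And>t. vel \<gamma> t $ 3 = c" and S: "c\<^sup>2 < 1"
    and k: "k\<^sup>2 = \<kappa> * (1 - c\<^sup>2) + \<tau>\<^sup>2 * c\<^sup>2" "k \<noteq> 0" and sT: "sin (k * T) \<noteq> 0"
  shows "\<not> isotropically_conjugate A g D (\<gamma> 0) (\<gamma> T)"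
proof
  assume "isotropically_conjugate A g D (\<gamma> 0) (\<gamma> T)"
  then obtain \<sigma> s t X where \<sigma>: "unit_speed_geodesic A g D \<sigma>" "\<sigma> s = \<gamma> 0" "\<sigma> t = \<gamma> T"
    and X: "killing_field A g X" "X \<circ> \<sigma> \<noteq> (\<lambda>r f. 0)" "(X \<circ> \<sigma>) s = (\<lambda>f. 0)" "(X \<circ> \<sigma>) t = (\<lambda>f. 0)"
    unfolding isotropically_conjugate_def isotropic_jacobi_field_def by blast
  obtain b where b: "b \<in> smooth_functions A" "\<And>p c. fr c p b = 0"
    "\<And>p c. dv (fr c p) (\<lambda>q. coef q (X q)) = b p *\<^sub>R vector [- c $ 2, c $ 1, 0] - Lam \<kappa> \<tau> c (coef p (X p))"
    by (rule killing_field_coef[OF kt X(1)]) (rule that)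
  have Xv: "X \<in> vector_fields A" using X(1) by (simp add: killing_field_def)
  define x where "x q = coef q (X q)" for q
  have xs: "smooth_vec x" and Xx: "X = (\<lambda>q. fr (x q) q)"
    unfolding x_def[abs_def] using field_coef_smooth[OF Xv] field_fr[OF Xv] by auto
  have zero: "x p = 0" if "X p = (\<lambda>f. 0)" for p
    using that unfolding Xx fr_zero[of p, symmetric] fr_inject by simp
  have x0: "x (\<gamma> 0) = 0" "x (\<gamma> T) = 0" using zero X(3,4) \<sigma> by auto
  have bc: "b (\<mu> t) = b (\<mu> t')" if "unit_speed_geodesic A g D \<mu>" for \<mu> t t'
  proof -
    have "((\<lambda>t. b (\<mu> t)) has_real_derivative 0) (at t)" for t
      using bspec[OF conjunct2[OF has_vel_vel[OF geodesic_equation(1)[OF that], unfolded has_vel_def]] b(1)] by (simp add: b(2))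
    then show ?thesis using DERIV_isconst_all[of "\<lambda>t. b (\<mu> t)"] by blast
  qed
  have xd: "hvd (\<lambda>t. x (\<mu> t)) (b (\<mu> t) *\<^sub>R vector [- vel \<mu> t $ 2, vel \<mu> t $ 1, 0] - Lam \<kappa> \<tau> (vel \<mu> t) (x (\<mu> t))) t"
    if "unit_speed_geodesic A g D \<mu>" for \<mu> t
    using hvd_compose[OF has_vel_vel[OF geodesic_equation(1)[OF that]] xs, of t]
    unfolding b(3)[folded x_def] .
  have b0: "b (\<gamma> 0) \<noteq> 0"
  proof
    assume "b (\<gamma> 0) = 0"
    then have bz: "b (\<sigma> t) = 0" for t using bc[OF \<sigma>(1), of t s] \<sigma>(2) by simp
    define lam where "lam = \<kappa> / \<tau> - \<tau>"
    have om: "\<kappa> / \<tau> = lam + \<tau>" by (simp add: lam_def)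
    define v y where "v = vel \<sigma>" and "y t = x (\<sigma> t)" for t
    define f where "f t = (y t $ 1)\<^sup>2 + (y t $ 2)\<^sup>2 + (y t $ 3)\<^sup>2" for t
    \<comment> \<open>With \<open>b = 0\<close> the derivative of \<open>y\<close> is a cross
      product up to its third component, so only the anisotropy \<open>lam\<close> changes the
      length of \<open>y\<close>. Gronwall's argument then makes the field vanish along all of
      \<sigma>.\<close>
    define f' where "f' t = 2 * lam * (y t $ 3 * (v t $ 1 * y t $ 2 - v t $ 2 * y t $ 1))" for t
    have yd: "hvd y (- Lam \<kappa> \<tau> (v t) (y t)) t" for t using xd[OF \<sigma>(1), of t] by (simp add: bz v_def y_def)
    have fz: "f t = 0" for t
    proof (rule nonneg_gronwall_zero[of f f' "2 * \<bar>lam\<bar>" s])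
      fix t
      show "(f has_real_derivative f' t) (at t)" unfolding f_def f'_def
        using yd[of t, unfolded forall_3 vector_uminus_component Lam_nth om]
        by (auto intro!: derivative_eq_intros simp: algebra_simps power2_eq_square)
      have v1: "(v t $ 1)\<^sup>2 + (v t $ 2)\<^sup>2 + (v t $ 3)\<^sup>2 = 1" unfolding v_def by (rule geodesic_equation(4)[OF \<sigma>(1)])
      show "\<bar>f' t\<bar> \<le> 2 * \<bar>lam\<bar> * f t"
      proof -
        have "(v t $ 1 * y t $ 2 - v t $ 2 * y t $ 1)\<^sup>2 \<le> ((v t $ 1)\<^sup>2 + (v t $ 2)\<^sup>2) * ((y t $ 1)\<^sup>2 + (y t $ 2)\<^sup>2)"
          using zero_le_power2[of "v t $ 1 * y t $ 1 + v t $ 2 * y t $ 2"] by (simp add: power2_eq_square algebra_simps)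
        also have "\<dots> \<le> 1 * ((y t $ 1)\<^sup>2 + (y t $ 2)\<^sup>2)"
          using v1 zero_le_power2[of "v t $ 3"] by (intro mult_right_mono) (linarith, simp)
        finally have "(v t $ 1 * y t $ 2 - v t $ 2 * y t $ 1)\<^sup>2 + (y t $ 3)\<^sup>2 \<le> f t" by (simp add: f_def)
        moreover have "2 * \<bar>y t $ 3 * (v t $ 1 * y t $ 2 - v t $ 2 * y t $ 1)\<bar> \<le> (v t $ 1 * y t $ 2 - v t $ 2 * y t $ 1)\<^sup>2 + (y t $ 3)\<^sup>2"
          using sum_squares_bound[of "\<bar>y t $ 3\<bar>" "\<bar>v t $ 1 * y t $ 2 - v t $ 2 * y t $ 1\<bar>"] by (simp add: abs_mult)
        moreover have "f t \<ge> 0" by (simp add: f_def)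
        ultimately have "\<bar>y t $ 3 * (v t $ 1 * y t $ 2 - v t $ 2 * y t $ 1)\<bar> \<le> f t" by linarith
        then show ?thesis unfolding f'_def abs_mult[of "2 * lam"] by (simp add: abs_mult mult_left_mono)
      qed
    qed (use x0 \<sigma> in \<open>auto simp: f_def y_def\<close>)
    have "x (\<sigma> t) = 0" for t
      using fz[of t] unfolding f_def y_def vec3_eq_iff
      by (simp add: add_nonneg_eq_0_iff)
    then have "X \<circ> \<sigma> = (\<lambda>r f. 0)" by (simp add: Xx fun_eq_iff fr_zero)
    then show False using X(2) by simp
  qed
  define \<beta> where "\<beta> = b (\<gamma> 0)"
  define y w where "y t = x (\<gamma> t)" and "w t = \<beta> *\<^sub>R (vector [- vel \<gamma> t $ 2, vel \<gamma> t $ 1, 0] :: real^3)" for t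
  have yd: "hvd y (w t - Lam \<kappa> \<tau> (vel \<gamma> t) (y t)) t" for t
    using xd[OF \<gamma>, of t] bc[OF \<gamma>, of t 0] by (simp add: y_def w_def \<beta>_def)
  have wd: "hvd w (- Gam \<kappa> \<tau> (w t) (vel \<gamma> t) - Gam \<kappa> \<tau> (vel \<gamma> t) (w t)) t" for t
    using geodesic_equation(3)[OF \<gamma>, of t]
    unfolding w_def forall_3 vector_minus_component vector_uminus_component Gam_nth
    by (auto simp: algebra_simps sl intro!: derivative_eq_intros)
  note rf = rotating_frame[OF \<gamma> sl yd wd]
  define p where "p t = vel \<gamma> t $ 1 * y t $ 2 - vel \<gamma> t $ 2 * y t $ 1" for t
  define r where "r t = - \<tau> * c * (vel \<gamma> t $ 1 * y t $ 1 + vel \<gamma> t $ 2 * y t $ 2) + \<kappa> / \<tau> * (1 - c\<^sup>2) * y t $ 3 +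
     (vel \<gamma> t $ 1 * w t $ 2 - vel \<gamma> t $ 2 * w t $ 1)" for t
  \<comment> \<open>The variation \<open>w\<close> is horizontal and orthogonal to the velocity.
    This removes the constant term of the equation for \<open>r\<close> and leaves a free
    oscillator.\<close>
  have m: "w 0 $ 3 = 0" "vel \<gamma> 0 $ 1 * w 0 $ 1 + vel \<gamma> 0 $ 2 * w 0 $ 2 = 0" by (simp_all add: w_def)
  have dp: "(p has_real_derivative r t) (at t)" for t using rf(1)[of t] unfolding p_def[abs_def] r_def .
  have dr: "(r has_real_derivative - (k\<^sup>2) * p t) (at t)" for t using rf(2)[of t] unfolding p_def r_def[abs_def] m k by simp
  have y0: "y 0 = 0" "y T = 0" using x0 by (simp_all add: y_def)
  have vS: "(vel \<gamma> 0 $ 1)\<^sup>2 + (vel \<gamma> 0 $ 2)\<^sup>2 = 1 - c\<^sup>2" using geodesic_equation(4)[OF \<gamma>, of 0] sl by simp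
  have r0: "r 0 = \<beta> * (1 - c\<^sup>2)" unfolding r_def y0 vS[symmetric] by (simp add: w_def algebra_simps power2_eq_square)
  have "p T - r 0 / k * sin (k * T) = 0"
  proof (rule oscillator_zero(1)[where K="k\<^sup>2" and s=0 and p="\<lambda>t. p t - r 0 / k * sin (k * t)" and r="\<lambda>t. r t - r 0 * cos (k * t)"])
    show "((\<lambda>t. p t - r 0 / k * sin (k * t)) has_real_derivative r t - r 0 * cos (k * t)) (at t)" for t
      using k by (auto intro!: derivative_eq_intros dp)
    show "((\<lambda>t. r t - r 0 * cos (k * t)) has_real_derivative - k\<^sup>2 * (p t - r 0 / k * sin (k * t))) (at t)" for t
      using k(2) by (auto intro!: derivative_eq_intros dr simp: field_simps power2_eq_square)
  qed (simp_all add: p_def y0)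
  moreover have "p T = 0" by (simp add: p_def y0)
  ultimately show False using r0 b0 S sT k(2) by (simp add: \<beta>_def)
qed

text \<open>The field has \<open>m = 1\<close> and \<open>Q = - c\<close>, so that the tangential
  component \<open>q + c * z\<close> vanishes identically and \<open>p'' + K p = \<tau>\<close>.
  With \<open>p 0 = 0\<close> one coefficient \<open>B\<close> is free. At
  \<open>T = 2 * x / k\<close> the condition \<open>p T = 0\<close> gives
  \<open>B = - (\<tau> / K) * tan x\<close>, and \<open>z T = 0\<close>, where
  \<open>z' = 1 - \<tau> * p\<close>, turns into \<open>tan x = \<nu> * x\<close>. Solutions with
  \<open>sin x\<close> and \<open>cos x\<close> nonzero keep \<open>sin (k * T)\<close> away from
  0.\<close>

lemma conjugate_point_exists:
  assumes kt: "\<kappa> \<noteq> \<tau>\<^sup>2" and \<gamma>: "unit_speed_geodesic A g D \<gamma>" and sl: "\<And>t. vel \<gamma> t $ 3 = c" and S: "c\<^sup>2 < 1"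
    and k: "k\<^sup>2 = \<kappa> * (1 - c\<^sup>2) + \<tau>\<^sup>2 * c\<^sup>2" "k > 0"
  obtains T where "conjugate_along A D \<gamma> 0 T" "sin (k * T) \<noteq> 0"
proof -
  note v = geodesic_equation[OF \<gamma>]
  define s where "s = 1 - c\<^sup>2"
  define lam where "lam = \<kappa> / \<tau> - \<tau>"
  have om: "\<kappa> / \<tau> = lam + \<tau>" "\<kappa> = (lam + \<tau>) * \<tau>" using tau_pos by (simp_all add: lam_def field_simps)
  have s: "s > 0" "c\<^sup>2 = 1 - s" using S by (simp_all add: s_def)
  have vS: "(vel \<gamma> t $ 1)\<^sup>2 + (vel \<gamma> t $ 2)\<^sup>2 = s" for t using v(4)[of t] by (simp add: s_def sl)
  have v1: "((\<lambda>t. vel \<gamma> t $ 1) has_real_derivative lam * c * vel \<gamma> t $ 2) (at t)"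
    and v2: "((\<lambda>t. vel \<gamma> t $ 2) has_real_derivative - lam * c * vel \<gamma> t $ 1) (at t)" for t
    using spec[OF v(3), of 1 t] spec[OF v(3), of 2 t] unfolding vector_uminus_component Gam_nth sl om(1)
    by (simp_all add: algebra_simps)
  define K where "K = k\<^sup>2"
  have K: "K > 0" "K = \<tau> * ((lam + \<tau>) * s + \<tau> * c\<^sup>2)"
    using k unfolding K_def by (simp_all add: om(2) s_def algebra_simps power2_eq_square)
  have K2: "K = \<tau>\<^sup>2 + \<tau> * lam * s" unfolding K(2) s(2) by (simp add: algebra_simps power2_eq_square)
  have lam: "lam \<noteq> 0" using kt tau_pos by (simp add: lam_def field_simps power2_eq_square)
  define \<nu> where "\<nu> = 1 - K / \<tau>\<^sup>2"
  have "\<nu> \<noteq> 0" using lam s tau_pos unfolding \<nu>_def K2 by (simp add: field_simps)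
  then obtain x where x: "x > 0" "sin x = \<nu> * x * cos x" "sin x \<noteq> 0" "cos x \<noteq> 0"
    by (rule tan_eq_linear_solution)
  define B where "B = - (\<tau> / K) * (sin x / cos x)"
  define T where "T = 2 * x / k"
  have kT: "k * T = 2 * x" using k by (simp add: T_def)
  have T: "T \<noteq> 0" using x k by (simp add: T_def)
  have sT: "sin (k * T) \<noteq> 0" using x by (simp add: kT sin_double)
  define p where "p t = \<tau> / K * (1 - cos (k * t)) + B * sin (k * t)" for t
  define p' where "p' t = \<tau> / K * (k * sin (k * t)) + B * (k * cos (k * t))" for t
  define z where "z t = t - \<tau> * (\<tau> / K * (t - sin (k * t) / k) + B * ((1 - cos (k * t)) / k))" for t
  have dp: "(p has_real_derivative p' t) (at t)" for t
    unfolding p_def p'_def using K(1) by (auto intro!: derivative_eq_intros)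
  have dp': "(p' has_real_derivative \<tau> - K * p t) (at t)" for t
  proof -
    have "(p' has_real_derivative \<tau> / K * (k * (k * cos (k * t))) - B * (k * (k * sin (k * t)))) (at t)"
      unfolding p'_def using K(1) by (auto intro!: derivative_eq_intros)
    moreover have "\<tau> / K * (k * (k * cos (k * t))) - B * (k * (k * sin (k * t))) = \<tau> - K * p t"
      unfolding p_def using K(1) by (simp add: field_simps) (simp add: K_def power2_eq_square algebra_simps)
    ultimately show ?thesis by simp
  qed
  have dz: "(z has_real_derivative 1 - \<tau> * p t) (at t)" for t
    unfolding z_def p_def using k(2) K(1) by (auto intro!: derivative_eq_intros)
  have zero0: "p 0 = 0" "z 0 = 0" by (simp_all add: p_def z_def)
  have s2: "1 - cos (2 * x) = 2 * (sin x)\<^sup>2" "sin (2 * x) = 2 * sin x * cos x"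
    by (simp_all add: cos_double_sin sin_double)
  have zeroT: "p T = 0" "z T = 0"
  proof -
    show "p T = 0" unfolding p_def kT s2 B_def using x(4) by (simp add: field_simps power2_eq_square)
    have e: "\<tau> / K * (2 * x / k - 2 * a * b / k) + - (\<tau> / K) * (a / b) * (2 * a\<^sup>2 / k)
        = 2 / k * (\<tau> / K) * (x - a * (a\<^sup>2 + b\<^sup>2) / b)" if "b \<noteq> 0" for a b :: real
      using that k(2) K(1) by (simp add: field_simps power2_eq_square)
    have sc: "sin x / cos x = \<nu> * x" unfolding x(2) using x(4) by simp
    have "z T = T - \<tau> * (2 / k * (\<tau> / K) * (x - sin x * ((sin x)\<^sup>2 + (cos x)\<^sup>2) / cos x))"
      unfolding z_def kT s2 unfolding T_def B_def e[OF x(4)] ..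
    also have "\<dots> = 2 / k * (x - \<tau> * (\<tau> / K) * (x - \<nu> * x))"
    proof -
      have sc': "sin x * ((sin x)\<^sup>2 + (cos x)\<^sup>2) / cos x = \<nu> * x" using sc by simp
      show ?thesis unfolding sc' T_def by (simp add: divide_inverse algebra_simps)
    qed
    also have "x - \<tau> * (\<tau> / K) * (x - \<nu> * x) = 0"
      using K(1) tau_pos by (simp add: \<nu>_def field_simps power2_eq_square)
    finally show "z T = 0" by simp
  qed
  \<comment> \<open>Solves the relation between \<open>r\<close> and \<open>P\<close> in
    \<open>rotating_frame\<close> for \<open>P\<close>, with \<open>q\<close> replaced by
    \<open>- c * z\<close>; its slope must come out as \<open>- lam * s\<close>.\<close>
  define P where "P t = p' t - (\<tau> * c\<^sup>2 + (lam + \<tau>) * s) * z t" for t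
  have dP: "(P has_real_derivative - lam * s) (at t)" for t
  proof -
    have "(P has_real_derivative \<tau> - K * p t - (\<tau> * c\<^sup>2 + (lam + \<tau>) * s) * (1 - \<tau> * p t)) (at t)"
      unfolding P_def by (auto intro!: derivative_eq_intros dp' dz)
    moreover have "\<tau> - K * p t - (\<tau> * c\<^sup>2 + (lam + \<tau>) * s) * (1 - \<tau> * p t) = - lam * s"
      unfolding K(2) s(2) by (simp add: algebra_simps)
    ultimately show ?thesis by simp
  qed
  have pP: "p' t = \<tau> * c * (c * z t) + (lam + \<tau>) * s * z t + P t" for t
    by (simp add: P_def power2_eq_square algebra_simps)
  \<comment> \<open>Inverts the passage to the turning frame: \<open>y\<close> has parallel part
    \<open>- c * z\<close>, transverse part \<open>p\<close> and vertical part \<open>z\<close>. In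
    the same way \<open>w\<close> has the parts \<open>- c\<close>, \<open>P\<close> and 1; dividing
    by \<open>s\<close> normalizes the horizontal velocity.\<close>
  define y where "y t = (vector [(- vel \<gamma> t $ 1 * (c * z t) - vel \<gamma> t $ 2 * p t) / s,
     (- vel \<gamma> t $ 2 * (c * z t) + vel \<gamma> t $ 1 * p t) / s, z t] :: real^3)" for t
  define w where "w t = (vector [(- vel \<gamma> t $ 1 * c - vel \<gamma> t $ 2 * P t) / s,
     (- vel \<gamma> t $ 2 * c + vel \<gamma> t $ 1 * P t) / s, 1] :: real^3)" for t
  have yd: "hvd y (w t - Lam \<kappa> \<tau> (vel \<gamma> t) (y t)) t" for t
    unfolding forall_3 vector_minus_component Lam_nth sl om(1)
  proof (intro conjI)
    show "((\<lambda>s. y s $ 1) has_real_derivative w t $ 1 - (lam + \<tau>) * (vel \<gamma> t $ 2 * y t $ 3 - c * y t $ 2)) (at t)"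
      unfolding y_def w_def vector_3
      by (rule DERIV_cong, (rule DERIV_cdivide DERIV_diff DERIV_mult DERIV_minus DERIV_cmult v1 v2 dp dz)+,
          use s(1) in \<open>simp add: pP field_simps\<close>)
    show "((\<lambda>s. y s $ 2) has_real_derivative w t $ 2 - (lam + \<tau>) * (c * y t $ 1 - vel \<gamma> t $ 1 * y t $ 3)) (at t)"
      unfolding y_def w_def vector_3
      by (rule DERIV_cong, (rule DERIV_cdivide DERIV_add DERIV_mult DERIV_minus DERIV_cmult v1 v2 dp dz)+,
          use s(1) in \<open>simp add: pP field_simps\<close>)
    have "vel \<gamma> t $ 1 * y t $ 2 - vel \<gamma> t $ 2 * y t $ 1 = ((vel \<gamma> t $ 1)\<^sup>2 + (vel \<gamma> t $ 2)\<^sup>2) * p t / s"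
      using s(1) by (simp add: y_def field_simps power2_eq_square)
    then have "vel \<gamma> t $ 1 * y t $ 2 - vel \<gamma> t $ 2 * y t $ 1 = p t" using s(1) by (simp add: vS)
    then show "((\<lambda>s. y s $ 3) has_real_derivative w t $ 3 - \<tau> * (vel \<gamma> t $ 1 * y t $ 2 - vel \<gamma> t $ 2 * y t $ 1)) (at t)"
      using dz[of t] by (simp add: y_def w_def)
  qed
  have wd: "hvd w (- Gam \<kappa> \<tau> (w t) (vel \<gamma> t) - Gam \<kappa> \<tau> (vel \<gamma> t) (w t)) t" for t
    unfolding forall_3 vector_minus_component vector_uminus_component Gam_nth sl om(1)
  proof (intro conjI)
    show "((\<lambda>s. w s $ 1) has_real_derivative - (\<tau> / 2 * (w t $ 2 * c) - (lam + \<tau> - \<tau> / 2) * (w t $ 3 * vel \<gamma> t $ 2)) -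
         (\<tau> / 2 * (vel \<gamma> t $ 2 * w t $ 3) - (lam + \<tau> - \<tau> / 2) * (c * w t $ 2))) (at t)"
      unfolding w_def vector_3
      by (rule DERIV_cong, (rule DERIV_cdivide DERIV_diff DERIV_mult DERIV_minus DERIV_const v1 v2 dP)+,
          use s(1) in \<open>simp add: field_simps\<close>)
    show "((\<lambda>s. w s $ 2) has_real_derivative - ((lam + \<tau> - \<tau> / 2) * (w t $ 3 * vel \<gamma> t $ 1) - \<tau> / 2 * (w t $ 1 * c)) -
         ((lam + \<tau> - \<tau> / 2) * (c * w t $ 1) - \<tau> / 2 * (vel \<gamma> t $ 1 * w t $ 3))) (at t)"
      unfolding w_def vector_3
      by (rule DERIV_cong, (rule DERIV_cdivide DERIV_add DERIV_mult DERIV_minus DERIV_const v1 v2 dP)+,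
          use s(1) in \<open>simp add: field_simps\<close>)
    show "((\<lambda>s. w s $ 3) has_real_derivative - (\<tau> / 2 * (w t $ 1 * vel \<gamma> t $ 2 - w t $ 2 * vel \<gamma> t $ 1)) -
         \<tau> / 2 * (vel \<gamma> t $ 1 * w t $ 2 - vel \<gamma> t $ 2 * w t $ 1)) (at t)"
      by (simp add: w_def algebra_simps)
  qed
  have C: "Ck_on k' UNIV p" "Ck_on k' UNIV z" "Ck_on k' UNIV P" for k'
    unfolding p_def z_def P_def p'_def divide_inverse
    by (intro Ck_on_add Ck_on_diff Ck_on_mult Ck_on_const Ck_on_id Ck_on_sin_scaled Ck_on_cos_scaled open_UNIV)+
  have "\<forall>i. Ck_on k' UNIV (\<lambda>t. y t $ i)" "\<forall>i. Ck_on k' UNIV (\<lambda>t. w t $ i)" for k'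
    unfolding forall_3 y_def w_def vector_3 divide_inverse
    by (intro conjI Ck_on_add Ck_on_diff Ck_on_mult Ck_on_minus Ck_on_const C v(2) open_UNIV)+
  then have "jacobi_field A D \<gamma> (\<lambda>t. fr (y t) (\<gamma> t))"
    by (intro jacobi_fieldI[OF \<gamma> _ yd _ wd]) auto
  moreover have "(\<lambda>t. fr (y t) (\<gamma> t)) \<noteq> (\<lambda>r f. 0)"
  proof
    assume "(\<lambda>t. fr (y t) (\<gamma> t)) = (\<lambda>r f. 0)"
    then have "fr (y t) (\<gamma> t) = fr 0 (\<gamma> t)" for t by (simp add: fr_zero fun_eq_iff)
    then have "y t = 0" for t by (simp only: fr_inject)
    then have "z t = 0" for t by (metis y_def vector_3(3) zero_index)
    then have "z = (\<lambda>t. 0)" by blast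
    then have "(z has_real_derivative 0) (at 0)" by simp
    then show False using dz[of 0] DERIV_unique zero0 by fastforce
  qed
  moreover have "y 0 = 0" "y T = 0" by (simp_all add: y_def vec3_eq_iff zero0 zeroT)
  ultimately have "conjugate_along A D \<gamma> 0 T"
    unfolding conjugate_along_def using T by (intro conjI exI[of _ "\<lambda>t. fr (y t) (\<gamma> t)"]) (auto simp: fr_zero)
  then show ?thesis using sT by (rule that)
qed

end

section \<open>The group structure\<close>

context M3 begin

abbreviation mul :: "'a \<Rightarrow> 'a \<Rightarrow> 'a" where "mul a b \<equiv> a \<otimes>\<^bsub>G\<^esub> b"
abbreviation iv :: "'a \<Rightarrow> 'a" where "iv a \<equiv> inv\<^bsub>G\<^esub> a"
abbreviation one :: 'a where "one \<equiv> \<one>\<^bsub>G\<^esub>"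

lemma lie: "lie_group G A"
  using M3 unfolding is_M3_def by blast

lemma grp: "group G" and car: "carrier G = UNIV"
  using lie unfolding lie_group_def by blast+

lemma mul_assoc: "mul (mul a b) c = mul a (mul b c)"
  using group.is_monoid[OF grp] car by (simp add: monoid.m_assoc)

lemma one_mul [simp]: "mul one a = a" "mul a one = a"
  using group.is_monoid[OF grp] car by (simp_all add: monoid.l_one monoid.r_one)

lemma iv_mul [simp]: "mul (iv a) a = one" "mul a (iv a) = one"
  using group.l_inv[OF grp] group.r_inv[OF grp] car by simp_all

lemma iv_mul_cancel [simp]: "mul (iv a) (mul a b) = b" "mul a (mul (iv a) b) = b"
  by (simp_all flip: mul_assoc)

text \<open>Smoothness of multiplication is given for the product atlas, with a chart in the target.
  On the part \<open>N\<close> of a product of charts that is mapped into one target chart,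
  \<open>f\<close> after multiplication factors through that chart; such parts cover
  everything.\<close>

lemma smooth2_mul:
  assumes f: "f \<in> smooth_functions A" shows "smooth2 A A (\<lambda>x y. f (mul x y))"
  unfolding smooth2_def
proof (clarify, rule Ck_on_local, clarify)
  fix U \<phi> V \<psi> k p q assume c: "(U, \<phi>) \<in> A" "(V, \<psi>) \<in> A" "p \<in> U" "q \<in> V"
  have sm: "smooth_map (product_atlas A A) A (\<lambda>(x, y). mul x y)"
    using lie unfolding lie_group_def by blast
  have cont: "continuous_on UNIV (\<lambda>(x, y). mul x y)" using sm unfolding smooth_map_def by blast
  obtain W \<eta> where d: "(W, \<eta>) \<in> A" "mul p q \<in> W" by (rule chart_at)
  define M where "M z = mul (inv_into U \<phi> (fst z)) (inv_into V \<psi> (snd z))" for z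
  define N where "N = {z \<in> \<phi> ` U \<times> \<psi> ` V. M z \<in> W}"
  have contM: "continuous_on (\<phi> ` U \<times> \<psi> ` V) M"
  proof -
    have "continuous_on (\<phi> ` U \<times> \<psi> ` V) (\<lambda>z. (inv_into U \<phi> (fst z), inv_into V \<psi> (snd z)))"
      by (intro continuous_on_Pair continuous_on_compose2[OF chart(4)[OF c(1)]] continuous_on_compose2[OF chart(4)[OF c(2)]]
          continuous_on_fst continuous_on_snd continuous_on_id) auto
    from continuous_on_compose2[OF cont this] show ?thesis by (simp add: M_def[abs_def])
  qed
  have "open N"
  proof -
    have "N = (\<phi> ` U \<times> \<psi> ` V) \<inter> M -` W" by (auto simp: N_def)
    then show ?thesis
      using continuous_open_preimage[OF contM _ chart(1)[OF d(1)]] chart(2)[OF c(1)] chart(2)[OF c(2)] by (simp add: open_Times)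
  qed
  have inv: "inv_into (U \<times> V) (map_prod \<phi> \<psi>) z = (inv_into U \<phi> (fst z), inv_into V \<psi> (snd z))"
    if "z \<in> \<phi> ` U \<times> \<psi> ` V" for z
  proof (rule inv_into_f_eq)
    show "inj_on (map_prod \<phi> \<psi>) (U \<times> V)" by (rule map_prod_inj_on[OF chart(6)[OF c(1)] chart(6)[OF c(2)]])
    show "(inv_into U \<phi> (fst z), inv_into V \<psi> (snd z)) \<in> U \<times> V"
      using that chart(7)[OF c(1)] chart(7)[OF c(2)] by (auto simp del: image_iff)
    show "map_prod \<phi> \<psi> (inv_into U \<phi> (fst z), inv_into V \<psi> (snd z)) = z"
      using that chart(8)[OF c(1)] chart(8)[OF c(2)] by (cases z) auto
  qed
  have "(U \<times> V, map_prod \<phi> \<psi>) \<in> product_atlas A A" using c unfolding product_atlas_def by blast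
  then have "smooth_on (map_prod \<phi> \<psi> ` ((U \<times> V) \<inter> (\<lambda>(x, y). mul x y) -` W)) (\<eta> \<circ> (\<lambda>(x, y). mul x y) \<circ> inv_into (U \<times> V) (map_prod \<phi> \<psi>))"
    using sm d(1) unfolding smooth_map_def by blast
  moreover have "N \<subseteq> map_prod \<phi> \<psi> ` ((U \<times> V) \<inter> (\<lambda>(x, y). mul x y) -` W)"
  proof
    fix z assume z: "z \<in> N"
    then have "z = map_prod \<phi> \<psi> (inv_into U \<phi> (fst z), inv_into V \<psi> (snd z))"
      using chart(8)[OF c(1)] chart(8)[OF c(2)] by (cases z) (auto simp: N_def)
    moreover have "(inv_into U \<phi> (fst z), inv_into V \<psi> (snd z)) \<in> (U \<times> V) \<inter> (\<lambda>(x, y). mul x y) -` W"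
      using z chart(7)[OF c(1)] chart(7)[OF c(2)] by (auto simp: N_def M_def simp del: image_iff)
    ultimately show "z \<in> map_prod \<phi> \<psi> ` ((U \<times> V) \<inter> (\<lambda>(x, y). mul x y) -` W)" by (rule image_eqI)
  qed
  ultimately have "Ck_on k N (\<eta> \<circ> (\<lambda>(x, y). mul x y) \<circ> inv_into (U \<times> V) (map_prod \<phi> \<psi>))"
    unfolding smooth_on_def using Ck_on_subset by blast
  then have "Ck_on k N (\<lambda>z. \<eta> (M z))"
    by (rule Ck_on_cong[OF \<open>open N\<close>]) (use inv in \<open>auto simp: N_def M_def\<close>)
  then have "Ck_on k N (\<lambda>z. f (inv_into W \<eta> (\<eta> (M z))))"
    by (rule Ck_on_compose[OF \<open>open N\<close> chart(2)[OF d(1)] smooth_functions_Ck[OF f d(1)]]) (auto simp: N_def)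
  then have "Ck_on k N (\<lambda>z. f (M z))"
    by (rule Ck_on_cong[OF \<open>open N\<close>]) (simp add: N_def chart(5)[OF d(1)])
  moreover have "(\<phi> p, \<psi> q) \<in> N" using c d chart(5)[OF c(1)] chart(5)[OF c(2)] by (simp add: N_def M_def)
  ultimately show "\<exists>N. open N \<and> (\<phi> p, \<psi> q) \<in> N \<and> Ck_on k N (\<lambda>z. f (mul (inv_into U \<phi> (fst z)) (inv_into V \<psi> (snd z))))"
    using \<open>open N\<close> unfolding M_def by blast
qed

interpretation pair: two_manifolds A A by unfold_locales

lemma smooth_right: "f \<in> smooth_functions A \<Longrightarrow> (\<lambda>q. f (mul q b)) \<in> smooth_functions A"
  by (rule pair.smooth2_slice'[OF smooth2_mul])

lemma smooth_right_iff: "(\<lambda>q. f (mul q b)) \<in> smooth_functions A \<longleftrightarrow> f \<in> smooth_functions A"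
proof
  assume "(\<lambda>q. f (mul q b)) \<in> smooth_functions A"
  from smooth_right[OF this, of "iv b"] show "f \<in> smooth_functions A" by (simp add: mul_assoc)
qed (rule smooth_right)

lemma smooth_inverse:
  assumes f: "f \<in> smooth_functions A" shows "(\<lambda>q. f (iv q)) \<in> smooth_functions A"
  unfolding smooth_functions_iff
proof (clarify, rule Ck_on_local, clarify)
  fix U \<phi> k p assume c: "(U, \<phi>) \<in> A" "p \<in> U"
  have sm: "smooth_map A A iv" using lie unfolding lie_group_def by blast
  obtain W \<eta> where d: "(W, \<eta>) \<in> A" "iv p \<in> W" by (rule chart_at)
  define N where "N = \<phi> ` (U \<inter> iv -` W)"
  have cont: "continuous_on UNIV iv" using sm unfolding smooth_map_def by blast
  have "open (iv -` W)" using cont chart(1)[OF d(1)] by (simp add: open_vimage)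
  then have N: "open N" unfolding N_def by (rule open_chart_image[OF c(1)])
  have "Ck_on k N (\<eta> \<circ> iv \<circ> inv_into U \<phi>)"
    using sm c(1) d(1) unfolding smooth_map_def N_def smooth_on_def by blast
  then have "Ck_on k N (\<lambda>x. f (inv_into W \<eta> ((\<eta> \<circ> iv \<circ> inv_into U \<phi>) x)))"
    by (rule Ck_on_compose[OF N chart(2)[OF d(1)] smooth_functions_Ck[OF f d(1)]]) (auto simp: N_def chart(5)[OF c(1)])
  then have "Ck_on k N (\<lambda>x. f (iv (inv_into U \<phi> x)))"
    by (rule Ck_on_cong[OF N]) (auto simp: N_def chart(5)[OF c(1)] chart(5)[OF d(1)])
  then show "\<exists>N. open N \<and> \<phi> p \<in> N \<and> Ck_on k N (\<lambda>x. f (iv (inv_into U \<phi> x)))"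
    using N c d by (intro exI[of _ N]) (auto simp: N_def)
qed

section \<open>Right-invariant fields and the adjoint action\<close>

lemma u_left:
  assumes "f \<in> smooth_functions A" shows "u i (mul a p) f = u i p (\<lambda>q. f (mul a q))"
proof -
  have "pushforward A (\<lambda>q. mul a q) (u i p) = u i (mul a p)"
    using M3 unfolding is_M3_def lie_algebra_def by blast
  from fun_cong[OF this, of f] show ?thesis using assms by (simp add: pushforward_def comp_def)
qed

lemma fr_left:
  assumes "f \<in> smooth_functions A" shows "fr c (mul a p) f = fr c p (\<lambda>q. f (mul a q))"
  by (simp add: fr_def u_left[OF assms])

text \<open>\<open>rho b\<close> is \<open>Ad (inv b)\<close>: it expresses right-invariant vector fields in the left-invariant frame.\<close>

definition rfield :: "real^3 \<Rightarrow> 'a vfield" where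
  "rfield w b f = fr w one (\<lambda>x. f (mul x b))"

definition rho :: "'a \<Rightarrow> real^3 \<Rightarrow> real^3" where
  "rho b w = coef b (rfield w b)"

lemma rfield_vf: "rfield w \<in> vector_fields A"
  unfolding vector_fields_def
proof (intro CollectI conjI allI ballI)
  fix f assume f: "f \<in> smooth_functions A"
  show "(\<lambda>p. rfield w p f) \<in> smooth_functions A"
    unfolding rfield_def by (rule pair.smooth2_deriv[OF smooth2_mul[OF f] fr_tangent])
next
  fix p show "rfield w p \<in> tangent_space A p"
    unfolding tangent_space_def rfield_def
    by (auto simp: tangentD(1,2,4,5)[OF fr_tangent] smooth_right smooth_cmult smooth_right_iff)
qed

lemma rfield_fr: "rfield w b = fr (rho b w) b"
  unfolding rho_def by (simp add: fr_coef vf_tangent[OF rfield_vf])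

lemma smooth_vec_rho: "smooth_vec (\<lambda>b. rho b w)"
  unfolding rho_def by (rule field_coef_smooth[OF rfield_vf])

lemma rho_one: "rho one w = w"
  by (simp add: rho_def rfield_def[abs_def])

text \<open>The two fields differentiate different factors of \<open>f (mul x q)\<close>, so
  \<open>tangent_commute\<close> interchanges them.\<close>

lemma rfield_commute:
  assumes f: "f \<in> smooth_functions A"
  shows "u k b (\<lambda>q. rfield w q f) = rfield w b (\<lambda>q. u k q f)"
proof -
  have "u k b (\<lambda>q. fr w one (\<lambda>x. f (mul x q))) = fr w one (\<lambda>x. u k b (\<lambda>q. f (mul x q)))"
    using pair.tangent_commute[OF smooth2_mul[OF f] fr_tangent u_tangent, of w one k b] by simp
  then show ?thesis unfolding rfield_def by (simp add: u_left[OF f])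
qed

text \<open>The vanishing bracket of \<open>u j\<close> with a right-invariant field, written in the
  frame. It is the equation that every later evaluation of \<open>rho\<close> relies on.\<close>

lemma dv_rho: "dv (fr c p) (\<lambda>b. rho b w) = - Lam \<kappa> \<tau> c (rho p w)"
proof -
  have uj: "u j = (\<lambda>q. fr (axis j 1) q)" for j by (rule ext) (rule u_fr)
  have rf: "rfield w = (\<lambda>q. fr (rho q w) q)" by (rule ext) (rule rfield_fr)
  have "lie_bracket (u j) (rfield w) p f = 0" for j f
  proof (cases "f \<in> smooth_functions A")
    case True then show ?thesis by (simp add: lie_bracket_def rfield_commute)
  next
    case False
    then show ?thesis
      using tangentD(5)[OF u_tangent] tangentD(5)[OF vf_tangent[OF rfield_vf]]
        tangentD(6)[OF u_tangent] tangentD(6)[OF vf_tangent[OF rfield_vf]] by (simp add: lie_bracket_def)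
  qed
  then have "lie_bracket (\<lambda>q. fr (axis j 1) q) (\<lambda>q. fr (rho q w) q) p = fr 0 p" for j
    by (simp add: fr_zero fun_eq_iff flip: uj rf)
  then have j: "dv (fr (axis j 1) p) (\<lambda>q. rho q w) + Lam \<kappa> \<tau> (axis j 1) (rho p w) = 0" for j
    unfolding bracket_fr[OF smooth_vec_const smooth_vec_rho] fr_inject
    by (simp add: vec3_eq_iff dv_nth tangentD(6)[OF fr_tangent])
  have "dv (fr c p) (\<lambda>b. rho b w) $ i = c $ 1 * dv (u 1 p) (\<lambda>b. rho b w) $ i + c $ 2 * dv (u 2 p) (\<lambda>b. rho b w) $ i + c $ 3 * dv (u 3 p) (\<lambda>b. rho b w) $ i" for i
    by (simp add: dv_nth fr_def)
  moreover have "dv (u j p) (\<lambda>b. rho b w) = - Lam \<kappa> \<tau> (axis j 1) (rho p w)" for j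
    using j[of j] by (simp add: u_fr eq_neg_iff_add_eq_0)
  ultimately have e: "dv (fr c p) (\<lambda>b. rho b w) $ i = - (c $ 1 * Lam \<kappa> \<tau> (axis 1 1) (rho p w) $ i
      + c $ 2 * Lam \<kappa> \<tau> (axis 2 1) (rho p w) $ i + c $ 3 * Lam \<kappa> \<tau> (axis 3 1) (rho p w) $ i)" for i
    by simp
  show ?thesis unfolding vec3_eq_iff vector_uminus_component e Lam_nth by (simp add: axis_def algebra_simps)
qed

section \<open>Curves and their body velocities\<close>

text \<open>The body velocity (left logarithmic derivative) of the curve at \<open>t\<close> is
  \<open>x\<close>.\<close>

definition moves :: "(real \<Rightarrow> 'a) \<Rightarrow> real^3 \<Rightarrow> real \<Rightarrow> bool" where
  "moves c x t \<longleftrightarrow> has_vel A c (fr x (c t)) t"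

lemma movesD: "moves c x t \<Longrightarrow> f \<in> smooth_functions A \<Longrightarrow> ((\<lambda>s. f (c s)) has_real_derivative fr x (c t) f) (at t)"
  unfolding moves_def has_vel_def by blast

lemma movesI: "(\<And>f. f \<in> smooth_functions A \<Longrightarrow> ((\<lambda>s. f (c s)) has_real_derivative fr x (c t) f) (at t)) \<Longrightarrow> moves c x t"
  unfolding moves_def has_vel_def by (blast intro: fr_tangent)

lemma moves_geodesic: "smooth_curve A \<gamma> \<Longrightarrow> moves \<gamma> (vel \<gamma> t) t"
  unfolding moves_def by (rule has_vel_vel)

lemma moves_const: "moves (\<lambda>t. a) 0 t"
  by (rule movesI) (simp add: fr_zero)

text \<open>The product rule for body velocities: differentiating the first factor gives
  \<open>x\<close> carried through \<open>d t\<close> by Ad of its inverse, differentiating the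
  second gives \<open>y\<close> unchanged.\<close>

lemma moves_mul:
  assumes c: "moves c x t" and d: "moves d y t"
  shows "moves (\<lambda>s. mul (c s) (d s)) (rho (d t) x + y) t"
proof (rule movesI)
  fix f assume f: "f \<in> smooth_functions A"
  have "((\<lambda>s. f (mul (c s) (d s))) has_real_derivative
      fr x (c t) (\<lambda>p. f (mul p (d t))) + fr y (d t) (\<lambda>q. f (mul (c t) q))) (at t)"
    using pair.smooth2_chain[OF smooth2_mul[OF f] c[unfolded moves_def] d[unfolded moves_def]] .
  also have "fr x (c t) (\<lambda>p. f (mul p (d t))) = fr x one (\<lambda>p. f (mul (mul (c t) p) (d t)))"
    using fr_left[OF smooth_right[OF f], of x "c t" one "d t"] by simp
  also have "\<dots> = rfield x (d t) (\<lambda>q. f (mul (c t) q))" by (simp add: rfield_def mul_assoc)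
  also have "\<dots> + fr y (d t) (\<lambda>q. f (mul (c t) q)) = fr (rho (d t) x + y) (d t) (\<lambda>q. f (mul (c t) q))"
    by (simp add: rfield_fr fr_add)
  also have "\<dots> = fr (rho (d t) x + y) (mul (c t) (d t)) f" by (simp add: fr_left[OF f])
  finally show "((\<lambda>s. f (mul (c s) (d s))) has_real_derivative fr (rho (d t) x + y) (mul (c t) (d t)) f) (at t)" .
qed

lemma rfield_zero: "rho b 0 = 0"
proof -
  have "fr (rho b 0) b = fr 0 b" unfolding rfield_fr[symmetric] by (simp add: rfield_def[abs_def] fr_zero)
  then show ?thesis by (simp only: fr_inject)
qed

lemma rho_linear: "rho b (a *\<^sub>R x + y) = a *\<^sub>R rho b x + rho b y"
proof -
  have "fr (rho b (a *\<^sub>R x + y)) b = fr (a *\<^sub>R rho b x + rho b y) b"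
    by (rule ext) (simp add: fr_add fr_scale flip: rfield_fr, simp add: rfield_def fr_add fr_scale)
  then show ?thesis by (simp only: fr_inject)
qed

lemma moves_left: "moves d y t \<Longrightarrow> moves (\<lambda>s. mul a (d s)) y t"
  using moves_mul[OF moves_const, of d y t a] by (simp add: rfield_zero)

lemma moves_right: "moves c x t \<Longrightarrow> moves (\<lambda>s. mul (c s) b) (rho b x) t"
  using moves_mul[OF _ moves_const, of c x t b] by simp

lemma hvd_rho: "moves c x t \<Longrightarrow> hvd (\<lambda>s. rho (c s) w) (- Lam \<kappa> \<tau> x (rho (c t) w)) t"
  unfolding moves_def using hvd_compose[OF _ smooth_vec_rho] dv_rho by metis

lemma moves_unique: "moves c x t \<Longrightarrow> moves c y t \<Longrightarrow> x = y"
  unfolding moves_def using has_vel_unique fr_inject by blast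

text \<open>Mere existence of a velocity is enough, since \<open>curves_eq\<close> cancels its value
  without computing it.\<close>

lemma moves_inverse: assumes c: "moves c x t" obtains y where "moves (\<lambda>s. iv (c s)) y t"
proof -
  define v where "v f = (if f \<in> smooth_functions A then fr x (c t) (\<lambda>q. f (iv q)) else 0)" for f
  have v: "v \<in> tangent_space A (iv (c t))"
    unfolding tangent_space_def v_def
    by (auto simp: tangentD(1,2,4)[OF fr_tangent] smooth_inverse smooth_add smooth_mult smooth_cmult)
  then obtain y where y: "v = fr y (iv (c t))" by (rule tangent_fr)
  have "moves (\<lambda>s. iv (c s)) y t"
    by (rule movesI) (use movesD[OF c smooth_inverse] in \<open>simp add: y[symmetric] v_def\<close>)
  then show ?thesis by (rule that)
qed

lemma moves_zero_const:
  assumes I: "open I" "connected I" and c: "\<And>t. t \<in> I \<Longrightarrow> moves c 0 t" and st: "s \<in> I" "t \<in> I"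
  shows "c s = c t"
proof (rule smooth_functions_separate)
  fix f assume "f \<in> smooth_functions A"
  then have "((\<lambda>s. f (c s)) has_real_derivative 0) (at t)" if "t \<in> I" for t
    using movesD[OF c[OF that]] by (simp add: fr_zero)
  then have "(\<lambda>s. f (c s)) constant_on I"
    using I by (intro has_field_derivative_0_imp_constant_on) auto
  then show "f (c s) = f (c t)" using st unfolding constant_on_def by metis
qed

text \<open>The product of \<open>d\<close> and its inverse is constant, so the body velocity
  computed for it by \<open>moves_mul\<close> is 0. The product of \<open>c\<close> with the same
  inverse has the same body velocity and is therefore constant too.\<close>

lemma curves_eq:
  assumes I: "open I" "connected I" and c: "\<And>t. t \<in> I \<Longrightarrow> moves c (x t) t" and d: "\<And>t. t \<in> I \<Longrightarrow> moves d (x t) t"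
    and st: "s \<in> I" "c s = d s" "t \<in> I"
  shows "c t = d t"
proof -
  have "moves (\<lambda>t. mul (c t) (iv (d t))) 0 t" if t: "t \<in> I" for t
  proof -
    obtain y where y: "moves (\<lambda>s. iv (d s)) y t" using moves_inverse[OF d[OF t]] by blast
    have "moves (\<lambda>s. mul (d s) (iv (d s))) (rho (iv (d t)) (x t) + y) t" by (rule moves_mul[OF d[OF t] y])
    then have "moves (\<lambda>s. one) (rho (iv (d t)) (x t) + y) t" by simp
    then have "rho (iv (d t)) (x t) + y = 0" using moves_unique moves_const by blast
    then show ?thesis using moves_mul[OF c[OF t] y] by simp
  qed
  from moves_zero_const[OF I this st(3,1)] have "mul (c t) (iv (d t)) = one" using st(2) by simp
  then have "mul (mul (c t) (iv (d t))) (d t) = d t" by simp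
  then show ?thesis by (simp add: mul_assoc)
qed

section \<open>Geodesics that meet each fiber once\<close>

text \<open>A right-invariant field obeys the system of \<open>rotating_frame\<close> with zero
  variation of the velocity, so \<open>p'' + K p = 0\<close> without constant term. As
  \<open>K\<close> is not positive, \<open>p * r\<close> is nondecreasing; it is 0 at the start, so
  \<open>p^2\<close> is smallest there and \<open>p\<close> never vanishes. Since the vertical
  component has derivative \<open>- \<tau> * p\<close>, it takes no value twice.\<close>

lemma meets_once_if:
  assumes \<gamma>: "unit_speed_geodesic A g D \<gamma>" and sl: "\<And>t. vel \<gamma> t $ 3 = c" and S: "c\<^sup>2 < 1"
    and K: "\<kappa> * (1 - c\<^sup>2) + \<tau>\<^sup>2 * c\<^sup>2 \<le> 0"
  shows "meets_each_fiber_once A u \<gamma>"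
  unfolding meets_each_fiber_once_def hopf_fiber_def integral_curve_def
proof (intro allI impI, elim exE conjE)
  fix F \<beta> s t assume \<beta>: "smooth_curve A \<beta>" "\<forall>t. velocity A \<beta> t = u 3 (\<beta> t)" and F: "F = range \<beta>" "\<gamma> s \<in> F" "\<gamma> t \<in> F"
  note v = geodesic_equation[OF \<gamma>]
  \<comment> \<open>The initial horizontal velocity turned by a right angle, so that
    \<open>p\<close> starts at \<open>1 - c^2\<close> with derivative 0. Translating by
    \<open>a\<close> makes the geodesic start at the unit, where \<open>rho\<close> is the
    identity.\<close>
  define w :: "real^3" where "w = vector [- vel \<gamma> 0 $ 2, vel \<gamma> 0 $ 1, 0]"
  define a where "a = iv (\<gamma> 0)"
  have m3: "moves (\<lambda>t. mul a (\<beta> t)) (axis 3 1) t" for t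
    by (rule moves_left) (use has_vel_velocity[OF \<beta>(1), of t] \<beta>(2) in \<open>simp add: moves_def u_fr\<close>)
  \<comment> \<open>Motion along a fiber only rotates the first two coordinates of a right-invariant
    field.\<close>
  have f3: "rho (mul a (\<beta> x)) w $ 3 = rho (mul a (\<beta> y)) w $ 3" for x y
  proof -
    have "((\<lambda>t. rho (mul a (\<beta> t)) w $ 3) has_real_derivative 0) (at t)" for t
      using spec[OF hvd_rho[OF m3[of t], of w], of 3] by (simp add: Lam_nth axis_def)
    then show ?thesis using DERIV_isconst_all[of "\<lambda>t. rho (mul a (\<beta> t)) w $ 3"] by blast
  qed
  define y where "y t = rho (mul a (\<gamma> t)) w" for t
  have yd: "hvd y ((\<lambda>t. 0) t - Lam \<kappa> \<tau> (vel \<gamma> t) (y t)) t" for t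
    using hvd_rho[OF moves_left[OF moves_geodesic[OF v(1), of t], of a], of w] by (simp add: y_def)
  have wd: "hvd (\<lambda>t. 0) (- Gam \<kappa> \<tau> ((\<lambda>t. 0) t) (vel \<gamma> t) - Gam \<kappa> \<tau> (vel \<gamma> t) ((\<lambda>t. 0) t)) t" for t
    by (simp add: Gam_add)
  note rf = rotating_frame[OF \<gamma> sl yd wd]
  define p where "p t = vel \<gamma> t $ 1 * y t $ 2 - vel \<gamma> t $ 2 * y t $ 1" for t
  define K where "K = \<kappa> * (1 - c\<^sup>2) + \<tau>\<^sup>2 * c\<^sup>2"
  define r where "r t = - \<tau> * c * (vel \<gamma> t $ 1 * y t $ 1 + vel \<gamma> t $ 2 * y t $ 2) + \<kappa> / \<tau> * (1 - c\<^sup>2) * y t $ 3" for t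
  have dp: "(p has_real_derivative r t) (at t)" for t using rf(1)[of t] unfolding p_def[abs_def] r_def by simp
  have dr: "(r has_real_derivative - K * p t) (at t)" for t using rf(2)[of t] unfolding p_def r_def[abs_def] K_def by simp
  have dz: "((\<lambda>t. y t $ 3) has_real_derivative - \<tau> * p t) (at t)" for t using rf(4)[of t] unfolding p_def by simp
  have y0: "y 0 = w" by (simp add: y_def a_def rho_one)
  have vS: "(vel \<gamma> 0 $ 1)\<^sup>2 + (vel \<gamma> 0 $ 2)\<^sup>2 = 1 - c\<^sup>2" using v(4)[of 0] sl by simp
  have p0: "p 0 = 1 - c\<^sup>2" unfolding vS[symmetric] p_def y0 w_def by (simp add: power2_eq_square)
  have r0: "r 0 = 0" unfolding r_def y0 w_def by (simp add: algebra_simps)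
  have dpr: "((\<lambda>t. p t * r t) has_real_derivative (r t)\<^sup>2 - K * (p t)\<^sup>2) (at t)" for t
    by (rule DERIV_cong, rule DERIV_mult[OF dp dr]) (simp add: power2_eq_square algebra_simps)
  have nn: "(r t)\<^sup>2 - K * (p t)\<^sup>2 \<ge> 0" for t
    using mult_nonpos_nonneg[OF K zero_le_power2[of "p t"]] zero_le_power2[of "r t"] unfolding K_def by linarith
  have mono: "p x * r x \<le> p y * r y" if "x \<le> y" for x y
    by (rule DERIV_nonneg_imp_nondecreasing[OF that, of "\<lambda>t. p t * r t"]) (intro exI conjI, rule dpr, rule nn)
  have dp2: "((\<lambda>t. (p t)\<^sup>2) has_real_derivative 2 * (p t * r t)) (at t)" for t
    by (auto intro!: derivative_eq_intros dp)
  have "(p 0)\<^sup>2 \<le> (p t)\<^sup>2" for t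
  proof (cases "t \<ge> 0")
    case True
    show ?thesis
      by (rule DERIV_nonneg_imp_nondecreasing[OF True, of "\<lambda>t. (p t)\<^sup>2"]) (intro exI conjI, rule dp2, use mono[of 0] r0 in simp)
  next
    case False
    then have le: "t \<le> 0" by simp
    show ?thesis
      by (rule DERIV_nonpos_imp_nonincreasing[OF le, of "\<lambda>t. (p t)\<^sup>2"]) (intro exI conjI, rule dp2, use mono[of _ 0] r0 in simp)
  qed
  then have pne: "p t \<noteq> 0" for t using p0 S by (metis diff_gt_0_iff_gt less_irrefl power2_less_eq_zero_iff zero_eq_power2 zero_less_power2)
  have inj: False if "x < x'" "y x $ 3 = y x' $ 3" for x x'
  proof -
    have "\<exists>z>x. z < x' \<and> y x' $ 3 - y x $ 3 = (x' - x) * (- \<tau> * p z)" by (rule MVT2[OF that(1) dz])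
    then show False using that pne tau_pos by auto
  qed
  have "y s $ 3 = y t $ 3" using F f3 unfolding y_def by auto
  then show "s = t" using inj[of s t] inj[of t s] by (metis linorder_less_linear)
qed

end

section \<open>One-parameter subgroups\<close>

lemma C1_lipschitz_bounded:
  fixes F :: "'e::euclidean_space \<Rightarrow> 'e"
  assumes "Ck_on (Suc 0) S F" "cball x0 R \<subseteq> S" "R > 0"
  obtains L M where "L \<ge> 0" "M \<ge> 0" "\<And>x. x \<in> cball x0 R \<Longrightarrow> norm (F x) \<le> M"
    "\<And>x y. x \<in> cball x0 R \<Longrightarrow> y \<in> cball x0 R \<Longrightarrow> norm (F x - F y) \<le> L * norm (x - y)"
proof -
  let ?B = "cball x0 R"
  have bnd: "\<exists>M\<ge>0. \<forall>x\<in>?B. norm (h x) \<le> M" if "continuous_on S h" for h :: "'e \<Rightarrow> 'e"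
  proof -
    have "bounded (h ` ?B)"
      by (intro compact_imp_bounded compact_continuous_image continuous_on_subset[OF that assms(2)] compact_cball)
    then obtain M where "\<forall>x\<in>?B. norm (h x) \<le> M" unfolding bounded_iff by blast
    then show ?thesis by (intro exI[of _ "max M 0"]) (auto simp: le_max_iff_disj)
  qed
  obtain M where M: "M \<ge> 0" "\<And>x. x \<in> ?B \<Longrightarrow> norm (F x) \<le> M"
    using bnd[OF Ck_on_imp_continuous_on[OF assms(1)]] by blast
  have "\<exists>M\<ge>0. \<forall>x\<in>?B. norm (frechet_derivative F (at x) b) \<le> M" for b
    using bnd[of "\<lambda>x. frechet_derivative F (at x) b"] assms(1) by simp
  then obtain N where N: "\<And>b. N b \<ge> 0" "\<And>b x. x \<in> ?B \<Longrightarrow> norm (frechet_derivative F (at x) b) \<le> N b" by metis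
  \<comment> \<open>Only derivatives along basis vectors are bounded so far; the sum of these bounds
    dominates the operator norm.\<close>
  define L where "L = (\<Sum>b\<in>Basis. N b)"
  have "norm (F x - F y) \<le> L * norm (x - y)" if xy: "x \<in> ?B" "y \<in> ?B" for x y
  proof (rule differentiable_bound[OF convex_cball _ _ xy])
    fix x assume x: "x \<in> ?B"
    have hd: "(F has_derivative frechet_derivative F (at x)) (at x)"
      using assms(2) x by (intro Ck_on_has_derivative[OF assms(1)]) blast
    then show "(F has_derivative frechet_derivative F (at x)) (at x within ?B)" by (rule has_derivative_at_withinI)
    have lin: "linear (frechet_derivative F (at x))" using hd has_derivative_linear by blast
    show "onorm (frechet_derivative F (at x)) \<le> L"
    proof (rule onorm_le)
      fix v
      have "frechet_derivative F (at x) v = frechet_derivative F (at x) (\<Sum>b\<in>Basis. (v \<bullet> b) *\<^sub>R b)"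
        by (simp add: euclidean_representation)
      also have "\<dots> = (\<Sum>b\<in>Basis. (v \<bullet> b) *\<^sub>R frechet_derivative F (at x) b)"
        by (simp add: linear_sum[OF lin] linear_cmul[OF lin] del: euclidean_representation)
      also have "norm \<dots> \<le> (\<Sum>b\<in>Basis. norm v * N b)"
        by (intro sum_norm_le) (auto intro!: mult_mono N x Basis_le_norm)
      finally show "norm (frechet_derivative F (at x) v) \<le> L * norm v"
        by (simp add: L_def sum_distrib_left mult.commute)
    qed
  qed
  moreover have "L \<ge> 0" unfolding L_def using N by (simp add: sum_nonneg)
  ultimately show ?thesis using that M by blast
qed

text \<open>Banach's fixed point theorem on bounded continuous functions of the whole line, with
  time clamped to \<open>{-\<epsilon>..\<epsilon>}\<close>. The integral from 0 is written as a
  difference of integrals from \<open>-\<epsilon>\<close>, which avoids oriented integrals for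
  negative time. The two integrals have length at most \<open>2 * \<epsilon>\<close> and \<epsilon>,
  whence the factor 3 in the bound and, for contraction by one half, the 6 in the
  hypothesis.\<close>

lemma picard_lipschitz:
  fixes H :: "'e::euclidean_space \<Rightarrow> 'e"
  assumes L: "L \<ge> 0" "\<And>x y. norm (H x - H y) \<le> L * norm (x - y)"
    and M: "\<And>x. norm (H x) \<le> M" and e: "\<epsilon> > 0" "6 * \<epsilon> * L \<le> 1"
  obtains x where "x 0 = x0" "\<And>t. t \<in> {-\<epsilon><..<\<epsilon>} \<Longrightarrow> (x has_vector_derivative H (x t)) (at t)"
    "\<And>t. norm (x t - x0) \<le> 3 * \<epsilon> * M"
proof -
  define cl where "cl t = max (-\<epsilon>) (min \<epsilon> t)" for t
  have cl: "cl t \<in> {-\<epsilon>..\<epsilon>}" for t using e by (auto simp: cl_def)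
  have Hc: "continuous_on UNIV H"
    by (rule Lipschitz.lipschitz_on_continuous_on[of L]) (rule lipschitz_onI, use L in \<open>auto simp: dist_norm\<close>)
  have c: "continuous_on UNIV (\<lambda>s. H (apply_bcontfun x s))" for x :: "real \<Rightarrow>\<^sub>C 'e"
    by (rule continuous_on_compose2[OF Hc]) (auto intro: continuous_on_apply_bcontfun)
  have int: "(\<lambda>s. H (apply_bcontfun x s)) integrable_on {a..b}" for a b and x :: "real \<Rightarrow>\<^sub>C 'e"
    by (intro integrable_continuous_interval continuous_on_subset[OF c]) simp
  define Q where "Q x t = x0 + integral {-\<epsilon>..cl t} (\<lambda>s. H (apply_bcontfun x s)) - integral {-\<epsilon>..0} (\<lambda>s. H (apply_bcontfun x s))"
    for x :: "real \<Rightarrow>\<^sub>C 'e" and t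
  have ib: "norm (integral {-\<epsilon>..b} h) \<le> B * (b + \<epsilon>)" if "\<And>s. norm (h s) \<le> B" "continuous_on UNIV h" "-\<epsilon> \<le> b" for b B and h :: "real \<Rightarrow> 'e"
    using integral_bound[of "-\<epsilon>" b h B] that by (auto intro: continuous_on_subset)
  have Qb: "norm (Q x t - x0) \<le> 3 * \<epsilon> * M" for x t
  proof -
    have M0: "M \<ge> 0" using M[of 0] norm_ge_zero order_trans by blast
    have "norm (Q x t - x0) \<le> norm (integral {-\<epsilon>..cl t} (\<lambda>s. H (apply_bcontfun x s))) + norm (integral {-\<epsilon>..0} (\<lambda>s. H (apply_bcontfun x s)))"
      unfolding Q_def by (simp add: norm_triangle_ineq4)
    also have "\<dots> \<le> M * (cl t + \<epsilon>) + M * (0 + \<epsilon>)"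
      using cl[of t] e by (intro add_mono ib M c) auto
    also have "\<dots> \<le> M * (2 * \<epsilon>) + M * \<epsilon>" using cl[of t] M0 by (intro add_mono mult_left_mono) auto
    finally show ?thesis by (simp add: algebra_simps)
  qed
  have Qc: "Q x \<in> bcontfun" for x
  proof (rule bcontfun_normI)
    have "continuous_on {-\<epsilon>..\<epsilon>} (\<lambda>t. integral {-\<epsilon>..t} (\<lambda>s. H (apply_bcontfun x s)))"
      by (rule indefinite_integral_continuous_1[OF int])
    then have "continuous_on UNIV (\<lambda>t. integral {-\<epsilon>..cl t} (\<lambda>s. H (apply_bcontfun x s)))"
      by (rule continuous_on_compose2) (use cl in \<open>auto simp: cl_def intro!: continuous_intros\<close>)
    then show "continuous_on UNIV (Q x)" unfolding Q_def by (intro continuous_intros)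
    show "norm (Q x t) \<le> norm x0 + 3 * \<epsilon> * M" for t
      using Qb[of x t] norm_triangle_ineq[of "Q x t - x0" x0] by simp
  qed
  define P where "P x = Bcontfun (Q x)" for x
  have P: "apply_bcontfun (P x) = Q x" for x unfolding P_def by (rule Bcontfun_inverse[OF Qc])
  have "dist (P x) (P y) \<le> 1 / 2 * dist x y" for x y
  proof (rule dist_bound)
    fix t
    have b: "norm (H (apply_bcontfun x s) - H (apply_bcontfun y s)) \<le> L * dist x y" for s
      using L(2)[of "apply_bcontfun x s" "apply_bcontfun y s"] mult_left_mono[OF dist_bounded[of x s y] L(1)]
      by (simp add: dist_norm)
    have cd: "continuous_on UNIV (\<lambda>s. H (apply_bcontfun x s) - H (apply_bcontfun y s))" by (intro continuous_intros c)
    have "Q x t - Q y t = integral {-\<epsilon>..cl t} (\<lambda>s. H (apply_bcontfun x s) - H (apply_bcontfun y s))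
       - integral {-\<epsilon>..0} (\<lambda>s. H (apply_bcontfun x s) - H (apply_bcontfun y s))"
      unfolding Q_def by (simp add: integral_diff int)
    then have "norm (Q x t - Q y t) \<le> norm (integral {-\<epsilon>..cl t} (\<lambda>s. H (apply_bcontfun x s) - H (apply_bcontfun y s)))
       + norm (integral {-\<epsilon>..0} (\<lambda>s. H (apply_bcontfun x s) - H (apply_bcontfun y s)))"
      by (simp add: norm_triangle_ineq4)
    also have "\<dots> \<le> L * dist x y * (cl t + \<epsilon>) + L * dist x y * (0 + \<epsilon>)"
      using cl[of t] e by (intro add_mono ib b cd) auto
    also have "\<dots> \<le> L * dist x y * (2 * \<epsilon>) + L * dist x y * \<epsilon>"
      using cl[of t] L(1) by (intro add_mono mult_left_mono) auto
    also have "\<dots> = 6 * \<epsilon> * L * (1 / 2 * dist x y)" by (simp add: algebra_simps)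
    also have "\<dots> \<le> 1 * (1 / 2 * dist x y)" by (rule mult_right_mono[OF e(2)]) simp
    finally show "dist (apply_bcontfun (P x) t) (apply_bcontfun (P y) t) \<le> 1 / 2 * dist x y" by (simp add: P dist_norm)
  qed
  then have "\<exists>!x. P x = x" by (intro banach_fix_type[of "1/2"]) auto
  then obtain x where x: "P x = x" by blast
  then have xQ: "apply_bcontfun x t = Q x t" for t using P by metis
  have "(apply_bcontfun x has_vector_derivative H (apply_bcontfun x t)) (at t)" if t: "t \<in> {-\<epsilon><..<\<epsilon>}" for t
  proof -
    have "((\<lambda>t. integral {-\<epsilon>..t} (\<lambda>s. H (apply_bcontfun x s))) has_vector_derivative H (apply_bcontfun x t)) (at t within {-\<epsilon>..\<epsilon>})"
      using t by (intro integral_has_vector_derivative continuous_on_subset[OF c]) auto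
    moreover have "at t within {-\<epsilon>..\<epsilon>} = at t" using t by (intro at_within_interior) simp
    ultimately have "((\<lambda>t. integral {-\<epsilon>..t} (\<lambda>s. H (apply_bcontfun x s))) has_vector_derivative H (apply_bcontfun x t)) (at t)"
      by simp
    then have "((\<lambda>t. x0 + integral {-\<epsilon>..t} (\<lambda>s. H (apply_bcontfun x s)) - integral {-\<epsilon>..0} (\<lambda>s. H (apply_bcontfun x s)))
        has_vector_derivative H (apply_bcontfun x t)) (at t)"
      by (auto intro!: derivative_eq_intros)
    then show ?thesis
    proof (rule has_vector_derivative_transform_within_open[where S="{-\<epsilon><..<\<epsilon>}"])
      fix s assume "s \<in> {-\<epsilon><..<\<epsilon>}"
      then have "cl s = s" by (simp add: cl_def)
      then have "Q x s = x0 + integral {-\<epsilon>..s} (\<lambda>s. H (apply_bcontfun x s)) - integral {-\<epsilon>..0} (\<lambda>s. H (apply_bcontfun x s))"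
        by (simp only: Q_def)
      with xQ[of s] show "x0 + integral {-\<epsilon>..s} (\<lambda>s. H (apply_bcontfun x s)) - integral {-\<epsilon>..0} (\<lambda>s. H (apply_bcontfun x s)) = apply_bcontfun x s"
        by (rule trans[THEN sym])
    qed (use t in auto)
  qed
  moreover have "Q x 0 = x0" using e by (simp add: Q_def cl_def)
  then have "apply_bcontfun x 0 = x0" by (rule trans[OF xQ])
  moreover have "norm (apply_bcontfun x t - x0) \<le> 3 * \<epsilon> * M" for t using Qb[of x t] by (subst xQ)
  ultimately show ?thesis by (intro that[of "apply_bcontfun x"])
qed

text \<open>Composing \<open>F\<close> with the nearest-point projection onto a ball, which does not
  increase distances, yields a globally bounded Lipschitz field. For small \<epsilon> the solution
  stays in the ball, where the projection is the identity.\<close>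

lemma local_ode_solution:
  fixes F :: "'e::euclidean_space \<Rightarrow> 'e"
  assumes "open S" "x0 \<in> S" "Ck_on (Suc 0) S F"
  obtains \<epsilon> x where "\<epsilon> > 0" "x 0 = x0"
    "\<And>t. t \<in> {-\<epsilon><..<\<epsilon>} \<Longrightarrow> x t \<in> S \<and> (x has_vector_derivative F (x t)) (at t)"
proof -
  obtain R where R: "R > 0" "cball x0 R \<subseteq> S" using assms by (meson open_contains_cball)
  obtain L M where LM: "L \<ge> 0" "M \<ge> 0" "\<And>x. x \<in> cball x0 R \<Longrightarrow> norm (F x) \<le> M"
    "\<And>x y. x \<in> cball x0 R \<Longrightarrow> y \<in> cball x0 R \<Longrightarrow> norm (F x - F y) \<le> L * norm (x - y)"
    by (rule C1_lipschitz_bounded[OF assms(3) R(2,1)]) blast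
  define pr where "pr = closest_point (cball x0 R)"
  have ne: "cball x0 R \<noteq> {}" using R by auto
  have pr: "pr x \<in> cball x0 R" for x unfolding pr_def by (rule closest_point_in_set[OF closed_cball ne])
  have prL: "norm (pr x - pr y) \<le> norm (x - y)" for x y
    unfolding pr_def using closest_point_lipschitz[OF convex_cball closed_cball ne, of x y] by (simp add: dist_norm)
  define \<epsilon> where "\<epsilon> = min (1 / (6 * (L + 1))) (R / (3 * (M + 1)))"
  have e: "\<epsilon> > 0" using R LM by (simp add: \<epsilon>_def)
  have "6 * \<epsilon> * L \<le> 6 * (1 / (6 * (L + 1))) * L"
    using LM by (intro mult_right_mono mult_left_mono) (auto simp: \<epsilon>_def)
  also have "\<dots> \<le> 1" using LM by (simp add: field_simps)
  finally have e1: "6 * \<epsilon> * L \<le> 1" .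
  have "3 * \<epsilon> * M \<le> 3 * (R / (3 * (M + 1))) * M"
    using LM by (intro mult_right_mono mult_left_mono) (auto simp: \<epsilon>_def)
  also have "\<dots> \<le> R" using LM R by (simp add: field_simps)
  finally have e2: "3 * \<epsilon> * M \<le> R" .
  have "norm (F (pr x) - F (pr y)) \<le> L * norm (x - y)" for x y
    using LM(4)[OF pr pr, of x y] mult_left_mono[OF prL LM(1), of x y] by linarith
  then obtain x where x: "x 0 = x0" "\<And>t. t \<in> {-\<epsilon><..<\<epsilon>} \<Longrightarrow> (x has_vector_derivative F (pr (x t))) (at t)"
    "\<And>t. norm (x t - x0) \<le> 3 * \<epsilon> * M"
    using picard_lipschitz[of L "\<lambda>x. F (pr x)" M \<epsilon> x0] LM pr e e1 by blast
  have "x t \<in> cball x0 R" for t using x(3)[of t] e2 by (simp add: dist_norm norm_minus_commute)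
  then have "x t \<in> S" "pr (x t) = x t" for t using R by (auto simp: pr_def closest_point_self)
  then show ?thesis using that[of \<epsilon> x] e x by simp
qed

context M3 begin

lemma local_flow:
  obtains \<epsilon> \<alpha> where "\<epsilon> > 0" "\<alpha> 0 = one" "\<And>t. t \<in> {-\<epsilon><..<\<epsilon>} \<Longrightarrow> moves \<alpha> w t"
proof -
  obtain U \<phi> where c: "(U, \<phi>) \<in> A" "one \<in> U" by (rule chart_at)
  have "\<forall>b. \<exists>f N. f \<in> smooth_functions A \<and> open N \<and> one \<in> N \<and> N \<subseteq> U \<and> (\<forall>q\<in>N. f q = \<phi> q \<bullet> b)"
    using coordinate_extension[OF c] by blast
  then obtain X N where X: "\<And>b. X b \<in> smooth_functions A" "\<And>b. open (N b)" "\<And>b. one \<in> N b"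
     "\<And>b. N b \<subseteq> U" "\<And>b q. q \<in> N b \<Longrightarrow> X b q = \<phi> q \<bullet> b" by metis
  define W where "W = U \<inter> (\<Inter>b\<in>Basis. N b)"
  have W: "open W" "one \<in> W" using X c chart(1)[OF c(1)] by (auto simp: W_def intro!: open_INT)
  define S where "S = \<phi> ` (U \<inter> W)"
  have S: "open S" unfolding S_def by (rule open_chart_image[OF c(1) W(1)])
  \<comment> \<open>Equal to \<open>chart_vec\<close> on \<open>S\<close>, but expressed by
    derivatives of smooth functions, which makes its smoothness available.\<close>
  define F where "F x = (\<Sum>b\<in>Basis. fr w (inv_into U \<phi> x) (X b) *\<^sub>R b)" for x
  have Fv: "F x = chart_vec U \<phi> (inv_into U \<phi> x) (fr w (inv_into U \<phi> x))" if "x \<in> S" for x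
  proof -
    obtain q where q: "q \<in> W" "q \<in> U" "x = \<phi> q" using \<open>x \<in> S\<close> unfolding S_def by blast
    have "F x = (\<Sum>b\<in>Basis. (chart_vec U \<phi> q (fr w q) \<bullet> b) *\<^sub>R b)"
      unfolding F_def q(3) chart(5)[OF c(1) q(2)]
    proof (rule sum.cong[OF refl])
      fix b :: "real^3" assume "b \<in> Basis"
      then have "q \<in> N b" using q by (auto simp: W_def)
      then show "fr w q (X b) *\<^sub>R b = (chart_vec U \<phi> q (fr w q) \<bullet> b) *\<^sub>R b"
        using chart_vec_coordinate[OF c(1) X(4,2) _ X(1) X(5) fr_tangent] by simp
    qed
    then show ?thesis using q chart(5)[OF c(1) q(2)] by (simp add: euclidean_representation)
  qed
  have "Ck_on k S F" for k
  proof -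
    have "(\<lambda>p. fr w p (X b)) \<in> smooth_functions A" for b
      by (rule vf_smooth[OF fr_field[OF smooth_vec_const] X(1)])
    then have "Ck_on k S (\<lambda>x. fr w (inv_into U \<phi> x) (X b))" for b
      by (rule Ck_on_subset[OF smooth_functions_Ck[OF _ c(1)]]) (auto simp: S_def)
    then show ?thesis unfolding F_def by (intro Ck_on_sum Ck_on_scaleR Ck_on_const S)
  qed
  moreover have "\<phi> one \<in> S" using c W by (simp add: S_def)
  ultimately obtain \<epsilon> x where x: "\<epsilon> > 0" "x 0 = \<phi> one"
    "\<And>t. t \<in> {-\<epsilon><..<\<epsilon>} \<Longrightarrow> x t \<in> S \<and> (x has_vector_derivative F (x t)) (at t)"
    using local_ode_solution[OF S] by blast
  define \<alpha> where "\<alpha> t = inv_into U \<phi> (x t)" for t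
  show ?thesis
  proof
    show "\<epsilon> > 0" by fact
    show "\<alpha> 0 = one" using c chart(5)[OF c(1)] by (simp add: \<alpha>_def x)
    fix t assume t: "t \<in> {-\<epsilon><..<\<epsilon>}"
    then have xt: "x t \<in> S" "x t \<in> \<phi> ` U" using x(3) by (auto simp: S_def)
    have aU: "\<alpha> t \<in> U" "\<phi> (\<alpha> t) = x t" using chart(7,8)[OF c(1) xt(2)] by (auto simp: \<alpha>_def)
    show "moves \<alpha> w t"
    proof (rule movesI)
      fix f assume f: "f \<in> smooth_functions A"
      let ?f = "\<lambda>y. f (inv_into U \<phi> y)"
      have hd: "(?f has_derivative frechet_derivative ?f (at (x t))) (at (x t))"
        by (rule Ck_on_has_derivative[OF smooth_functions_Ck[OF f c(1)] xt(2)])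
      have "(x has_derivative (\<lambda>h. h *\<^sub>R F (x t))) (at t)"
        using x(3)[OF t] by (simp add: has_vector_derivative_def)
      from has_derivative_compose[OF this hd]
      have "((\<lambda>s. f (\<alpha> s)) has_derivative (\<lambda>h. frechet_derivative ?f (at (x t)) (h *\<^sub>R F (x t)))) (at t)"
        by (simp add: \<alpha>_def)
      moreover have "frechet_derivative ?f (at (x t)) (F (x t)) = fr w (\<alpha> t) f"
        using chart_vec[OF fr_tangent c(1) aU(1) f] Fv[OF xt(1)] aU(2) by (simp add: \<alpha>_def)
      ultimately show "((\<lambda>s. f (\<alpha> s)) has_real_derivative fr w (\<alpha> t) f) (at t)"
        using linear_cmul[OF has_derivative_linear[OF hd]] by (simp add: has_field_derivative_def mult_commute_abs)
    qed
  qed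
qed

lemma Lam_linear: "linear (\<lambda>y. a *\<^sub>R Lam \<kappa> \<tau> x y)"
  by (rule linearI) (simp_all add: vec3_eq_iff Lam_nth algebra_simps)

text \<open>Because \<open>Lam\<close> vanishes on equal arguments, the deviation of
  \<open>rho (c t) w\<close> from \<open>w\<close> solves a linear homogeneous equation with initial
  value 0.\<close>

lemma rho_fixed:
  assumes I: "is_interval I" "0 \<in> I" "t \<in> I" and c: "c 0 = one" "\<And>t. t \<in> I \<Longrightarrow> moves c w t"
  shows "rho (c t) w = w"
proof -
  have "hvd (\<lambda>s. rho (c s) w - w) ((-1) *\<^sub>R Lam \<kappa> \<tau> w (rho (c t) w - w)) t" if "t \<in> I" for t
  proof -
    have "hvd (\<lambda>s. rho (c s) w - w) (- Lam \<kappa> \<tau> w (rho (c t) w) - 0) t"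
      by (rule hvd_diff[OF hvd_rho[OF c(2)[OF that]]]) simp
    moreover have "- Lam \<kappa> \<tau> w (rho (c t) w) - 0 = (-1) *\<^sub>R Lam \<kappa> \<tau> w (rho (c t) w - w)"
      by (simp add: vec3_eq_iff Lam_nth algebra_simps)
    ultimately show ?thesis by (simp only: simp_thms)
  qed
  from linear_ode_zero[OF I Lam_linear this] show ?thesis by (simp add: c(1) rho_one)
qed

lemma moves_reparam:
  assumes "moves c x (h t)" "(h has_real_derivative h') (at t)"
  shows "moves (\<lambda>s. c (h s)) (h' *\<^sub>R x) t"
proof (rule movesI)
  fix f assume "f \<in> smooth_functions A"
  from DERIV_chain2[OF movesD[OF assms(1) this] assms(2)]
  show "((\<lambda>s. f (c (h s))) has_real_derivative fr (h' *\<^sub>R x) (c (h t)) f) (at t)"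
    by (simp add: fr_scale mult.commute)
qed

lemma moves_cong:
  assumes "moves c x t" "open I" "t \<in> I" "\<And>s. s \<in> I \<Longrightarrow> c s = d s" shows "moves d x t"
proof (rule movesI)
  fix f assume "f \<in> smooth_functions A"
  from movesD[OF assms(1) this] have "((\<lambda>s. f (d s)) has_real_derivative fr x (c t) f) (at t)"
    by (rule has_field_derivative_transform_within_open[OF _ assms(2,3)]) (simp add: assms(4))
  then show "((\<lambda>s. f (d s)) has_real_derivative fr x (d t) f) (at t)" by (simp add: assms(3,4))
qed

text \<open>A flow line through the unit is extended by squaring, since \<open>rho (\<alpha> t)\<close> fixes its velocity.\<close>

lemma flow_doubling:
  assumes a: "\<alpha> 0 = one" "\<And>t. t \<in> {-r<..<r} \<Longrightarrow> moves \<alpha> w t" and r: "r > 0"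
  shows "\<exists>\<beta>. \<beta> 0 = one \<and> (\<forall>t\<in>{-(2 * r)<..<2 * r}. moves \<beta> w t)"
proof (intro exI[of _ "\<lambda>t. mul (\<alpha> (t / 2)) (\<alpha> (t / 2))"] conjI ballI)
  show "mul (\<alpha> (0 / 2)) (\<alpha> (0 / 2)) = one" by (simp add: a)
  fix t assume "t \<in> {-(2 * r)<..<2 * r}"
  then have t: "t / 2 \<in> {-r<..<r}" by auto
  have m: "moves (\<lambda>t. \<alpha> (t / 2)) ((1/2) *\<^sub>R w) t"
    by (rule moves_reparam[where c=\<alpha> and h="\<lambda>t. t / 2"]) (rule a(2)[OF t], auto intro!: derivative_eq_intros)
  have "rho (\<alpha> (t / 2)) w = w"
    by (rule rho_fixed[OF _ _ t a]) (use r in auto)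
  then have "rho (\<alpha> (t / 2)) ((1/2) *\<^sub>R w) + (1/2) *\<^sub>R w = w"
    using rho_linear[of "\<alpha> (t / 2)" "1/2" w 0] by (simp add: rfield_zero flip: scaleR_left_distrib)
  then show "moves (\<lambda>t. mul (\<alpha> (t / 2)) (\<alpha> (t / 2))) w t" using moves_mul[OF m m] by simp
qed

text \<open>Repeated doubling gives flow lines on arbitrarily long intervals; by
  \<open>curves_eq\<close> they agree on overlaps and can be glued.\<close>

lemma one_parameter_subgroup_exists: "\<exists>E. E 0 = one \<and> (\<forall>t. moves E w t)"
proof -
  obtain \<epsilon> \<alpha> where e: "\<epsilon> > 0" "\<alpha> 0 = one" "\<And>t. t \<in> {-\<epsilon><..<\<epsilon>} \<Longrightarrow> moves \<alpha> w t"
    by (rule local_flow) blast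
  have "\<exists>\<beta>. \<beta> 0 = one \<and> (\<forall>t\<in>{-(\<epsilon> * 2 ^ n)<..<\<epsilon> * 2 ^ n}. moves \<beta> w t)" for n
  proof (induction n)
    case 0 then show ?case using e by auto
  next
    case (Suc n)
    then obtain \<beta> where b: "\<beta> 0 = one" "\<And>t. t \<in> {-(\<epsilon> * 2 ^ n)<..<\<epsilon> * 2 ^ n} \<Longrightarrow> moves \<beta> w t" by blast
    have "\<epsilon> * 2 ^ n > 0" using e by simp
    from flow_doubling[OF b this] show ?case by (simp add: mult.left_commute)
  qed
  then obtain B where B: "\<And>n. B n 0 = one" "\<And>n t. t \<in> {-(\<epsilon> * 2 ^ n)<..<\<epsilon> * 2 ^ n} \<Longrightarrow> moves (B n) w t" by metis
  have "\<exists>n. \<bar>t\<bar> < \<epsilon> * 2 ^ n" for t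
  proof -
    obtain n where "\<bar>t\<bar> / \<epsilon> < 2 ^ n" using real_arch_pow[of 2 "\<bar>t\<bar> / \<epsilon>"] by auto
    then show ?thesis using e by (auto simp: field_simps)
  qed
  then obtain N where N: "\<And>t. \<bar>t\<bar> < \<epsilon> * 2 ^ N t" by metis
  define E where "E t = B (N t) t" for t
  have eq: "B n t = B m t" if "\<bar>t\<bar> < \<epsilon> * 2 ^ n" "\<bar>t\<bar> < \<epsilon> * 2 ^ m" for n m t
  proof -
    define I where "I = {-min (\<epsilon> * 2 ^ n) (\<epsilon> * 2 ^ m)<..<min (\<epsilon> * 2 ^ n) (\<epsilon> * 2 ^ m)}"
    have I: "open I" "connected I" "0 \<in> I" "t \<in> I"
      using that e by (auto simp: I_def is_interval_connected)
    have "moves (B n) w t" "moves (B m) w t" if "t \<in> I" for t using that by (auto simp: I_def intro!: B)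
    from curves_eq[OF I(1,2) this I(3) _ I(4)] show ?thesis by (simp add: B)
  qed
  have "moves E w t" for t
  proof -
    let ?I = "{-(\<epsilon> * 2 ^ N t)<..<\<epsilon> * 2 ^ N t}"
    have t: "t \<in> ?I" using N[of t] by auto
    show ?thesis
    proof (rule moves_cong[OF B(2)[OF t] open_greaterThanLessThan t])
      fix s assume "s \<in> ?I"
      then show "B (N t) s = E s" unfolding E_def using N[of s] by (intro eq) auto
    qed
  qed
  then show ?thesis using B by (intro exI[of _ E]) (simp add: E_def)
qed

section \<open>The exponential map\<close>

text \<open>\<open>E w t\<close> is exp(t w).\<close>

definition E :: "real^3 \<Rightarrow> real \<Rightarrow> 'a" where
  "E w = (SOME E. E 0 = one \<and> (\<forall>t. moves E w t))"

lemma E: "E w 0 = one" "moves (E w) w t"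
  using someI_ex[OF one_parameter_subgroup_exists[of w]] unfolding E_def by blast+

text \<open>The derivative of \<open>f\<close> along the curve is again a smooth function along it,
  namely \<open>f\<close> differentiated by the left-invariant field \<open>w\<close>. Hence the
  induction on the order.\<close>

lemma smooth_curve_if_moves:
  assumes c: "\<And>t. moves c w t" shows "smooth_curve A c"
proof (rule smooth_curveI)
  show "\<exists>v. has_vel A c v t" for t using c unfolding moves_def by blast
  show "f \<in> smooth_functions A \<Longrightarrow> Ck_on k UNIV (\<lambda>t. f (c t))" for f k
  proof (induction k arbitrary: f)
    case 0
    then show ?case using DERIV_isCont[OF movesD[OF c]] by (auto intro!: continuous_at_imp_continuous_on)
  next
    case (Suc k)
    have "(\<lambda>p. fr w p f) \<in> smooth_functions A" by (rule vf_smooth[OF fr_field[OF smooth_vec_const] Suc.prems])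
    from Ck_on_field_SucI[OF open_UNIV movesD[OF c Suc.prems] Suc.IH[OF this]] show ?case .
  qed
qed

lemma hopf_fiber_E: "hopf_fiber A u (range (\<lambda>s. mul a (E (axis 3 1) s)))"
  unfolding hopf_fiber_def integral_curve_def
proof (intro exI conjI allI)
  have m: "moves (\<lambda>s. mul a (E (axis 3 1) s)) (axis 3 1) t" for t by (rule moves_left[OF E(2)])
  show s: "smooth_curve A (\<lambda>s. mul a (E (axis 3 1) s))" by (rule smooth_curve_if_moves[OF m])
  show "velocity A (\<lambda>s. mul a (E (axis 3 1) s)) t = u 3 (mul a (E (axis 3 1) t))" for t
    using has_vel_unique[OF has_vel_velocity[OF s] m[unfolded moves_def]] by (simp add: u_fr)
qed (rule refl)

text \<open>\<open>rho (E w t)\<close> is Ad(exp(-t w)), and its linear equation has unique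
  solutions. Evaluating it amounts to exhibiting an explicit solution \<open>y\<close>.\<close>

lemma rho_E:
  assumes y: "\<And>t. hvd y (- Lam \<kappa> \<tau> w (y t)) t"
  shows "rho (E w t) (y 0) = y t"
proof -
  have "hvd (\<lambda>s. rho (E w s) (y 0) - y s) ((-1) *\<^sub>R Lam \<kappa> \<tau> w (rho (E w t) (y 0) - y t)) t" for t
  proof -
    have "hvd (\<lambda>s. rho (E w s) (y 0) - y s) (- Lam \<kappa> \<tau> w (rho (E w t) (y 0)) - - Lam \<kappa> \<tau> w (y t)) t"
      by (rule hvd_diff[OF hvd_rho[OF E(2)] y])
    moreover have "- Lam \<kappa> \<tau> w (rho (E w t) (y 0)) - - Lam \<kappa> \<tau> w (y t) = (-1) *\<^sub>R Lam \<kappa> \<tau> w (rho (E w t) (y 0) - y t)"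
      by (simp add: vec3_eq_iff Lam_nth algebra_simps)
    ultimately show ?thesis by (simp only: simp_thms)
  qed
  from linear_ode_zero[OF is_interval_univ UNIV_I UNIV_I Lam_linear this, of 0 t] show ?thesis
    by (simp add: E(1) rho_one)
qed

end

section \<open>Returning to a Hopf fiber\<close>

context M3 begin

lemma moves_E: "(h has_real_derivative h') (at t) \<Longrightarrow> moves (\<lambda>t. E w (h t)) (h' *\<^sub>R w) t"
  by (rule moves_reparam[OF E(2)])

lemma E_add: "E w (s + t) = mul (E w s) (E w t)"
proof (rule curves_eq[OF open_UNIV connected_UNIV, of "\<lambda>t. E w (s + t)" "\<lambda>_. w" "\<lambda>t. mul (E w s) (E w t)" 0 t])
  show "moves (\<lambda>t. E w (s + t)) w t" for t
  proof -
    have "((\<lambda>t. s + t) has_real_derivative 1) (at t)" by (auto intro!: derivative_eq_intros)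
    from moves_E[OF this, of w] show ?thesis by simp
  qed
  show "moves (\<lambda>t. mul (E w s) (E w t)) w t" for t by (rule moves_left[OF E(2)])
qed (simp_all add: E(1))

text \<open>If the adjoint action of \<open>a\<close> is trivial, left and right translates by
  \<open>a\<close> of a one-parameter subgroup have the same body velocity and both start at
  \<open>a\<close>.\<close>

lemma E_commute:
  assumes "\<And>w. rho a w = w" shows "mul (E w s) a = mul a (E w s)"
proof (rule curves_eq[OF open_UNIV connected_UNIV, of "\<lambda>s. mul (E w s) a" "\<lambda>_. w" "\<lambda>s. mul a (E w s)" 0 s])
  show "moves (\<lambda>s. mul (E w s) a) w t" for t using moves_right[OF E(2)[of w t], of a] by (simp add: assms)
  show "moves (\<lambda>s. mul a (E w s)) w t" for t by (rule moves_left[OF E(2)])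
qed (simp_all add: E(1))

lemma rho_E3:
  "rho (E (axis 3 1) t) y = vector [y $ 1 * cos (\<kappa> / \<tau> * t) + y $ 2 * sin (\<kappa> / \<tau> * t),
     y $ 2 * cos (\<kappa> / \<tau> * t) - y $ 1 * sin (\<kappa> / \<tau> * t), y $ 3]"
proof -
  define om where "om = \<kappa> / \<tau>"
  define Y where "Y t = (vector [y $ 1 * cos (om * t) + y $ 2 * sin (om * t),
     y $ 2 * cos (om * t) - y $ 1 * sin (om * t), y $ 3] :: real^3)" for t
  have "hvd Y (- Lam \<kappa> \<tau> (axis 3 1) (Y t)) t" for t
    unfolding forall_3 vector_uminus_component Lam_nth om_def[symmetric] Y_def vector_3
    by (auto simp: axis_def algebra_simps intro!: derivative_eq_intros)
  from rho_E[OF this, of t] have "rho (E (axis 3 1) t) (Y 0) = Y t" .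
  moreover have "Y 0 = y" by (simp add: Y_def vec3_eq_iff)
  ultimately show ?thesis by (simp add: Y_def om_def)
qed

lemma vel_formula:
  assumes \<gamma>: "unit_speed_geodesic A g D \<gamma>" and sl: "\<And>t. vel \<gamma> t $ 3 = c"
  defines "l \<equiv> (\<kappa> / \<tau> - \<tau>) * c"
  shows "vel \<gamma> t = vector [vel \<gamma> 0 $ 1 * cos (l * t) + vel \<gamma> 0 $ 2 * sin (l * t),
     vel \<gamma> 0 $ 2 * cos (l * t) - vel \<gamma> 0 $ 1 * sin (l * t), c]"
proof -
  define Y where "Y t = (vector [vel \<gamma> 0 $ 1 * cos (l * t) + vel \<gamma> 0 $ 2 * sin (l * t),
     vel \<gamma> 0 $ 2 * cos (l * t) - vel \<gamma> 0 $ 1 * sin (l * t), c] :: real^3)" for t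
  define R :: "real^3 \<Rightarrow> real^3" where "R y = vector [l * y $ 2, - l * y $ 1, 0]" for y
  have R: "linear R" by (rule linearI) (simp_all add: R_def vec3_eq_iff algebra_simps)
  have "hvd (\<lambda>s. vel \<gamma> s - Y s) (R (vel \<gamma> t - Y t)) t" for t
  proof -
    have "hvd Y (R (Y t)) t"
      unfolding forall_3 R_def Y_def vector_3 by (auto simp: algebra_simps intro!: derivative_eq_intros)
    moreover have "hvd (vel \<gamma>) (R (vel \<gamma> t)) t"
    proof -
      have "- Gam \<kappa> \<tau> (vel \<gamma> t) (vel \<gamma> t) = R (vel \<gamma> t)"
        unfolding vec3_eq_iff vector_uminus_component Gam_nth R_def vector_3 sl l_def by (simp add: algebra_simps)
      then show ?thesis using geodesic_equation(3)[OF \<gamma>, of t] by (simp only:) simp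
    qed
    ultimately have "hvd (\<lambda>s. vel \<gamma> s - Y s) (R (vel \<gamma> t) - R (Y t)) t" by (intro hvd_diff)
    moreover have "R (vel \<gamma> t) - R (Y t) = R (vel \<gamma> t - Y t)" by (rule linear_diff[OF R, symmetric])
    ultimately show ?thesis by (simp only: simp_thms)
  qed
  from linear_ode_zero[OF is_interval_univ UNIV_I UNIV_I R this, of 0 t]
  have "vel \<gamma> t = Y t" by (simp add: Y_def vec3_eq_iff sl)
  then show ?thesis by (simp add: Y_def)
qed

text \<open>Equal body velocities make \<eta> and \<gamma> differ by a left translation, and left
  translation carries fibers to fibers. So any explicit curve with the right velocity decides the
  matter.\<close>

lemma meets_twice_if_return:
  assumes \<gamma>: "unit_speed_geodesic A g D \<gamma>" and \<eta>: "\<And>t. moves \<eta> (vel \<gamma> t) t"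
    and T: "T \<noteq> 0" "\<eta> T = mul (\<eta> 0) (E (axis 3 1) s)"
  shows "\<not> meets_each_fiber_once A u \<gamma>"
proof -
  have e: "mul (mul (\<gamma> 0) (iv (\<eta> 0))) (\<eta> t) = \<gamma> t" for t
    by (rule curves_eq[OF open_UNIV connected_UNIV moves_left[OF \<eta>] moves_geodesic[OF geodesic_equation(1)[OF \<gamma>]], of 0])
      (simp_all add: mul_assoc)
  let ?F = "range (\<lambda>s. mul (\<gamma> 0) (E (axis 3 1) s))"
  have "\<gamma> T = mul (\<gamma> 0) (E (axis 3 1) s)" unfolding e[of T, symmetric] T(2) by (simp add: mul_assoc)
  then have "\<gamma> T \<in> ?F" by blast
  moreover have "\<gamma> 0 = mul (\<gamma> 0) (E (axis 3 1) 0)" by (simp add: E(1))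
  then have "\<gamma> 0 \<in> ?F" by (rule range_eqI)
  ultimately show ?thesis
    using T(1) hopf_fiber_E[of "\<gamma> 0"] unfolding meets_each_fiber_once_def by metis
qed

text \<open>Conjugates a horizontal direction plus a suitable vertical part to a multiple of \<open>\<xi>\<close>; this needs
  the discriminant \<open>\<kappa> S + (\<tau> c)\<^sup>2\<close> to be positive.\<close>

lemma elliptic_conjugate:
  assumes "\<kappa> \<noteq> 0" and S: "a\<^sup>2 + b\<^sup>2 = S" "S > 0" and k: "k\<^sup>2 = \<kappa> * S + \<tau>\<^sup>2 * c\<^sup>2" "k > 0"
  obtains m n s where "\<bar>m * (\<kappa> / \<tau>)\<bar> = k" "rho (E n s) (m *\<^sub>R axis 3 1) = vector [a, b, c * \<tau>\<^sup>2 / \<kappa>]"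
proof -
  note outer = that
  \<comment> \<open>For negative \<kappa> the solution \<open>X\<close> below is a
    \<open>cosh\<close>, so the sign of \<open>m\<close> has to make \<open>X0\<close>
    nonnegative.\<close>
  define \<sigma> :: real where "\<sigma> = (if c < 0 \<and> \<kappa> < 0 then -1 else 1)"
  have sg: "\<sigma>\<^sup>2 = 1" "\<bar>\<sigma>\<bar> = 1" "\<sigma> \<noteq> 0" by (auto simp: \<sigma>_def)
  \<comment> \<open>The Ad-invariant form \<tau>^2 (y1^2 + y2^2) + \<kappa> y3^2 has the value
    \<kappa> m^2 at \<open>m\<close> times \<xi> and \<tau>^2 k^2 / \<kappa> at the target, which
    determines \<open>m\<close> up to sign.\<close>
  define m where "m = \<sigma> * \<tau> * k / \<kappa>"
  have m: "m \<noteq> 0" "\<bar>m * (\<kappa> / \<tau>)\<bar> = k" using assms(1) tau_pos k sg by (simp_all add: m_def abs_mult)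
  define n where "n = (vector [- b, a, 0] :: real^3)"
  \<comment> \<open>Under the subgroup of the horizontal direction \<open>n\<close>, orthogonal to
    \<open>(a, b)\<close>, the vector \<xi> stays in the plane of \<open>(a, b, 0)\<close> and
    \<xi>. A linear system for two functions remains: trigonometric for positive \<kappa>,
    hyperbolic for negative \<kappa>.\<close>
  have step: thesis
    if AB: "\<And>s. (X has_real_derivative \<tau> * S * Z s) (at s)" "\<And>s. (Z has_real_derivative - (\<kappa> / \<tau>) * X s) (at s)"
      "X 0 = 1" "Z 0 = 0" "m * X s = c * \<tau>\<^sup>2 / \<kappa>" "m * Z s = 1" for X Z :: "real \<Rightarrow> real" and s
  proof -
    define Y where "Y s = (m *\<^sub>R vector [a * Z s, b * Z s, X s] :: real^3)" for s
    have "hvd Y (- Lam \<kappa> \<tau> n (Y s)) s" for s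
      unfolding forall_3 vector_uminus_component Lam_nth Y_def n_def vector_scaleR_component vector_3 S(1)[symmetric]
      using AB(1,2)[of s] S(1) by (auto intro!: derivative_eq_intros simp: algebra_simps power2_eq_square)
    from rho_E[OF this, of s] have "rho (E n s) (Y 0) = Y s" .
    moreover have "Y 0 = m *\<^sub>R axis 3 1" by (simp add: Y_def AB vec3_eq_iff axis_def)
    moreover have "m * (a * Z s) = a" "m * (b * Z s) = b" using AB(6) by (metis mult.left_commute mult.right_neutral)+
    then have "Y s = vector [a, b, c * \<tau>\<^sup>2 / \<kappa>]" using AB(5) by (simp add: Y_def vec3_eq_iff)
    ultimately have "rho (E n s) (m *\<^sub>R axis 3 1) = vector [a, b, c * \<tau>\<^sup>2 / \<kappa>]" by simp
    then show thesis by (rule outer[OF m(2)])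
  qed
  define \<mu> where "\<mu> = sqrt (\<bar>\<kappa>\<bar> * S)"
  have mu: "\<mu> > 0" "\<mu>\<^sup>2 = \<bar>\<kappa>\<bar> * S" using S(2) assms(1) by (simp_all add: \<mu>_def)
  define X0 where "X0 = c * \<tau>\<^sup>2 / (\<kappa> * m)"
  define W0 where "W0 = - (\<mu> * \<tau>) / (\<kappa> * m)"
  have km: "\<kappa> * m = \<sigma> * \<tau> * k" using assms(1) by (simp add: m_def)
  have X0: "X0\<^sup>2 = \<tau>\<^sup>2 * c\<^sup>2 / k\<^sup>2" and W0: "W0\<^sup>2 = \<mu>\<^sup>2 / k\<^sup>2"
    using tau_pos k(2) sg by (simp_all add: X0_def W0_def km power_divide power_mult_distrib field_simps power2_eq_square)
  show thesis
  proof (cases "\<kappa> > 0")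
    case True
    have "X0\<^sup>2 + W0\<^sup>2 = k\<^sup>2 / k\<^sup>2"
      unfolding X0 W0 mu(2) add_divide_distrib[symmetric] k(1) using True by (simp add: add.commute)
    then have "X0\<^sup>2 + W0\<^sup>2 = 1" using k(2) by simp
    then obtain x where x: "X0 = cos x" "W0 = sin x" using sincos_total_2pi by metis
    show thesis
    proof (rule step[of "\<lambda>s. cos (\<mu> * s)" "\<lambda>s. - (\<kappa> / (\<tau> * \<mu>)) * sin (\<mu> * s)" "x / \<mu>"])
      fix s
      show "((\<lambda>s. cos (\<mu> * s)) has_real_derivative \<tau> * S * (- (\<kappa> / (\<tau> * \<mu>)) * sin (\<mu> * s))) (at s)"
        using mu tau_pos True
        by (auto intro!: derivative_eq_intros simp: field_simps power2_eq_square)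
      show "((\<lambda>s. - (\<kappa> / (\<tau> * \<mu>)) * sin (\<mu> * s)) has_real_derivative - (\<kappa> / \<tau>) * cos (\<mu> * s)) (at s)"
        using mu tau_pos by (auto intro!: derivative_eq_intros simp: field_simps)
      show "m * cos (\<mu> * (x / \<mu>)) = c * \<tau>\<^sup>2 / \<kappa>"
        using mu(1) x(1)[symmetric] m(1) True by (simp add: X0_def)
      show "m * (- (\<kappa> / (\<tau> * \<mu>)) * sin (\<mu> * (x / \<mu>))) = 1"
        using mu(1) x(2)[symmetric] m(1) True tau_pos by (simp add: W0_def)
    qed auto
  next
    case False
    then have neg: "\<kappa> < 0" using assms(1) by simp
    have "X0\<^sup>2 = (k\<^sup>2 + \<bar>\<kappa>\<bar> * S) / k\<^sup>2"
      unfolding X0 using neg by (simp add: k(1))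
    then have "X0\<^sup>2 = 1 + W0\<^sup>2" unfolding W0 mu(2) using k(2) by (simp add: add_divide_distrib)
    moreover have "X0 = \<bar>c\<bar> * \<tau>\<^sup>2 / (\<tau> * k)" using neg by (auto simp: X0_def km \<sigma>_def)
    then have "X0 \<ge> 0" using tau_pos k(2) by simp
    ultimately have X1: "X0 = sqrt (1 + W0\<^sup>2)" by (metis real_sqrt_unique)
    define x where "x = arsinh W0"
    have x: "sinh x = W0" "cosh x = X0" by (simp_all add: x_def cosh_arsinh_real X1)
    show thesis
    proof (rule step[of "\<lambda>s. cosh (\<mu> * s)" "\<lambda>s. - (\<kappa> / (\<tau> * \<mu>)) * sinh (\<mu> * s)" "x / \<mu>"])
      fix s
      have "\<tau> * S * (- (\<kappa> / (\<tau> * \<mu>)) * sinh (\<mu> * s)) = \<mu>\<^sup>2 / \<mu> * sinh (\<mu> * s)"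
        unfolding mu(2) using neg tau_pos by simp
      also have "\<dots> = sinh (\<mu> * s) * \<mu>" using mu(1) by (simp add: power2_eq_square)
      finally show "((\<lambda>s. cosh (\<mu> * s)) has_real_derivative \<tau> * S * (- (\<kappa> / (\<tau> * \<mu>)) * sinh (\<mu> * s))) (at s)"
        by (auto intro!: derivative_eq_intros)
      show "((\<lambda>s. - (\<kappa> / (\<tau> * \<mu>)) * sinh (\<mu> * s)) has_real_derivative - (\<kappa> / \<tau>) * cosh (\<mu> * s)) (at s)"
        using mu tau_pos by (auto intro!: derivative_eq_intros simp: field_simps)
      show "m * cosh (\<mu> * (x / \<mu>)) = c * \<tau>\<^sup>2 / \<kappa>"
        using mu(1) x(2) m(1) neg by (simp add: X0_def)
      show "m * (- (\<kappa> / (\<tau> * \<mu>)) * sinh (\<mu> * (x / \<mu>))) = 1"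
        using mu(1) x(1) m(1) neg tau_pos by (simp add: W0_def)
    qed auto
  qed
qed

text \<open>The geodesic is a translate of h^{-1} exp(m t \<xi>) h exp(-\<alpha> t \<xi>). The right
  factor turns the horizontal velocity, which fixes \<alpha> by the required rate
  \<open>(\<kappa> / \<tau> - \<tau>) * c\<close>, and contributes -\<alpha> vertically. The left
  factor must therefore have vertical velocity \<open>c + \<alpha>\<close>; this is the third
  coordinate \<open>c * \<tau>\<^sup>2 / \<kappa>\<close> of the target in
  \<open>elliptic_conjugate\<close>.\<close>

lemma meets_twice_curved:
  assumes "\<kappa> \<noteq> 0" and \<gamma>: "unit_speed_geodesic A g D \<gamma>" and sl: "\<And>t. vel \<gamma> t $ 3 = c" and S: "c\<^sup>2 < 1"
    and k: "k\<^sup>2 = \<kappa> * (1 - c\<^sup>2) + \<tau>\<^sup>2 * c\<^sup>2" "k > 0"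
  shows "\<not> meets_each_fiber_once A u \<gamma>"
proof -
  define a b where "a = vel \<gamma> 0 $ 1" and "b = vel \<gamma> 0 $ 2"
  have ab: "a\<^sup>2 + b\<^sup>2 = 1 - c\<^sup>2" using geodesic_equation(4)[OF \<gamma>, of 0] sl by (simp add: a_def b_def)
  have Sp: "1 - c\<^sup>2 > 0" using S by simp
  obtain m n s where mns: "\<bar>m * (\<kappa> / \<tau>)\<bar> = k" "rho (E n s) (m *\<^sub>R axis 3 1) = vector [a, b, c * \<tau>\<^sup>2 / \<kappa>]"
    by (rule elliptic_conjugate[OF assms(1) ab Sp k]) blast
  define \<alpha> where "\<alpha> = - (\<kappa> / \<tau> - \<tau>) * c * \<tau> / \<kappa>"
  have al: "\<kappa> / \<tau> * (- \<alpha> * t) = (\<kappa> / \<tau> - \<tau>) * c * t" for t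
    using assms(1) tau_pos by (simp add: \<alpha>_def field_simps)
  have ca: "c * \<tau>\<^sup>2 / \<kappa> = c + \<alpha>" using assms(1) tau_pos by (simp add: \<alpha>_def field_simps power2_eq_square)
  define \<xi> :: "real^3" where "\<xi> = axis 3 1"
  define h where "h = E n s"
  define \<eta> where "\<eta> t = mul (mul (iv h) (mul (E \<xi> (m * t)) h)) (E \<xi> (- \<alpha> * t))" for t
  have mv: "moves \<eta> (vel \<gamma> t) t" for t
  proof -
    have "moves (\<lambda>t. E \<xi> (m * t)) (m *\<^sub>R \<xi>) t" by (rule moves_E) (auto intro!: derivative_eq_intros)
    then have "moves (\<lambda>t. mul (iv h) (mul (E \<xi> (m * t)) h)) (rho h (m *\<^sub>R \<xi>)) t"
      by (intro moves_left moves_right)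
    moreover have "moves (\<lambda>t. E \<xi> (- \<alpha> * t)) ((- \<alpha>) *\<^sub>R \<xi>) t" by (rule moves_E) (auto intro!: derivative_eq_intros)
    ultimately have "moves \<eta> (rho (E \<xi> (- \<alpha> * t)) (rho h (m *\<^sub>R \<xi>)) + (- \<alpha>) *\<^sub>R \<xi>) t"
      unfolding \<eta>_def by (rule moves_mul)
    moreover have "rho (E \<xi> (- \<alpha> * t)) (rho h (m *\<^sub>R \<xi>)) + (- \<alpha>) *\<^sub>R \<xi> = vel \<gamma> t"
      unfolding vel_formula[OF \<gamma> sl, of t] h_def \<xi>_def mns(2) rho_E3 al
      by (simp add: vec3_eq_iff a_def b_def ca axis_def)
    ultimately show ?thesis by simp
  qed
  define T where "T = 2 * pi / k"
  have T: "T \<noteq> 0" using k by (simp add: T_def)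
  have "\<kappa> / \<tau> * (m * T) = 2 * pi \<or> \<kappa> / \<tau> * (m * T) = - (2 * pi)"
    using mns(1) k(2) by (auto simp: T_def field_simps abs_if split: if_splits)
  then have "cos (\<kappa> / \<tau> * (m * T)) = 1" "sin (\<kappa> / \<tau> * (m * T)) = 0" by (elim disjE; simp)+
  then have "rho (E \<xi> (m * T)) w = w" for w unfolding \<xi>_def rho_E3 by (simp add: vec3_eq_iff)
  \<comment> \<open>At time \<open>T\<close> the left factor is a full turn about the fiber. It has
    trivial adjoint action, hence commutes with \<open>h\<close>, and only an element of the fiber
    through the unit remains.\<close>
  then have "mul (iv h) (mul (E \<xi> (m * T)) h) = E \<xi> (m * T)"
    by (simp add: h_def flip: E_commute)
  then have "\<eta> T = mul (\<eta> 0) (E \<xi> (m * T + - \<alpha> * T))" by (simp only: \<eta>_def E_add) (simp add: E(1))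
  then show ?thesis using meets_twice_if_return[OF \<gamma> mv T] by (simp add: \<xi>_def)
qed

text \<open>In the Heisenberg group \<xi> is central and no horizontal direction can be conjugated
  into it. Instead the geodesic is written as a product of the three coordinate subgroups. Its first
  two exponents are periodic because the horizontal velocity turns at the rate
  \<open>\<tau> * c\<close>.\<close>

lemma meets_twice_flat:
  assumes "\<kappa> = 0" and \<gamma>: "unit_speed_geodesic A g D \<gamma>" and sl: "\<And>t. vel \<gamma> t $ 3 = c" and c: "c \<noteq> 0"
  shows "\<not> meets_each_fiber_once A u \<gamma>"
proof -
  define a b where "a = vel \<gamma> 0 $ 1" and "b = vel \<gamma> 0 $ 2"
  define v1 v2 where "v1 t = vel \<gamma> t $ 1" and "v2 t = vel \<gamma> t $ 2" for t
  have vS: "(v1 t)\<^sup>2 + (v2 t)\<^sup>2 = 1 - c\<^sup>2" for t using geodesic_equation(4)[OF \<gamma>, of t] sl by (simp add: v1_def v2_def)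
  have dv1: "(v1 has_real_derivative - \<tau> * c * v2 t) (at t)" and dv2: "(v2 has_real_derivative \<tau> * c * v1 t) (at t)" for t
    using spec[OF geodesic_equation(3)[OF \<gamma>], of 1 t] spec[OF geodesic_equation(3)[OF \<gamma>], of 2 t]
    unfolding vector_uminus_component Gam_nth sl assms(1) v1_def[abs_def] v2_def[abs_def]
    by (simp_all add: algebra_simps)
  have per: "v1 (2 * pi / (\<tau> * c)) = v1 0" "v2 (2 * pi / (\<tau> * c)) = v2 0"
    unfolding v1_def v2_def using vel_formula[OF \<gamma> sl, of "2 * pi / (\<tau> * c)"] c tau_pos assms(1) by simp_all
  \<comment> \<open>Primitives of \<open>v1\<close>, \<open>v2\<close> and
    \<open>c - \<tau> * y * v1\<close>, where the last one equals \<open>c + v1^2 / c\<close>. For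
    it, \<open>v1^2\<close> is half of \<open>(1 - c^2) + (v1^2 - v2^2)\<close>, and
    \<open>v1 * v2\<close> has derivative \<open>\<tau> * c * (v1^2 - v2^2)\<close>.\<close>
  define x y z where "x t = v2 t / (\<tau> * c)" and "y t = - v1 t / (\<tau> * c)"
    and "z t = c * t + ((1 - c\<^sup>2) * t + v1 t * v2 t / (\<tau> * c)) / (2 * c)" for t
  have dx: "(x has_real_derivative v1 t) (at t)" and dy: "(y has_real_derivative v2 t) (at t)" for t
    unfolding x_def y_def using c tau_pos by (auto intro!: derivative_eq_intros dv1 dv2)
  have dz: "(z has_real_derivative c - \<tau> * y t * v1 t) (at t)" for t
  proof -
    have "(z has_real_derivative c + ((1 - c\<^sup>2) + (- \<tau> * c * v2 t * v2 t + \<tau> * c * v1 t * v1 t) / (\<tau> * c)) / (2 * c)) (at t)"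
      unfolding z_def
      by (rule DERIV_cong, (rule DERIV_add DERIV_cdivide DERIV_cmult DERIV_ident DERIV_mult dv1 dv2)+,
          simp add: mult.commute mult.left_commute)
    moreover have "c + ((1 - c\<^sup>2) + (- \<tau> * c * v2 t * v2 t + \<tau> * c * v1 t * v1 t) / (\<tau> * c)) / (2 * c) = c - \<tau> * y t * v1 t"
      unfolding vS[of t, symmetric] y_def using c tau_pos by (simp add: field_simps power2_eq_square)
    ultimately show ?thesis by simp
  qed
  define \<eta> where "\<eta> t = mul (mul (E (axis 1 1) (x t)) (E (axis 2 1) (y t))) (E (axis 3 1) (z t))" for t
  have r2: "rho (E (axis 2 1) t) (q *\<^sub>R axis 1 1) = vector [q, 0, \<tau> * q * t]" for t q
  proof -
    define Y where "Y t = (vector [q, 0, \<tau> * q * t] :: real^3)" for t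
    have "hvd Y (- Lam \<kappa> \<tau> (axis 2 1) (Y t)) t" for t
      unfolding forall_3 vector_uminus_component Lam_nth Y_def vector_3 assms(1)
      by (auto simp: axis_def intro!: derivative_eq_intros)
    from rho_E[OF this, of t] have "rho (E (axis 2 1) t) (Y 0) = Y t" .
    moreover have "Y 0 = q *\<^sub>R axis 1 1" by (simp add: Y_def vec3_eq_iff axis_def)
    ultimately show ?thesis by (simp add: Y_def)
  qed
  have mv: "moves \<eta> (vel \<gamma> t) t" for t
  proof -
    have "moves \<eta> (rho (E (axis 3 1) (z t)) (rho (E (axis 2 1) (y t)) (v1 t *\<^sub>R axis 1 1) + v2 t *\<^sub>R axis 2 1)
       + (c - \<tau> * y t * v1 t) *\<^sub>R axis 3 1) t"
      unfolding \<eta>_def by (intro moves_mul moves_E dx dy dz)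
    moreover have "rho (E (axis 3 1) (z t)) (rho (E (axis 2 1) (y t)) (v1 t *\<^sub>R axis 1 1) + v2 t *\<^sub>R axis 2 1)
       + (c - \<tau> * y t * v1 t) *\<^sub>R axis 3 1 = vel \<gamma> t"
      unfolding rho_E3 r2 by (simp add: assms(1) vec3_eq_iff axis_def v1_def v2_def sl)
    ultimately show ?thesis by simp
  qed
  let ?T = "2 * pi / (\<tau> * c)"
  have T: "?T \<noteq> 0" using c tau_pos by simp
  have "\<eta> ?T = mul (\<eta> 0) (E (axis 3 1) (z ?T - z 0))"
    unfolding \<eta>_def x_def y_def per by (simp add: mul_assoc flip: E_add)
  then show ?thesis by (rule meets_twice_if_return[OF \<gamma> mv T])
qed

end

theorem corollary5p5:
  fixes \<kappa> \<tau> \<theta> :: real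
    and G :: "'a::{t2_space, second_countable_topology} monoid"
    and A :: "('a, real^3) atlas"
    and g :: "'a metric"
    and u :: "3 \<Rightarrow> 'a vfield"
    and D :: "'a connection"
    and \<gamma> :: "real \<Rightarrow> 'a"
  assumes "\<tau> > 0" and "\<kappa> \<noteq> \<tau>\<^sup>2"
    and "is_M3 \<kappa> \<tau> G A g u"
    and "levi_civita A g D"
    and "unit_speed_geodesic A g D \<gamma>"
    and "slope_angle A g u \<gamma> \<theta>" and "0 < \<theta>" and "\<theta> < pi"
  shows "(isotropic_geodesic A g D \<gamma> \<longleftrightarrow> no_conjugate_pair A D \<gamma>) \<and>
         (no_conjugate_pair A D \<gamma> \<longleftrightarrow> meets_each_fiber_once A u \<gamma>)"
proof -
  have "smooth_atlas A" using assms(3) unfolding is_M3_def lie_group_def by blast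
  then interpret M3 A \<kappa> \<tau> G g u D using assms by unfold_locales
  define c where "c = cos \<theta>"
  have sl: "vel \<gamma> t $ 3 = c" for t unfolding c_def by (rule slope_vel[OF assms(5,6)])
  have "sin \<theta> > 0" using assms by (intro sin_gt_zero)
  then have S: "c\<^sup>2 < 1" using sin_cos_squared_add[of \<theta>] unfolding c_def
    by (metis add.commute less_add_same_cancel1 zero_less_power)
  define K where "K = \<kappa> * (1 - c\<^sup>2) + \<tau>\<^sup>2 * c\<^sup>2"
  show ?thesis
  proof (cases "K \<le> 0")
    case True
    have n: "no_conjugate_pair A D \<gamma>"
      by (rule no_conjugate_pair_if[OF assms(5) sl S]) (use True in \<open>simp add: K_def\<close>)
    moreover have "meets_each_fiber_once A u \<gamma>"
      by (rule meets_once_if[OF assms(5) sl S]) (use True in \<open>simp add: K_def\<close>)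
    moreover have "isotropic_geodesic A g D \<gamma>"
      using n unfolding isotropic_geodesic_def no_conjugate_pair_def by blast
    ultimately show ?thesis by blast
  next
    case False
    define k where "k = sqrt K"
    have k: "k\<^sup>2 = \<kappa> * (1 - c\<^sup>2) + \<tau>\<^sup>2 * c\<^sup>2" "k > 0" using False by (simp_all add: k_def K_def)
    obtain T where T: "conjugate_along A D \<gamma> 0 T" "sin (k * T) \<noteq> 0"
      by (rule conjugate_point_exists[OF assms(2,5) sl S k]) blast
    have k0: "k \<noteq> 0" using k(2) by simp
    have "\<not> isotropically_conjugate A g D (\<gamma> 0) (\<gamma> T)"
      by (rule killing_zero_off_fiber[OF assms(2,5) sl S k(1) k0 T(2)])
    then have "\<not> isotropic_geodesic A g D \<gamma>" "\<not> no_conjugate_pair A D \<gamma>"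
      using T(1) unfolding isotropic_geodesic_def no_conjugate_pair_def by blast+
    moreover have "\<not> meets_each_fiber_once A u \<gamma>"
    proof (cases "\<kappa> = 0")
      case True
      then have "c \<noteq> 0" using k by auto
      then show ?thesis by (rule meets_twice_flat[OF True assms(5) sl])
    qed (rule meets_twice_curved[OF _ assms(5) sl S k])
    ultimately show ?thesis by blast
  qed
qed

end
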